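(* A left or right Noetherian Hopf algebra $H$ over a field $\Bbbk$ is affine provided that one of the following conditions holds: (a) the coradical $H_{(0)}$ is cocommutative; (b) the Hopf coradical $H_{[0]}$ is commutative; (c) the coradical $H_{(0)}$ is finite-dimensional.
   Context: A $\Bbbk$-algebra is called affine if it is finitely generated as a $\Bbbk$-algebra. The coradical $H_{(0)}$ of a Hopf algebra $H$ is the sum of all simple subcoalgebras of $H$. The Hopf coradical $H_{[0]}$ is the subalgebra of $H$ generated by $H_{(0)}$. The field $\Bbbk$ is arbitrary. *)

theory Defs
  imports Complex_Main "HOL-Library.Poly_Mapping"
begin

section \<open>Free vector spaces and tensor products\<close>

text \<open>The type \<open>'x \<Rightarrow>\<^sub>0 'k\<close> is the vector space over \<open>'k\<close> with basis the type \<open>'x\<close>;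
  the basis vector belonging to \<open>x\<close> is \<open>Poly_Mapping.single x 1\<close>.\<close>

definition free_scale :: "'k::field \<Rightarrow> ('x \<Rightarrow>\<^sub>0 'k) \<Rightarrow> ('x \<Rightarrow>\<^sub>0 'k)" where
  "free_scale c u = Poly_Mapping.map ((*) c) u"

lemma lookup_free_scale: "Poly_Mapping.lookup (free_scale c u) x = c * Poly_Mapping.lookup u x"
  unfolding free_scale_def by (simp add: Poly_Mapping.map.rep_eq when_def)

lemma vector_space_free_scale: "vector_space (free_scale :: 'k::field \<Rightarrow> ('x \<Rightarrow>\<^sub>0 'k) \<Rightarrow> _)"
  by unfold_locales
    (auto intro!: poly_mapping_eqI simp: lookup_free_scale Poly_Mapping.lookup_add algebra_simps)

text \<open>The linear extension of a map \<open>f\<close> from the basis \<open>'x\<close> to a vector space.\<close>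

definition lin_ext ::
  "('k::field \<Rightarrow> 'v::ab_group_add \<Rightarrow> 'v) \<Rightarrow> ('x \<Rightarrow> 'v) \<Rightarrow> ('x \<Rightarrow>\<^sub>0 'k) \<Rightarrow> 'v" where
  "lin_ext s f u = (\<Sum>x\<in>Poly_Mapping.keys u. s (Poly_Mapping.lookup u x) (f x))"

text \<open>
  Let \<open>s\<close> be the scalar multiplication of a vector space on the type \<open>'h\<close>. The tensor power
  \<open>H \<otimes> H\<close> (respectively \<open>H \<otimes> H \<otimes> H\<close>) is the quotient of the free vector space on
  \<open>'h \<times> 'h\<close> (respectively \<open>'h \<times> 'h \<times> 'h\<close>) by the subspace spanned by the multilinearity
  relations. A slot is a map \<open>'h \<Rightarrow> 'x\<close> that inserts its argument in one position and keeps
  the other positions fixed; the relations say that every slot becomes linear.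
\<close>

definition slot_relations ::
  "('k::field \<Rightarrow> 'h::ab_group_add \<Rightarrow> 'h) \<Rightarrow> ('h \<Rightarrow> 'x) set \<Rightarrow> ('x \<Rightarrow>\<^sub>0 'k) set" where
  "slot_relations s \<Sigma> = module.span free_scale
     ({Poly_Mapping.single (\<sigma> (a + b)) 1 - Poly_Mapping.single (\<sigma> a) 1
         - Poly_Mapping.single (\<sigma> b) 1 | \<sigma> a b. \<sigma> \<in> \<Sigma>}
      \<union> {Poly_Mapping.single (\<sigma> (s c a)) 1 - free_scale c (Poly_Mapping.single (\<sigma> a) 1)
         | \<sigma> c a. \<sigma> \<in> \<Sigma>})"

definition slots2 :: "('h \<Rightarrow> 'h \<times> 'h) set" where
  "slots2 = {\<lambda>x. (x, b) | b. True} \<union> {\<lambda>x. (a, x) | a. True}"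

definition slots3 :: "('h \<Rightarrow> 'h \<times> 'h \<times> 'h) set" where
  "slots3 = {\<lambda>x. (x, b, c) | b c. True} \<union> {\<lambda>x. (a, x, c) | a c. True}
     \<union> {\<lambda>x. (a, b, x) | a b. True}"

text \<open>Elements of the tensor powers are cosets of the subspace of relations.\<close>

definition tensor_class2 ::
  "('k::field \<Rightarrow> 'h::ab_group_add \<Rightarrow> 'h) \<Rightarrow> ('h \<times> 'h \<Rightarrow>\<^sub>0 'k) \<Rightarrow> ('h \<times> 'h \<Rightarrow>\<^sub>0 'k) set" where
  "tensor_class2 s u = {v. v - u \<in> slot_relations s slots2}"

definition tensor_class3 ::
  "('k::field \<Rightarrow> 'h::ab_group_add \<Rightarrow> 'h) \<Rightarrow> ('h \<times> 'h \<times> 'h \<Rightarrow>\<^sub>0 'k)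
    \<Rightarrow> ('h \<times> 'h \<times> 'h \<Rightarrow>\<^sub>0 'k) set" where
  "tensor_class3 s u = {v. v - u \<in> slot_relations s slots3}"

definition tensor_square ::
  "('k::field \<Rightarrow> 'h::ab_group_add \<Rightarrow> 'h) \<Rightarrow> ('h \<times> 'h \<Rightarrow>\<^sub>0 'k) set set" where
  "tensor_square s = range (tensor_class2 s)"

text \<open>A representative of a coset. The operations below that are defined through it do not
  depend on the choice on elements of \<^const>\<open>tensor_square\<close>; for \<open>tensor_lift\<close> this needs
  \<open>f\<close> bilinear, and for \<open>tensor_left\<close> and \<open>tensor_right\<close> it needs \<open>D\<close> linear with values
  in \<^const>\<open>tensor_square\<close>.\<close>

definition coset_rep :: "'v set \<Rightarrow> 'v" where
  "coset_rep X = (SOME u. u \<in> X)"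

definition tensor_add ::
  "('k::field \<Rightarrow> 'h::ab_group_add \<Rightarrow> 'h)
    \<Rightarrow> ('h \<times> 'h \<Rightarrow>\<^sub>0 'k) set \<Rightarrow> ('h \<times> 'h \<Rightarrow>\<^sub>0 'k) set \<Rightarrow> ('h \<times> 'h \<Rightarrow>\<^sub>0 'k) set" where
  "tensor_add s X Y = tensor_class2 s (coset_rep X + coset_rep Y)"

definition tensor_scale ::
  "('k::field \<Rightarrow> 'h::ab_group_add \<Rightarrow> 'h)
    \<Rightarrow> 'k \<Rightarrow> ('h \<times> 'h \<Rightarrow>\<^sub>0 'k) set \<Rightarrow> ('h \<times> 'h \<Rightarrow>\<^sub>0 'k) set" where
  "tensor_scale s c X = tensor_class2 s (free_scale c (coset_rep X))"

text \<open>\<open>(a \<otimes> b) (c \<otimes> d) = a c \<otimes> b d\<close>\<close>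

definition tensor_mult ::
  "('k::field \<Rightarrow> 'h::ring_1 \<Rightarrow> 'h)
    \<Rightarrow> ('h \<times> 'h \<Rightarrow>\<^sub>0 'k) set \<Rightarrow> ('h \<times> 'h \<Rightarrow>\<^sub>0 'k) set \<Rightarrow> ('h \<times> 'h \<Rightarrow>\<^sub>0 'k) set" where
  "tensor_mult s X Y = tensor_class2 s
     (lin_ext free_scale (\<lambda>(a, b).
        lin_ext free_scale (\<lambda>(c, d). Poly_Mapping.single (a * c, b * d) 1) (coset_rep Y))
      (coset_rep X))"

text \<open>The flip \<open>a \<otimes> b \<mapsto> b \<otimes> a\<close>.\<close>

definition tensor_flip ::
  "('k::field \<Rightarrow> 'h::ab_group_add \<Rightarrow> 'h) \<Rightarrow> ('h \<times> 'h \<Rightarrow>\<^sub>0 'k) set \<Rightarrow> ('h \<times> 'h \<Rightarrow>\<^sub>0 'k) set" where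
  "tensor_flip s X = tensor_class2 s
     (lin_ext free_scale (\<lambda>(a, b). Poly_Mapping.single (b, a) 1) (coset_rep X))"

text \<open>The linear map \<open>H \<otimes> H \<rightarrow> H\<close> induced by a bilinear map \<open>f\<close>.\<close>

definition tensor_lift ::
  "('k::field \<Rightarrow> 'h::ab_group_add \<Rightarrow> 'h) \<Rightarrow> ('h \<Rightarrow> 'h \<Rightarrow> 'h) \<Rightarrow> ('h \<times> 'h \<Rightarrow>\<^sub>0 'k) set \<Rightarrow> 'h" where
  "tensor_lift s f X = lin_ext s (\<lambda>(a, b). f a b) (coset_rep X)"

text \<open>The maps \<open>D \<otimes> id\<close> and \<open>id \<otimes> D\<close> from \<open>H \<otimes> H\<close> to \<open>H \<otimes> H \<otimes> H\<close>, for a linear map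
  \<open>D\<close> from \<open>H\<close> to \<open>H \<otimes> H\<close>.\<close>

definition tensor_left ::
  "('k::field \<Rightarrow> 'h::ab_group_add \<Rightarrow> 'h) \<Rightarrow> ('h \<Rightarrow> ('h \<times> 'h \<Rightarrow>\<^sub>0 'k) set)
    \<Rightarrow> ('h \<times> 'h \<Rightarrow>\<^sub>0 'k) set \<Rightarrow> ('h \<times> 'h \<times> 'h \<Rightarrow>\<^sub>0 'k) set" where
  "tensor_left s D X = tensor_class3 s
     (lin_ext free_scale (\<lambda>(a, b).
        lin_ext free_scale (\<lambda>(p, q). Poly_Mapping.single (p, q, b) 1) (coset_rep (D a)))
      (coset_rep X))"

definition tensor_right ::
  "('k::field \<Rightarrow> 'h::ab_group_add \<Rightarrow> 'h) \<Rightarrow> ('h \<Rightarrow> ('h \<times> 'h \<Rightarrow>\<^sub>0 'k) set)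
    \<Rightarrow> ('h \<times> 'h \<Rightarrow>\<^sub>0 'k) set \<Rightarrow> ('h \<times> 'h \<times> 'h \<Rightarrow>\<^sub>0 'k) set" where
  "tensor_right s D X = tensor_class3 s
     (lin_ext free_scale (\<lambda>(a, b).
        lin_ext free_scale (\<lambda>(p, q). Poly_Mapping.single (a, p, q) 1) (coset_rep (D b)))
      (coset_rep X))"

text \<open>The image of \<open>C \<otimes> C\<close> in \<open>H \<otimes> H\<close> for a subset (in practice a subspace) \<open>C\<close> of \<open>H\<close>.\<close>

definition sub_tensor_square ::
  "('k::field \<Rightarrow> 'h::ab_group_add \<Rightarrow> 'h) \<Rightarrow> 'h set \<Rightarrow> ('h \<times> 'h \<Rightarrow>\<^sub>0 'k) set set" where
  "sub_tensor_square s C = tensor_class2 s `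
     module.span free_scale ((\<lambda>x. Poly_Mapping.single x 1) ` (C \<times> C))"


section \<open>Algebras\<close>

locale k_algebra = vector_space scale
  for scale :: "'k::field \<Rightarrow> 'h::ring_1 \<Rightarrow> 'h" +
  assumes scale_mult_left: "scale c x * y = scale c (x * y)"
    and scale_mult_right: "x * scale c y = scale c (x * y)"
begin

definition subalgebra :: "'h set \<Rightarrow> bool" where
  "subalgebra A \<longleftrightarrow> subspace A \<and> 1 \<in> A \<and> (\<forall>x\<in>A. \<forall>y\<in>A. x * y \<in> A)"

definition affine_algebra :: bool where
  "affine_algebra \<longleftrightarrow> (\<exists>G. finite G \<and> subalgebra hull G = UNIV)"

end

definition left_ideal :: "'h::ring_1 set \<Rightarrow> bool" where
  "left_ideal I \<longleftrightarrow> 0 \<in> I \<and> (\<forall>x\<in>I. \<forall>y\<in>I. x + y \<in> I) \<and> (\<forall>r. \<forall>x\<in>I. r * x \<in> I)"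

definition right_ideal :: "'h::ring_1 set \<Rightarrow> bool" where
  "right_ideal I \<longleftrightarrow> 0 \<in> I \<and> (\<forall>x\<in>I. \<forall>y\<in>I. x + y \<in> I) \<and> (\<forall>r. \<forall>x\<in>I. x * r \<in> I)"

text \<open>Ascending chain condition on left (respectively right) ideals of the ring \<open>'h\<close>.\<close>

definition left_noetherian :: "'h::ring_1 itself \<Rightarrow> bool" where
  "left_noetherian _ \<longleftrightarrow>
     (\<forall>I :: nat \<Rightarrow> 'h set. (\<forall>n. left_ideal (I n)) \<and> mono I \<longrightarrow> (\<exists>m. \<forall>n\<ge>m. I n = I m))"

definition right_noetherian :: "'h::ring_1 itself \<Rightarrow> bool" where
  "right_noetherian _ \<longleftrightarrow>
     (\<forall>I :: nat \<Rightarrow> 'h set. (\<forall>n. right_ideal (I n)) \<and> mono I \<longrightarrow> (\<exists>m. \<forall>n\<ge>m. I n = I m))"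


section \<open>Coalgebras\<close>

locale k_coalgebra = vector_space scale
  for scale :: "'k::field \<Rightarrow> 'h::ab_group_add \<Rightarrow> 'h" +
  fixes comult :: "'h \<Rightarrow> ('h \<times> 'h \<Rightarrow>\<^sub>0 'k) set"
    and counit :: "'h \<Rightarrow> 'k"
  assumes comult_in: "comult x \<in> tensor_square scale"
    and comult_add: "comult (x + y) = tensor_add scale (comult x) (comult y)"
    and comult_scale: "comult (scale c x) = tensor_scale scale c (comult x)"
    and counit_linear: "Vector_Spaces.linear scale (*) counit"
    and coassoc:
      "tensor_left scale comult (comult x) = tensor_right scale comult (comult x)"
    and counit_left: "tensor_lift scale (\<lambda>a b. scale (counit a) b) (comult x) = x"
    and counit_right: "tensor_lift scale (\<lambda>a b. scale (counit b) a) (comult x) = x"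
begin

definition subcoalgebra :: "'h set \<Rightarrow> bool" where
  "subcoalgebra C \<longleftrightarrow> subspace C \<and> comult ` C \<subseteq> sub_tensor_square scale C"

definition simple_subcoalgebra :: "'h set \<Rightarrow> bool" where
  "simple_subcoalgebra C \<longleftrightarrow> subcoalgebra C \<and> C \<noteq> {0} \<and>
     (\<forall>D. subcoalgebra D \<and> D \<subseteq> C \<longrightarrow> D = {0} \<or> D = C)"

definition coradical :: "'h set" where
  "coradical = span (\<Union> {C. simple_subcoalgebra C})"

text \<open>For a subcoalgebra \<open>C\<close> the equation may be checked in \<open>H \<otimes> H\<close>, since over a field
  \<open>C \<otimes> C\<close> embeds in \<open>H \<otimes> H\<close>.\<close>

definition cocommutative_on :: "'h set \<Rightarrow> bool" where
  "cocommutative_on C \<longleftrightarrow> (\<forall>x\<in>C. tensor_flip scale (comult x) = comult x)"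

end


section \<open>Hopf algebras\<close>

locale hopf_algebra = k_algebra scale + k_coalgebra scale comult counit
  for scale :: "'k::field \<Rightarrow> 'h::ring_1 \<Rightarrow> 'h"
    and comult :: "'h \<Rightarrow> ('h \<times> 'h \<Rightarrow>\<^sub>0 'k) set"
    and counit :: "'h \<Rightarrow> 'k" +
  fixes antipode :: "'h \<Rightarrow> 'h"
  assumes comult_mult: "comult (x * y) = tensor_mult scale (comult x) (comult y)"
    and comult_one: "comult 1 = tensor_class2 scale (Poly_Mapping.single (1, 1) 1)"
    and counit_mult: "counit (x * y) = counit x * counit y"
    and counit_one: "counit 1 = 1"
    and antipode_linear: "Vector_Spaces.linear scale scale antipode"
    and antipode_left:
      "tensor_lift scale (\<lambda>a b. antipode a * b) (comult x) = scale (counit x) 1"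
    and antipode_right:
      "tensor_lift scale (\<lambda>a b. a * antipode b) (comult x) = scale (counit x) 1"
begin

definition hopf_coradical :: "'h set" where
  "hopf_coradical = subalgebra hull coradical"

end

end

theory Submission
  imports Defs
begin

text \<open>
  Let \<open>B\<close> be the subalgebra generated by the coradical and its image under the antipode; it is a
  Hopf subalgebra. The successive quotients of the wedge filtration of \<open>H\<close> over \<open>B\<close> are Hopf
  modules, hence free over \<open>B\<close>. Therefore \<open>HT \<inter> B = BT\<close> for \<open>T \<subseteq> B\<close>, and a Hopf subalgebra
  \<open>K \<supseteq> B\<close> with \<open>HK\<^sup>+ = H\<^sup>+\<close> equals \<open>H\<close>. As \<open>H\<^sup>+\<close> is finitely generated as a left ideal and
  every element lies in a finite-dimensional subcoalgebra, \<open>H\<close> is affine as soon as \<open>B\<close> is, which is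
  clear in case (c). In cases (a) and (b) the algebra \<open>B\<close> is cocommutative, respectively
  commutative. Generators of the left ideal \<open>HB\<^sup>+\<close> taken in \<open>B\<^sup>+\<close> lie in an affine Hopf subalgebra
  \<open>A \<subseteq> B\<close> with \<open>BA\<^sup>+ = B\<^sup>+\<close>, and it remains to see that this forces \<open>A = B\<close>. For commutative \<open>B\<close>
  one finds a nonzero element of \<open>A\<close> that multiplies a given subcoalgebra into \<open>A\<close>; for
  cocommutative \<open>B\<close> a Fitting decomposition shows that \<open>A\<close> contains the coradical.
\<close>

section \<open>Linear algebra\<close>

text \<open>The first half rests on \<open>K\<close> containing the coradical: only then do the
  wedge powers of \<open>K\<close> exhaust \<open>H\<close>, so that freeness of the quotients
  suffices. The affine algebra \<open>A\<close> inside \<open>B\<close> need not contain the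
  coradical, so no such filtration relates \<open>A\<close> to \<open>B\<close>, and
  \<open>A = B\<close> has to come from commutativity or cocommutativity. The same distinction
  governs stability under the antipode. It is automatic for a subalgebra generated by a subcoalgebra
  as soon as it contains the coradical and the antipode image of the coradical; this image is
  adjoined to \<open>B\<close> because the antipode is not known to preserve the coradical. The
  algebra \<open>A\<close> is instead generated by a subcoalgebra together with its antipode image,
  which works because the antipode is an involution on \<open>B\<close>. Tensors are handled by
  duality: conditions on the coproduct of \<open>x\<close> become conditions on the elements
  obtained by contracting one leg with a linear form, and the arguments are about modules over the
  dual algebra.\<close>

locale linear_space = vector_space scale
  for scale :: "'k::field \<Rightarrow> 'h::ab_group_add \<Rightarrow> 'h"
begin

abbreviation lin :: "('h \<Rightarrow> 'h) \<Rightarrow> bool" where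
  "lin \<equiv> Vector_Spaces.linear scale scale"

abbreviation lform :: "('h \<Rightarrow> 'k) \<Rightarrow> bool" where
  "lform \<equiv> Vector_Spaces.linear scale (*)"

lemma lin_iff: "lin f \<longleftrightarrow> (\<forall>x y. f (x + y) = f x + f y) \<and> (\<forall>c x. f (scale c x) = scale c (f x))"
  unfolding Vector_Spaces.linear_iff using vector_space_axioms by auto

lemma vector_space_field: "vector_space ((*) :: 'k \<Rightarrow> 'k \<Rightarrow> 'k)"
  by unfold_locales (auto simp: algebra_simps)

lemma lform_iff: "lform f \<longleftrightarrow> (\<forall>x y. f (x + y) = f x + f y) \<and> (\<forall>c x. f (scale c x) = c * f x)"
  unfolding Vector_Spaces.linear_iff using vector_space_axioms vector_space_field by auto

lemma lin_add: "lin f \<Longrightarrow> f (x + y) = f x + f y"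
  and lin_scale: "lin f \<Longrightarrow> f (scale c x) = scale c (f x)"
  by (auto simp: lin_iff)

lemma lform_add: "lform \<phi> \<Longrightarrow> \<phi> (x + y) = \<phi> x + \<phi> y"
  and lform_scale: "lform \<phi> \<Longrightarrow> \<phi> (scale c x) = c * \<phi> x"
  by (auto simp: lform_iff)

lemma lin_0: "lin f \<Longrightarrow> f 0 = 0"
  using lin_scale[of f 0 0] by simp

lemma lform_0: "lform \<phi> \<Longrightarrow> \<phi> 0 = 0"
  using lform_scale[of \<phi> 0 0] by simp

lemma lin_diff: "lin f \<Longrightarrow> f (x - y) = f x - f y"
  using lin_add[of f "x - y" y] by simp

lemma lform_diff: "lform \<phi> \<Longrightarrow> \<phi> (x - y) = \<phi> x - \<phi> y"
  using lform_add[of \<phi> "x - y" y] by simp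

lemma lin_sum: "lin f \<Longrightarrow> f (sum g I) = (\<Sum>i\<in>I. f (g i))"
  by (induction I rule: infinite_finite_induct) (auto simp: lin_0 lin_add)

lemma lform_sum: "lform \<phi> \<Longrightarrow> \<phi> (sum g I) = (\<Sum>i\<in>I. \<phi> (g i))"
  by (induction I rule: infinite_finite_induct) (auto simp: lform_0 lform_add)

lemma lin_sum_list: "lin f \<Longrightarrow> f (sum_list xs) = (\<Sum>x\<leftarrow>xs. f x)"
  by (induction xs) (auto simp: lin_0 lin_add)

lemma lform_sum_list: "lform \<phi> \<Longrightarrow> \<phi> (sum_list xs) = (\<Sum>x\<leftarrow>xs. \<phi> x)"
  by (induction xs) (auto simp: lform_0 lform_add)

lemma subspace_sum_list: "subspace W \<Longrightarrow> (\<And>x. x \<in> set xs \<Longrightarrow> f x \<in> W) \<Longrightarrow> (\<Sum>x\<leftarrow>xs. f x) \<in> W"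
  by (induction xs) (auto intro: subspace_0 subspace_add)

lemma subspace_kernel: "lin f \<Longrightarrow> subspace {x. f x = 0}"
  by (auto simp: subspace_def lin_0 lin_add lin_scale)

lemma subspace_lin_vimage: "lin f \<Longrightarrow> subspace W \<Longrightarrow> subspace {x. f x \<in> W}"
  by (auto simp: subspace_def lin_0 lin_add lin_scale)

lemma subspace_lin_image: "lin f \<Longrightarrow> subspace W \<Longrightarrow> subspace (f ` W)"
  unfolding subspace_def
  by (auto simp: image_iff) (metis lin_0, metis lin_add, metis lin_scale)

lemma subspace_lform_kernel: "lform f \<Longrightarrow> subspace {x. f x = 0}"
  by (auto simp: subspace_def lform_0 lform_add lform_scale)

section \<open>Projections and separating linear forms\<close>

definition proj :: "'h set \<Rightarrow> 'h \<Rightarrow> 'h" where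
  "proj W = (SOME p. lin p \<and> range p \<subseteq> W \<and> (\<forall>x\<in>W. p x = x))"

text \<open>A left inverse of the identity on \<open>W\<close> gives a total map. This lets
  identities valid only on a subspace be written with maps that are \<open>bilin\<close> on the
  whole type.\<close>

lemma proj_props:
  assumes "subspace W"
  shows lin_proj: "lin (proj W)"
    and proj_in: "proj W x \<in> W"
    and proj_id: "x \<in> W \<Longrightarrow> proj W x = x"
proof -
  interpret vector_space_pair scale scale ..
  have "lin id" by (simp add: lin_iff)
  from linear_exists_left_inverse_on[OF this assms]
  have "\<exists>p. lin p \<and> range p \<subseteq> W \<and> (\<forall>x\<in>W. p x = x)" by auto
  from someI_ex[OF this] have "lin (proj W) \<and> range (proj W) \<subseteq> W \<and> (\<forall>x\<in>W. proj W x = x)"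
    unfolding proj_def .
  then show "lin (proj W)" "proj W x \<in> W" "x \<in> W \<Longrightarrow> proj W x = x" by auto
qed

lemma lform_extend:
  assumes "independent B"
  obtains \<phi> where "lform \<phi>" "\<And>b. b \<in> B \<Longrightarrow> \<phi> b = f b"
proof -
  interpret f: vector_space "(*) :: 'k \<Rightarrow> 'k \<Rightarrow> 'k" by (rule vector_space_field)
  interpret vector_space_pair scale "(*)" ..
  from linear_independent_extend[OF assms] show ?thesis using that by blast
qed

lemma lform_separate:
  assumes W: "subspace W" and x: "x \<notin> W"
  obtains \<phi> where "lform \<phi>" "\<And>w. w \<in> W \<Longrightarrow> \<phi> w = 0" "\<phi> x = 1"
proof -
  let ?y = "x - proj W x"
  have "?y \<noteq> 0" using x proj_in[OF W, of x] by auto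
  then have "independent {?y}" by simp
  then obtain \<psi> where \<psi>: "lform \<psi>" "\<psi> ?y = 1" by (rule lform_extend[of _ "\<lambda>_. 1"]) auto
  show ?thesis
  proof (rule that[of "\<lambda>z. \<psi> (z - proj W z)"])
    show "lform (\<lambda>z. \<psi> (z - proj W z))"
      unfolding lform_iff using \<psi>(1) lin_proj[OF W]
      by (simp add: lin_add lin_scale lform_add lform_scale lform_diff right_diff_distrib)
  qed (use \<psi> proj_id[OF W] in \<open>auto simp: lform_0\<close>)
qed

lemma lform_determined:
  assumes "\<And>\<phi>. lform \<phi> \<Longrightarrow> \<phi> x = \<phi> y"
  shows "x = y"
proof (rule ccontr)
  assume "x \<noteq> y"
  then have "x - y \<notin> {0}" by simp
  then obtain \<phi> where "lform \<phi>" "\<phi> (x - y) = 1"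
    using lform_separate[OF subspace_single_0] by metis
  then show False using assms[of \<phi>] by (simp add: lform_diff)
qed

section \<open>Multilinear maps into the space itself\<close>

definition bilin :: "('h \<Rightarrow> 'h \<Rightarrow> 'h) \<Rightarrow> bool" where
  "bilin G \<longleftrightarrow> (\<forall>b. lin (\<lambda>a. G a b)) \<and> (\<forall>a. lin (\<lambda>b. G a b))"

definition trilin :: "('h \<Rightarrow> 'h \<Rightarrow> 'h \<Rightarrow> 'h) \<Rightarrow> bool" where
  "trilin G \<longleftrightarrow> (\<forall>b c. lin (\<lambda>a. G a b c)) \<and> (\<forall>a c. lin (\<lambda>b. G a b c)) \<and> (\<forall>a b. lin (\<lambda>c. G a b c))"

lemma bilinI: "(\<And>b. lin (\<lambda>a. G a b)) \<Longrightarrow> (\<And>a. lin (\<lambda>b. G a b)) \<Longrightarrow> bilin G"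
  by (auto simp: bilin_def)

lemma trilinI: "(\<And>b c. lin (\<lambda>a. G a b c)) \<Longrightarrow> (\<And>a c. lin (\<lambda>b. G a b c)) \<Longrightarrow>
    (\<And>a b. lin (\<lambda>c. G a b c)) \<Longrightarrow> trilin G"
  by (auto simp: trilin_def)

lemma bilinD: assumes "bilin G" shows "lin (\<lambda>a. G a b)" "lin (\<lambda>b. G a b)"
  using assms by (auto simp: bilin_def)

text \<open>Only finitely many coordinates of one basis of the whole space occur on a finite set.
  The coordinates are linear forms on everything, so they can act on coproducts.\<close>

lemma basis_expansion:
  assumes "finite Y"
  obtains F r where "finite F" "\<And>\<beta>. lform (r \<beta>)" "\<And>y. y \<in> Y \<Longrightarrow> y = (\<Sum>\<beta>\<in>F. scale (r \<beta> y) \<beta>)"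
proof -
  let ?B = "extend_basis {}"
  have B: "independent ?B" "span ?B = UNIV"
    using independent_extend_basis[OF independent_empty] span_extend_basis[OF independent_empty] by auto
  let ?F = "\<Union>y\<in>Y. {b. representation ?B y b \<noteq> 0}"
  have fin: "finite ?F" using assms finite_representation by blast
  have "y = (\<Sum>\<beta>\<in>?F. scale (representation ?B y \<beta>) \<beta>)" if "y \<in> Y" for y
  proof -
    have "y = (\<Sum>b | representation ?B y b \<noteq> 0. scale (representation ?B y b) b)"
      using sum_nonzero_representation_eq[OF B(1), of y] B(2) by simp
    also have "\<dots> = (\<Sum>\<beta>\<in>?F. scale (representation ?B y \<beta>) \<beta>)"
      by (rule sum.mono_neutral_left) (use that fin in auto)
    finally show ?thesis .
  qed
  moreover have "lform (\<lambda>y. representation ?B y \<beta>)" for \<beta>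
    using linear_representation[OF B] .
  ultimately show ?thesis using fin that[of ?F "\<lambda>b y. representation ?B y b"] by blast
qed

section \<open>Finite-dimensional subsets\<close>

lemma span_finite_subset:
  assumes "x \<in> span T"
  shows "\<exists>T'. finite T' \<and> T' \<subseteq> T \<and> x \<in> span T'"
proof -
  obtain t r where "finite t" "t \<subseteq> T" "x = (\<Sum>a\<in>t. scale (r a) a)"
    using assms unfolding span_explicit by auto
  then show ?thesis by (intro exI[of _ t]) (auto intro: span_sum span_scale span_base)
qed

text \<open>Phrased by containment, so that it passes to arbitrary subsets. \<open>dim\<close> alone
  cannot express finiteness, being 0 for infinite-dimensional spaces as well.\<close>

definition findim :: "'h set \<Rightarrow> bool" where
  "findim V \<longleftrightarrow> (\<exists>B. finite B \<and> V \<subseteq> span B)"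

lemma findim_mono: "findim W \<Longrightarrow> V \<subseteq> W \<Longrightarrow> findim V"
  unfolding findim_def by blast

lemma findim_basis:
  assumes "subspace V" "findim V"
  obtains B where "finite B" "B \<subseteq> V" "V = span B" "independent B" "card B = dim V"
proof -
  obtain B where B: "B \<subseteq> V" "independent B" "V \<subseteq> span B" "card B = dim V"
    using basis_exists by metis
  obtain C where "finite C" "V \<subseteq> span C" using assms(2) by (auto simp: findim_def)
  then have "finite B" using independent_span_bound[of C B] B by auto
  moreover have "V = span B" using B span_minimal[OF B(1) assms(1)] by auto
  ultimately show ?thesis using B that by blast
qed

lemma dim_less_psubset:
  assumes "subspace V" "subspace W" "findim W" "V \<subset> W"
  shows "dim V < dim W"
proof -
  have "findim V" using assms findim_mono by blast
  from findim_basis[OF assms(1) this]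
  obtain B where B: "finite B" "B \<subseteq> V" "V = span B" "independent B" "card B = dim V" .
  have "B \<subseteq> W" using B assms by auto
  from maximal_independent_subset_extend[OF this B(4)]
  obtain C where C: "B \<subseteq> C" "C \<subseteq> W" "independent C" "W \<subseteq> span C" by blast
  obtain D where "finite D" "W \<subseteq> span D" using assms(3) by (auto simp: findim_def)
  then have fin: "finite C" using independent_span_bound[of D C] C by auto
  have "B \<noteq> C" using B C assms(4) by auto
  then have "card B < card C" using C(1) fin by (auto intro: psubset_card_mono)
  then show ?thesis using B C basis_card_eq_dim[of C W] by simp
qed

lemma findim_chain:
  assumes V: "subspace V" "findim V" and F: "\<And>n. subspace (F n)" "\<And>m n. m \<le> n \<Longrightarrow> F m \<subseteq> F n"
    and "V \<subseteq> (\<Union>n::nat. F n)"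
  shows "\<exists>n. V \<subseteq> F n"
proof -
  from findim_basis[OF V] obtain B where B: "finite B" "B \<subseteq> V" "V = span B" by metis
  have "\<forall>b\<in>B. \<exists>n. b \<in> F n" using B assms(5) by auto
  then obtain n where n: "\<And>b. b \<in> B \<Longrightarrow> b \<in> F (n b)" by metis
  let ?N = "Max (insert 0 (n ` B))"
  have "B \<subseteq> F ?N"
  proof
    fix b assume "b \<in> B"
    then have "n b \<le> ?N" using B(1) by (intro Max_ge) auto
    then show "b \<in> F ?N" using n[OF \<open>b \<in> B\<close>] F(2) by blast
  qed
  then show ?thesis using span_minimal[OF _ F(1)] B(3) by blast
qed

end

section \<open>Sums over lists of pure tensors\<close>

lemma sum_list_pairs_cong:
  assumes "\<And>a b. (a, b) \<in> set l \<Longrightarrow> f a b = g a b"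
  shows "(\<Sum>(a, b)\<leftarrow>l. f a b) = (\<Sum>(a, b)\<leftarrow>l. g a b)"
  by (rule arg_cong[where f = sum_list], rule map_cong) (use assms in auto)

lemma sum_list_pairs_swap:
  fixes G :: "_ \<Rightarrow> _ \<Rightarrow> _ \<Rightarrow> _ \<Rightarrow> 'v::comm_monoid_add"
  shows "(\<Sum>(a, b)\<leftarrow>l. \<Sum>(c, d)\<leftarrow>k. G a b c d) = (\<Sum>(c, d)\<leftarrow>k. \<Sum>(a, b)\<leftarrow>l. G a b c d)"
proof (induction l)
  case (Cons x l)
  show ?case using Cons.IH by (simp add: split_def sum_list_addf)
qed (simp add: split_def)

context linear_space
begin

lemma lin_pairs: "lin f \<Longrightarrow> f (\<Sum>(a, b)\<leftarrow>l. G a b) = (\<Sum>(a, b)\<leftarrow>l. f (G a b))"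
  by (simp add: lin_sum_list split_def comp_def)

lemma lform_pairs: "lform f \<Longrightarrow> f (\<Sum>(a, b)\<leftarrow>l. G a b) = (\<Sum>(a, b)\<leftarrow>l. f (G a b))"
  by (simp add: lform_sum_list split_def comp_def)

lemma subspace_pairs:
  "subspace W \<Longrightarrow> (\<And>a b. (a, b) \<in> set l \<Longrightarrow> G a b \<in> W) \<Longrightarrow> (\<Sum>(a, b)\<leftarrow>l. G a b) \<in> W"
  by (rule subspace_sum_list) auto

lemma scale_pairs_left: "scale (\<Sum>(a, b)\<leftarrow>l. r a b) v = (\<Sum>(a, b)\<leftarrow>l. scale (r a b) v)"
  by (induction l) (auto simp: scale_left_distrib)

lemma lin_ident: "lin (\<lambda>x. x)"
  and lin_plus: "lin f \<Longrightarrow> lin g \<Longrightarrow> lin (\<lambda>x. f x + g x)"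
  and lin_minus: "lin f \<Longrightarrow> lin g \<Longrightarrow> lin (\<lambda>x. f x - g x)"
  and lin_scaled: "lin f \<Longrightarrow> lin (\<lambda>x. scale c (f x))"
  and lin_coeff: "lform \<phi> \<Longrightarrow> lin (\<lambda>x. scale (\<phi> x) v)"
  and lin_comp: "lin f \<Longrightarrow> lin g \<Longrightarrow> lin (\<lambda>x. f (g x))"
  and lform_comp: "lform \<phi> \<Longrightarrow> lin g \<Longrightarrow> lform (\<lambda>x. \<phi> (g x))"
  by (auto simp: lin_iff lform_iff algebra_simps scale_right_diff_distrib)

lemma lin_param: "(\<And>a b. lin (\<lambda>x. G x a b)) \<Longrightarrow> lin (\<lambda>x. \<Sum>(a, b)\<leftarrow>l. G x a b)"
  by (induction l) (auto simp: lin_iff algebra_simps)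

text \<open>In its second argument \<open>G\<close> factors through the quotient by
  \<open>W\<close>. Expanding the second legs modulo \<open>W\<close> in a basis leaves coordinate
  forms that vanish on \<open>W\<close>, and bilinearity moves the coefficients to the first legs.
  This turns tensor conditions into conditions on contractions.\<close>

lemma pairs_expand:
  assumes W: "subspace W" and G: "bilin G" "\<And>a w. w \<in> W \<Longrightarrow> G a w = 0"
    and Z: "subspace Z"
    and mem: "\<And>\<phi> c. lform \<phi> \<Longrightarrow> (\<And>w. w \<in> W \<Longrightarrow> \<phi> w = 0) \<Longrightarrow>
      G (\<Sum>(a, b)\<leftarrow>l. scale (\<phi> b) a) c \<in> Z"
  shows "(\<Sum>(a, b)\<leftarrow>l. G a b) \<in> Z"
proof -
  let ?q = "\<lambda>b. b - proj W b"
  have q: "lin ?q" using lin_minus[OF lin_ident lin_proj[OF W]] .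
  obtain F r where F: "finite F" "\<And>\<beta>. lform (r \<beta>)"
    "\<And>y. y \<in> ?q ` snd ` set l \<Longrightarrow> y = (\<Sum>\<beta>\<in>F. scale (r \<beta> y) \<beta>)"
    using basis_expansion[of "?q ` snd ` set l"] by auto
  have "(\<Sum>(a, b)\<leftarrow>l. G a b) = (\<Sum>(a, b)\<leftarrow>l. G a (\<Sum>\<beta>\<in>F. scale (r \<beta> (?q b)) \<beta>))"
  proof (rule sum_list_pairs_cong)
    fix a b assume "(a, b) \<in> set l"
    then have "?q b \<in> ?q ` snd ` set l" by force
    then have "(\<Sum>\<beta>\<in>F. scale (r \<beta> (?q b)) \<beta>) = ?q b" using F(3) by metis
    then show "G a b = G a (\<Sum>\<beta>\<in>F. scale (r \<beta> (?q b)) \<beta>)"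
      using G(2)[OF proj_in[OF W]] by (simp add: lin_diff[OF bilinD(2)[OF G(1)]])
  qed
  also have "\<dots> = (\<Sum>(a, b)\<leftarrow>l. \<Sum>\<beta>\<in>F. G (scale (r \<beta> (?q b)) a) \<beta>)"
    by (simp add: lin_sum[OF bilinD(2)[OF G(1)]] lin_scale[OF bilinD(2)[OF G(1)]]
        lin_scale[OF bilinD(1)[OF G(1)]])
  also have "\<dots> = (\<Sum>\<beta>\<in>F. \<Sum>(a, b)\<leftarrow>l. G (scale (r \<beta> (?q b)) a) \<beta>)"
    by (induction l) (auto simp: sum.distrib)
  also have "\<dots> = (\<Sum>\<beta>\<in>F. G (\<Sum>(a, b)\<leftarrow>l. scale (r \<beta> (?q b)) a) \<beta>)"
    by (simp add: lin_pairs[OF bilinD(1)[OF G(1)]])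
  also have "\<dots> \<in> Z"
  proof (rule subspace_sum[OF Z], rule mem)
    fix \<beta> show "lform (\<lambda>b. r \<beta> (?q b))" using lform_comp[OF F(2) q] .
  qed (auto simp: proj_id[OF W] lform_0[OF F(2)])
  finally show ?thesis .
qed

end

section \<open>Hopf algebras in Sweedler notation\<close>

text \<open>\<open>\<Delta> x\<close> lists pure tensors with sum the coproduct of \<open>x\<close>. Identities between tensors are
  stated after applying bilinear or trilinear maps into the space itself. The multiplication is an
  explicit parameter so that the locale applies to the opposite algebra on the same type.\<close>

locale sweedler_hopf = linear_space scale
  for scale :: "'k::field \<Rightarrow> 'h::ab_group_add \<Rightarrow> 'h" (infixr "\<star>" 75) +
  fixes mul :: "'h \<Rightarrow> 'h \<Rightarrow> 'h" (infixl "\<odot>" 70)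
    and one :: 'h ("\<one>")
    and cop :: "'h \<Rightarrow> ('h \<times> 'h) list" ("\<Delta>")
    and eps :: "'h \<Rightarrow> 'k" ("\<epsilon>")
    and S :: "'h \<Rightarrow> 'h"
  assumes mul_bilin: "bilin (\<odot>)"
    and mul_assoc: "(x \<odot> y) \<odot> z = x \<odot> (y \<odot> z)"
    and one_mul: "\<one> \<odot> x = x"
    and mul_one: "x \<odot> \<one> = x"
    and cop_lin: "bilin G \<Longrightarrow> lin (\<lambda>x. \<Sum>(a, b)\<leftarrow>\<Delta> x. G a b)"
    and cop_coassoc: "trilin T \<Longrightarrow>
      (\<Sum>(e, c)\<leftarrow>\<Delta> x. \<Sum>(a, b)\<leftarrow>\<Delta> e. T a b c) = (\<Sum>(a, e)\<leftarrow>\<Delta> x. \<Sum>(b, c)\<leftarrow>\<Delta> e. T a b c)"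
    and cop_counit_left: "(\<Sum>(a, b)\<leftarrow>\<Delta> x. \<epsilon> a \<star> b) = x"
    and cop_counit_right: "(\<Sum>(a, b)\<leftarrow>\<Delta> x. \<epsilon> b \<star> a) = x"
    and cop_mul: "bilin G \<Longrightarrow>
      (\<Sum>(a, b)\<leftarrow>\<Delta> (x \<odot> y). G a b) = (\<Sum>(a, b)\<leftarrow>\<Delta> x. \<Sum>(c, d)\<leftarrow>\<Delta> y. G (a \<odot> c) (b \<odot> d))"
    and cop_one: "bilin G \<Longrightarrow> (\<Sum>(a, b)\<leftarrow>\<Delta> \<one>. G a b) = G \<one> \<one>"
    and eps_lform: "lform \<epsilon>"
    and eps_mul: "\<epsilon> (x \<odot> y) = \<epsilon> x * \<epsilon> y"
    and eps_one: "\<epsilon> \<one> = 1"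
    and S_lin: "lin S"
    and antipode_left: "(\<Sum>(a, b)\<leftarrow>\<Delta> x. S a \<odot> b) = \<epsilon> x \<star> \<one>"
    and antipode_right: "(\<Sum>(a, b)\<leftarrow>\<Delta> x. a \<odot> S b) = \<epsilon> x \<star> \<one>"
begin

lemma mul_lin: "lin (\<lambda>x. x \<odot> y)" "lin (\<lambda>x. y \<odot> x)" "lin ((\<odot>) y)"
  using bilinD[OF mul_bilin] by auto

lemma lin_mulr: "lin f \<Longrightarrow> lin (\<lambda>x. f x \<odot> c)"
  and lin_mull: "lin f \<Longrightarrow> lin (\<lambda>x. c \<odot> f x)"
  and lin_S: "lin f \<Longrightarrow> lin (\<lambda>x. S (f x))"
  and lform_eps: "lin f \<Longrightarrow> lform (\<lambda>x. \<epsilon> (f x))"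
  and lin_cop: "bilin G \<Longrightarrow> lin f \<Longrightarrow> lin (\<lambda>x. \<Sum>(a, b)\<leftarrow>\<Delta> (f x). G a b)"
  using mul_lin S_lin eps_lform cop_lin by (auto simp: lin_iff lform_iff)

lemmas lin_intros = lin_param lin_cop lin_mulr lin_mull lin_S lform_eps lin_coeff lin_scaled
  lin_plus lin_minus S_lin mul_lin eps_lform lin_ident bilinI trilinI

lemma mul_0 [simp]: "0 \<odot> x = 0" "x \<odot> 0 = 0"
  using lin_0[OF mul_lin(1)] lin_0[OF mul_lin(2)] by auto

lemma mul_add: "(x + y) \<odot> z = x \<odot> z + y \<odot> z" "z \<odot> (x + y) = z \<odot> x + z \<odot> y"
  using lin_add[OF mul_lin(1)] lin_add[OF mul_lin(2)] by auto

lemma mul_diff: "(x - y) \<odot> z = x \<odot> z - y \<odot> z" "z \<odot> (x - y) = z \<odot> x - z \<odot> y"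
  using lin_diff[OF mul_lin(1)] lin_diff[OF mul_lin(2)] by auto

lemma mul_scale: "(c \<star> x) \<odot> z = c \<star> (x \<odot> z)" "z \<odot> (c \<star> x) = c \<star> (z \<odot> x)"
  using lin_scale[OF mul_lin(1)] lin_scale[OF mul_lin(2)] by auto

lemma mul_pairs:
  "(\<Sum>(a, b)\<leftarrow>l. G a b) \<odot> z = (\<Sum>(a, b)\<leftarrow>l. G a b \<odot> z)"
  "z \<odot> (\<Sum>(a, b)\<leftarrow>l. G a b) = (\<Sum>(a, b)\<leftarrow>l. z \<odot> G a b)"
  using lin_pairs[OF mul_lin(1)] lin_pairs[OF mul_lin(2)] by auto

lemma scale_pairs: "c \<star> (\<Sum>(a, b)\<leftarrow>l. G a b) = (\<Sum>(a, b)\<leftarrow>l. c \<star> G a b)"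
  by (rule lin_pairs) (intro lin_intros)

lemma contract_counit:
  assumes "lin f"
  shows "(\<Sum>(a, b)\<leftarrow>\<Delta> x. \<epsilon> a \<star> f b) = f x" "(\<Sum>(a, b)\<leftarrow>\<Delta> x. \<epsilon> b \<star> f a) = f x"
  using arg_cong[OF cop_counit_left[of x], of f] arg_cong[OF cop_counit_right[of x], of f]
  by (simp_all add: lin_pairs[OF assms] lin_scale[OF assms])

lemma contract_antipode:
  assumes "lin f"
  shows "(\<Sum>(a, b)\<leftarrow>\<Delta> x. f (S a \<odot> b)) = \<epsilon> x \<star> f \<one>" "(\<Sum>(a, b)\<leftarrow>\<Delta> x. f (a \<odot> S b)) = \<epsilon> x \<star> f \<one>"
  using arg_cong[OF antipode_left[of x], of f] arg_cong[OF antipode_right[of x], of f]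
  by (simp_all add: lin_pairs[OF assms] lin_scale[OF assms])

lemma S_one: "S \<one> = \<one>"
proof -
  have "S \<one> \<odot> \<one> = (\<Sum>(a, b)\<leftarrow>\<Delta> \<one>. S a \<odot> b)"
    by (rule cop_one[symmetric]) (intro lin_intros)
  then show ?thesis by (simp add: antipode_left eps_one mul_one)
qed

text \<open>Both sides are convolution inverse to the multiplication. The chain evaluates S(y1)
  S(x1) x2 y2 S(x3 y3) in two ways: collapsing x2 y2 S(x3 y3) gives one side, collapsing S(x1) x2
  and then S(y1) y2 gives the other.\<close>

lemma S_mul: "S (x \<odot> y) = S y \<odot> S x"
proof -
  have "S y \<odot> S x = (\<Sum>(x1, x2)\<leftarrow>\<Delta> x. \<epsilon> x2 \<star> (S y \<odot> S x1))"
    by (rule contract_counit(2)[symmetric]) (intro lin_intros)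
  also have "\<dots> = (\<Sum>(x1, x2)\<leftarrow>\<Delta> x. \<Sum>(y1, y2)\<leftarrow>\<Delta> y. \<epsilon> y2 \<star> (\<epsilon> x2 \<star> (S y1 \<odot> S x1)))"
    by (intro sum_list_pairs_cong contract_counit(2)[symmetric] lin_intros)
  also have "\<dots> = (\<Sum>(x1, x2)\<leftarrow>\<Delta> x. \<Sum>(y1, y2)\<leftarrow>\<Delta> y. \<Sum>(c, d)\<leftarrow>\<Delta> (x2 \<odot> y2). S y1 \<odot> S x1 \<odot> (c \<odot> S d))"
    by (intro sum_list_pairs_cong, subst contract_antipode(2), intro lin_intros)
      (simp add: eps_mul mul_one mult.commute)
  also have "\<dots> = (\<Sum>(x1, x2)\<leftarrow>\<Delta> x. \<Sum>(y1, y2)\<leftarrow>\<Delta> y. \<Sum>(a, b)\<leftarrow>\<Delta> x2. \<Sum>(c, d)\<leftarrow>\<Delta> y2.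
      S y1 \<odot> S x1 \<odot> (a \<odot> c \<odot> S (b \<odot> d)))"
    by (intro sum_list_pairs_cong cop_mul lin_intros)
  also have "\<dots> = (\<Sum>(x1, x2)\<leftarrow>\<Delta> x. \<Sum>(a, b)\<leftarrow>\<Delta> x2. \<Sum>(y1, y2)\<leftarrow>\<Delta> y. \<Sum>(c, d)\<leftarrow>\<Delta> y2.
      S y1 \<odot> S x1 \<odot> (a \<odot> c \<odot> S (b \<odot> d)))"
    by (intro sum_list_pairs_cong, rule sum_list_pairs_swap)
  also have "\<dots> = (\<Sum>(e, b)\<leftarrow>\<Delta> x. \<Sum>(x1, a)\<leftarrow>\<Delta> e. \<Sum>(y1, y2)\<leftarrow>\<Delta> y. \<Sum>(c, d)\<leftarrow>\<Delta> y2.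
      S y1 \<odot> S x1 \<odot> (a \<odot> c \<odot> S (b \<odot> d)))"
    by (rule cop_coassoc[symmetric]) (intro lin_intros)
  also have "\<dots> = (\<Sum>(e, b)\<leftarrow>\<Delta> x. \<Sum>(x1, a)\<leftarrow>\<Delta> e. \<Sum>(y1, y2)\<leftarrow>\<Delta> y. \<Sum>(c, d)\<leftarrow>\<Delta> y2.
      S y1 \<odot> (S x1 \<odot> a) \<odot> c \<odot> S (b \<odot> d))"
    by (simp add: mul_assoc)
  also have "\<dots> = (\<Sum>(e, b)\<leftarrow>\<Delta> x. \<epsilon> e \<star> (\<Sum>(y1, y2)\<leftarrow>\<Delta> y. \<Sum>(c, d)\<leftarrow>\<Delta> y2. S y1 \<odot> \<one> \<odot> c \<odot> S (b \<odot> d)))"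
    by (intro sum_list_pairs_cong contract_antipode(1)) (intro lin_intros)
  also have "\<dots> = (\<Sum>(y1, y2)\<leftarrow>\<Delta> y. \<Sum>(c, d)\<leftarrow>\<Delta> y2. S y1 \<odot> \<one> \<odot> c \<odot> S (x \<odot> d))"
    by (rule contract_counit(1)) (intro lin_intros)
  also have "\<dots> = (\<Sum>(e, d)\<leftarrow>\<Delta> y. \<Sum>(y1, c)\<leftarrow>\<Delta> e. S y1 \<odot> \<one> \<odot> c \<odot> S (x \<odot> d))"
    by (rule cop_coassoc[symmetric]) (intro lin_intros)
  also have "\<dots> = (\<Sum>(e, d)\<leftarrow>\<Delta> y. \<Sum>(y1, c)\<leftarrow>\<Delta> e. (S y1 \<odot> c) \<odot> S (x \<odot> d))"
    by (simp add: mul_one)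
  also have "\<dots> = (\<Sum>(e, d)\<leftarrow>\<Delta> y. \<epsilon> e \<star> (\<one> \<odot> S (x \<odot> d)))"
    by (intro sum_list_pairs_cong contract_antipode(1)) (intro lin_intros)
  also have "\<dots> = \<one> \<odot> S (x \<odot> y)"
    by (rule contract_counit(1)) (intro lin_intros)
  finally show ?thesis by (simp add: one_mul)
qed

text \<open>Both sides are convolution inverse to the coproduct, as maps from H to H \<otimes> H.
  The coproduct of \<open>c \<odot> S d\<close> is inserted in place of that of \<one>; after
  reassociation \<open>S b \<odot> p\<close> and then \<open>S a \<odot> e\<close> cancel.\<close>

lemma S_cop:
  assumes G: "bilin G"
  shows "(\<Sum>(a, b)\<leftarrow>\<Delta> (S x). G a b) = (\<Sum>(a, b)\<leftarrow>\<Delta> x. G (S b) (S a))"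
proof -
  have G1: "lin (\<lambda>x. G (f x) c)" if "lin f" for f c using lin_comp[OF bilinD(1)[OF G] that] .
  have G2: "lin (\<lambda>x. G c (f x))" if "lin f" for f c using lin_comp[OF bilinD(2)[OF G] that] .
  have "(\<Sum>(a, b)\<leftarrow>\<Delta> x. G (S b) (S a)) = (\<Sum>(h, t)\<leftarrow>\<Delta> x. \<epsilon> t \<star> (\<Sum>(a, b)\<leftarrow>\<Delta> h. G (S b) (S a)))"
    by (rule contract_counit(2)[symmetric]) (intro lin_intros G1 G2)
  also have "\<dots> = (\<Sum>(h, t)\<leftarrow>\<Delta> x. \<Sum>(a, b)\<leftarrow>\<Delta> h. \<epsilon> t \<star> (\<Sum>(p, q)\<leftarrow>\<Delta> \<one>. G (S b \<odot> p) (S a \<odot> q)))"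
    by (subst cop_one, intro lin_intros G1 G2) (simp add: scale_pairs mul_one)
  also have "\<dots> = (\<Sum>(h, t)\<leftarrow>\<Delta> x. \<Sum>(a, b)\<leftarrow>\<Delta> h. \<Sum>(c, d)\<leftarrow>\<Delta> t. \<Sum>(p, q)\<leftarrow>\<Delta> (c \<odot> S d). G (S b \<odot> p) (S a \<odot> q))"
    by (intro sum_list_pairs_cong contract_antipode(2)[symmetric]) (intro lin_intros G1 G2)
  also have "\<dots> = (\<Sum>(h, t)\<leftarrow>\<Delta> x. \<Sum>(a, b)\<leftarrow>\<Delta> h. \<Sum>(c, d)\<leftarrow>\<Delta> t. \<Sum>(p, q)\<leftarrow>\<Delta> c. \<Sum>(u, v)\<leftarrow>\<Delta> (S d).
      G (S b \<odot> (p \<odot> u)) (S a \<odot> (q \<odot> v)))"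
    by (intro sum_list_pairs_cong cop_mul lin_intros G1 G2)
  also have "\<dots> = (\<Sum>(a, r)\<leftarrow>\<Delta> x. \<Sum>(b, t)\<leftarrow>\<Delta> r. \<Sum>(c, d)\<leftarrow>\<Delta> t. \<Sum>(p, q)\<leftarrow>\<Delta> c. \<Sum>(u, v)\<leftarrow>\<Delta> (S d).
      G (S b \<odot> (p \<odot> u)) (S a \<odot> (q \<odot> v)))"
    by (rule cop_coassoc) (intro lin_intros G1 G2)
  also have "\<dots> = (\<Sum>(a, r)\<leftarrow>\<Delta> x. \<Sum>(e, d)\<leftarrow>\<Delta> r. \<Sum>(b, c)\<leftarrow>\<Delta> e. \<Sum>(p, q)\<leftarrow>\<Delta> c. \<Sum>(u, v)\<leftarrow>\<Delta> (S d).
      G (S b \<odot> (p \<odot> u)) (S a \<odot> (q \<odot> v)))"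
    by (intro sum_list_pairs_cong cop_coassoc[symmetric] lin_intros G1 G2)
  also have "\<dots> = (\<Sum>(a, r)\<leftarrow>\<Delta> x. \<Sum>(e, d)\<leftarrow>\<Delta> r. \<Sum>(g, q)\<leftarrow>\<Delta> e. \<Sum>(b, p)\<leftarrow>\<Delta> g. \<Sum>(u, v)\<leftarrow>\<Delta> (S d).
      G (S b \<odot> (p \<odot> u)) (S a \<odot> (q \<odot> v)))"
    by (intro sum_list_pairs_cong cop_coassoc[symmetric] lin_intros G1 G2)
  also have "\<dots> = (\<Sum>(a, r)\<leftarrow>\<Delta> x. \<Sum>(e, d)\<leftarrow>\<Delta> r. \<Sum>(g, q)\<leftarrow>\<Delta> e. \<Sum>(b, p)\<leftarrow>\<Delta> g. \<Sum>(u, v)\<leftarrow>\<Delta> (S d).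
      G ((S b \<odot> p) \<odot> u) (S a \<odot> (q \<odot> v)))"
    by (simp add: mul_assoc)
  also have "\<dots> = (\<Sum>(a, r)\<leftarrow>\<Delta> x. \<Sum>(e, d)\<leftarrow>\<Delta> r. \<Sum>(g, q)\<leftarrow>\<Delta> e. \<epsilon> g \<star> (\<Sum>(u, v)\<leftarrow>\<Delta> (S d).
      G (\<one> \<odot> u) (S a \<odot> (q \<odot> v))))"
    by (intro sum_list_pairs_cong contract_antipode(1)) (intro lin_intros G1 G2)
  also have "\<dots> = (\<Sum>(a, r)\<leftarrow>\<Delta> x. \<Sum>(e, d)\<leftarrow>\<Delta> r. \<Sum>(u, v)\<leftarrow>\<Delta> (S d). G (\<one> \<odot> u) (S a \<odot> (e \<odot> v)))"
    by (intro sum_list_pairs_cong contract_counit(1)) (intro lin_intros G1 G2)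
  also have "\<dots> = (\<Sum>(h, d)\<leftarrow>\<Delta> x. \<Sum>(a, e)\<leftarrow>\<Delta> h. \<Sum>(u, v)\<leftarrow>\<Delta> (S d). G (\<one> \<odot> u) (S a \<odot> (e \<odot> v)))"
    by (rule cop_coassoc[symmetric]) (intro lin_intros G1 G2)
  also have "\<dots> = (\<Sum>(h, d)\<leftarrow>\<Delta> x. \<Sum>(a, e)\<leftarrow>\<Delta> h. \<Sum>(u, v)\<leftarrow>\<Delta> (S d). G u ((S a \<odot> e) \<odot> v))"
    by (simp add: mul_assoc one_mul)
  also have "\<dots> = (\<Sum>(h, d)\<leftarrow>\<Delta> x. \<epsilon> h \<star> (\<Sum>(u, v)\<leftarrow>\<Delta> (S d). G u (\<one> \<odot> v)))"
    by (intro sum_list_pairs_cong contract_antipode(1)) (intro lin_intros G1 G2)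
  also have "\<dots> = (\<Sum>(u, v)\<leftarrow>\<Delta> (S x). G u (\<one> \<odot> v))"
    by (rule contract_counit(1)) (intro lin_intros G1 G2)
  finally show ?thesis by (simp add: one_mul)
qed

section \<open>The left and right hit actions of the dual algebra\<close>

definition lhit :: "('h \<Rightarrow> 'k) \<Rightarrow> 'h \<Rightarrow> 'h" where
  "lhit \<phi> x = (\<Sum>(a, b)\<leftarrow>\<Delta> x. \<phi> b \<star> a)"

definition rhit :: "('h \<Rightarrow> 'k) \<Rightarrow> 'h \<Rightarrow> 'h" where
  "rhit \<phi> x = (\<Sum>(a, b)\<leftarrow>\<Delta> x. \<phi> a \<star> b)"

lemma lin_lhit: "lform \<phi> \<Longrightarrow> lin (lhit \<phi>)"
  and lin_rhit: "lform \<phi> \<Longrightarrow> lin (rhit \<phi>)"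
  unfolding lhit_def[abs_def] rhit_def[abs_def]
  by (rule cop_lin, intro lin_intros, assumption?)+

lemma lhit_eps: "lhit \<epsilon> x = x" and rhit_eps: "rhit \<epsilon> x = x"
  by (simp_all add: lhit_def rhit_def cop_counit_left cop_counit_right)

lemma eps_lhit: "lform \<phi> \<Longrightarrow> \<epsilon> (lhit \<phi> x) = \<phi> x"
  and eps_rhit: "lform \<phi> \<Longrightarrow> \<epsilon> (rhit \<phi> x) = \<phi> x"
  using arg_cong[OF cop_counit_left[of x], of \<phi>] arg_cong[OF cop_counit_right[of x], of \<phi>]
  by (simp_all add: lhit_def rhit_def lform_pairs eps_lform lform_scale mult.commute)

lemma lhit_rhit_adjoint: "lform \<phi> \<Longrightarrow> lform \<psi> \<Longrightarrow> \<psi> (lhit \<phi> x) = \<phi> (rhit \<psi> x)"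
  by (simp add: lhit_def rhit_def lform_pairs lform_scale mult.commute)

text \<open>The form \<open>\<lambda>z. \<phi> (lhit \<psi> z)\<close> is the convolution product of
  \<phi> and \<psi>, so \<open>lhit\<close> is a left action of the dual algebra. Correspondingly
  \<open>rhit\<close> is a right action.\<close>

lemma lhit_lhit:
  assumes "lform \<phi>" "lform \<psi>"
  shows "lhit \<phi> (lhit \<psi> x) = lhit (\<lambda>z. \<phi> (lhit \<psi> z)) x"
proof -
  have "lhit \<phi> (lhit \<psi> x) = (\<Sum>(e, c)\<leftarrow>\<Delta> x. \<Sum>(a, b)\<leftarrow>\<Delta> e. \<psi> c \<star> \<phi> b \<star> a)"
    unfolding lhit_def[of \<psi>] lin_pairs[OF lin_lhit[OF assms(1)]] lin_scale[OF lin_lhit[OF assms(1)]]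
    by (simp add: lhit_def scale_pairs)
  also have "\<dots> = (\<Sum>(a, e)\<leftarrow>\<Delta> x. \<Sum>(b, c)\<leftarrow>\<Delta> e. \<psi> c \<star> \<phi> b \<star> a)"
    by (rule cop_coassoc) (intro lin_intros assms)
  also have "\<dots> = lhit (\<lambda>z. \<phi> (lhit \<psi> z)) x"
    by (simp add: scale_pairs_left lhit_def lform_pairs[OF assms(1)] lform_scale[OF assms(1)])
  finally show ?thesis .
qed

lemma rhit_rhit:
  assumes "lform \<phi>" "lform \<psi>"
  shows "rhit \<phi> (rhit \<psi> x) = rhit (\<lambda>z. \<phi> (rhit \<psi> z)) x"
proof -
  have "rhit \<phi> (rhit \<psi> x) = (\<Sum>(a, e)\<leftarrow>\<Delta> x. \<Sum>(b, c)\<leftarrow>\<Delta> e. \<psi> a \<star> \<phi> b \<star> c)"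
    unfolding rhit_def[of \<psi>] lin_pairs[OF lin_rhit[OF assms(1)]] lin_scale[OF lin_rhit[OF assms(1)]]
    by (simp add: rhit_def scale_pairs)
  also have "\<dots> = (\<Sum>(e, c)\<leftarrow>\<Delta> x. \<Sum>(a, b)\<leftarrow>\<Delta> e. \<psi> a \<star> \<phi> b \<star> c)"
    by (rule cop_coassoc[symmetric]) (intro lin_intros assms)
  also have "\<dots> = rhit (\<lambda>z. \<phi> (rhit \<psi> z)) x"
    by (simp add: scale_pairs_left rhit_def lform_pairs[OF assms(1)] lform_scale[OF assms(1)])
  finally show ?thesis .
qed

lemma lhit_rhit:
  assumes "lform \<phi>" "lform \<psi>"
  shows "lhit \<phi> (rhit \<psi> x) = rhit \<psi> (lhit \<phi> x)"
proof -
  have "lhit \<phi> (rhit \<psi> x) = (\<Sum>(a, e)\<leftarrow>\<Delta> x. \<Sum>(b, c)\<leftarrow>\<Delta> e. \<psi> a \<star> \<phi> c \<star> b)"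
    unfolding rhit_def[of \<psi>] lin_pairs[OF lin_lhit[OF assms(1)]] lin_scale[OF lin_lhit[OF assms(1)]]
    by (simp add: lhit_def scale_pairs)
  also have "\<dots> = (\<Sum>(e, c)\<leftarrow>\<Delta> x. \<Sum>(a, b)\<leftarrow>\<Delta> e. \<psi> a \<star> \<phi> c \<star> b)"
    by (rule cop_coassoc[symmetric]) (intro lin_intros assms)
  also have "\<dots> = rhit \<psi> (lhit \<phi> x)"
    unfolding lhit_def[of \<phi>] lin_pairs[OF lin_rhit[OF assms(2)]] lin_scale[OF lin_rhit[OF assms(2)]]
    by (simp add: rhit_def scale_pairs mult.commute)
  finally show ?thesis .
qed

lemma lhit_add: "lhit (\<lambda>z. \<phi> z + \<psi> z) x = lhit \<phi> x + lhit \<psi> x"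
  and lhit_diff: "lhit (\<lambda>z. \<phi> z - \<psi> z) x = lhit \<phi> x - lhit \<psi> x"
  and lhit_scale: "lhit (\<lambda>z. c * \<phi> z) x = c \<star> lhit \<phi> x"
  unfolding lhit_def scale_pairs
  by (simp_all add: split_def scale_left_distrib scale_left_diff_distrib sum_list_addf sum_list_subtractf)

section \<open>Subcoalgebras and the coradical\<close>

text \<open>Stability under both actions puts the coproduct of \<open>C\<close> into the
  intersection of C \<otimes> H and H \<otimes> C, which over a field is C \<otimes> C. The
  equivalence with the definition by cosets is \<open>subcoalgebra_iff\<close>.\<close>

definition subcoal :: "'h set \<Rightarrow> bool" where
  "subcoal C \<longleftrightarrow> subspace C \<and> (\<forall>\<phi>. lform \<phi> \<longrightarrow> lhit \<phi> ` C \<subseteq> C \<and> rhit \<phi> ` C \<subseteq> C)"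

lemma subcoalI:
  "subspace C \<Longrightarrow> (\<And>\<phi> x. lform \<phi> \<Longrightarrow> x \<in> C \<Longrightarrow> lhit \<phi> x \<in> C) \<Longrightarrow>
    (\<And>\<phi> x. lform \<phi> \<Longrightarrow> x \<in> C \<Longrightarrow> rhit \<phi> x \<in> C) \<Longrightarrow> subcoal C"
  by (auto simp: subcoal_def)

lemma subcoalD:
  assumes "subcoal C"
  shows "subspace C" "lform \<phi> \<Longrightarrow> x \<in> C \<Longrightarrow> lhit \<phi> x \<in> C" "lform \<phi> \<Longrightarrow> x \<in> C \<Longrightarrow> rhit \<phi> x \<in> C"
  using assms by (auto simp: subcoal_def)

definition annih :: "'h set \<Rightarrow> ('h \<Rightarrow> 'k) \<Rightarrow> bool" where
  "annih W \<phi> \<longleftrightarrow> lform \<phi> \<and> (\<forall>w\<in>W. \<phi> w = 0)"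

text \<open>By adjointness a test form can be moved onto \<open>x\<close>, where it stays inside
  \<open>C\<close>, and \<phi> vanishes there.\<close>

lemma annih_hits:
  assumes C: "subcoal C" "x \<in> C" and \<phi>: "annih C \<phi>"
  shows "lhit \<phi> x = 0" "rhit \<phi> x = 0"
proof -
  have \<phi>': "lform \<phi>" using \<phi> by (simp add: annih_def)
  show "lhit \<phi> x = 0"
    by (rule lform_determined)
      (use C \<phi> \<phi>' in \<open>auto simp: lhit_rhit_adjoint annih_def lform_0 subcoalD(3)\<close>)
  show "rhit \<phi> x = 0"
    by (rule lform_determined)
      (use C \<phi> \<phi>' in \<open>auto simp: lhit_rhit_adjoint[symmetric] annih_def lform_0 subcoalD(2)\<close>)
qed

lemma cop_expand:
  assumes W: "subspace W" and G: "bilin G" "\<And>a w. w \<in> W \<Longrightarrow> G a w = 0"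
    and Z: "subspace Z" and mem: "\<And>\<phi> c. annih W \<phi> \<Longrightarrow> G (lhit \<phi> x) c \<in> Z"
  shows "(\<Sum>(a, b)\<leftarrow>\<Delta> x. G a b) \<in> Z"
  by (rule pairs_expand[OF W G Z]) (use mem in \<open>auto simp: annih_def lhit_def\<close>)

lemma cop_expand_right:
  assumes W: "subspace W" and G: "bilin G" "\<And>a w. w \<in> W \<Longrightarrow> G w a = 0"
    and Z: "subspace Z" and mem: "\<And>\<phi> c. annih W \<phi> \<Longrightarrow> G c (rhit \<phi> x) \<in> Z"
  shows "(\<Sum>(a, b)\<leftarrow>\<Delta> x. G a b) \<in> Z"
proof -
  have eq: "(\<Sum>(a, b)\<leftarrow>map prod.swap (\<Delta> x). H a b) = (\<Sum>(a, b)\<leftarrow>\<Delta> x. H b a)" for H :: "'h \<Rightarrow> 'h \<Rightarrow> 'h"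
    by (simp add: comp_def split_def)
  have "(\<Sum>(a, b)\<leftarrow>map prod.swap (\<Delta> x). G b a) \<in> Z"
  proof (rule pairs_expand[OF W _ _ Z])
    show "bilin (\<lambda>a b. G b a)" using G(1) by (auto simp: bilin_def)
    show "G c (\<Sum>(a, b)\<leftarrow>map prod.swap (\<Delta> x). \<phi> b \<star> a) \<in> Z"
      if "lform \<phi>" "\<And>w. w \<in> W \<Longrightarrow> \<phi> w = 0" for \<phi> c
      unfolding eq using mem[of \<phi> c] that by (auto simp: annih_def rhit_def)
  qed (use G(2) in auto)
  then show ?thesis unfolding eq .
qed

text \<open>The legs are projected one after the other. Each error term is expanded over forms that
  vanish on \<open>C\<close>, and such forms act as zero on \<open>C\<close>.\<close>

lemma cop_restrict:
  assumes C: "subcoal C" "x \<in> C" and G: "bilin G"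
  shows "(\<Sum>(a, b)\<leftarrow>\<Delta> x. G a b) = (\<Sum>(a, b)\<leftarrow>\<Delta> x. G (proj C a) (proj C b))"
proof -
  let ?p = "proj C"
  note sub = subcoalD(1)[OF C(1)]
  have p: "lin (\<lambda>x. ?p x)" using lin_proj[OF sub] .
  have G1: "lin (\<lambda>x. G (f x) c)" if "lin f" for f c using lin_comp[OF bilinD(1)[OF G] that] .
  have G2: "lin (\<lambda>x. G c (f x))" if "lin f" for f c using lin_comp[OF bilinD(2)[OF G] that] .
  have "(\<Sum>(a, b)\<leftarrow>\<Delta> x. G a (b - ?p b)) \<in> {0}"
  proof (rule cop_expand[OF sub _ _ subspace_single_0])
    show "bilin (\<lambda>a b. G a (b - ?p b))" by (intro bilinI G1 G2 lin_intros p)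
    show "G a (w - ?p w) = 0" if "w \<in> C" for a w
      using that by (simp add: proj_id[OF sub] lin_0[OF bilinD(2)[OF G]])
    show "G (lhit \<phi> x) (c - ?p c) \<in> {0}" if "annih C \<phi>" for \<phi> c
      using annih_hits(1)[OF C that] by (simp add: lin_0[OF bilinD(1)[OF G]])
  qed
  then have 1: "(\<Sum>(a, b)\<leftarrow>\<Delta> x. G a b) = (\<Sum>(a, b)\<leftarrow>\<Delta> x. G a (?p b))"
    by (simp add: lin_diff[OF bilinD(2)[OF G]] split_def sum_list_subtractf)
  have "(\<Sum>(a, b)\<leftarrow>\<Delta> x. G (a - ?p a) (?p b)) \<in> {0}"
  proof (rule cop_expand_right[OF sub _ _ subspace_single_0])
    show "bilin (\<lambda>a b. G (a - ?p a) (?p b))" by (intro bilinI G1 G2 lin_intros p)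
    show "G (w - ?p w) (?p a) = 0" if "w \<in> C" for a w
      using that by (simp add: proj_id[OF sub] lin_0[OF bilinD(1)[OF G]])
    show "G (c - ?p c) (?p (rhit \<phi> x)) \<in> {0}" if "annih C \<phi>" for \<phi> c
      using annih_hits(2)[OF C that] by (simp add: lin_0[OF bilinD(2)[OF G]] lin_0[OF p])
  qed
  then have 2: "(\<Sum>(a, b)\<leftarrow>\<Delta> x. G a (?p b)) = (\<Sum>(a, b)\<leftarrow>\<Delta> x. G (?p a) (?p b))"
    by (simp add: lin_diff[OF bilinD(1)[OF G]] split_def sum_list_subtractf)
  show ?thesis by (simp only: 1 2)
qed

text \<open>Lets the legs of the coproduct of \<open>x \<in> C\<close> be treated as elements of
  \<open>C\<close>, although the entries of the chosen list may lie outside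
  \<open>C\<close>.\<close>

lemma cop_cong:
  assumes C: "subcoal C" "x \<in> C" and "bilin G" "bilin G'"
    and "\<And>a b. a \<in> C \<Longrightarrow> b \<in> C \<Longrightarrow> G a b = G' a b"
  shows "(\<Sum>(a, b)\<leftarrow>\<Delta> x. G a b) = (\<Sum>(a, b)\<leftarrow>\<Delta> x. G' a b)"
  unfolding cop_restrict[OF C assms(3)] cop_restrict[OF C assms(4)]
  by (rule sum_list_pairs_cong) (simp add: assms(5) proj_in subcoalD(1)[OF C(1)])

lemma cop_mem:
  assumes C: "subcoal C" "x \<in> C" and "bilin G" and Z: "subspace Z"
    and "\<And>a b. a \<in> C \<Longrightarrow> b \<in> C \<Longrightarrow> G a b \<in> Z"
  shows "(\<Sum>(a, b)\<leftarrow>\<Delta> x. G a b) \<in> Z"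
  unfolding cop_restrict[OF C assms(3)]
  by (rule subspace_pairs[OF Z]) (simp add: assms(5) proj_in subcoalD(1)[OF C(1)])

lemma lform_conv:
  assumes "lform \<phi>" "lform \<psi>"
  shows "lform (\<lambda>z. \<phi> (lhit \<psi> z))" "lform (\<lambda>z. \<phi> (rhit \<psi> z))"
  using lform_comp[OF assms(1) lin_lhit[OF assms(2)]] lform_comp[OF assms(1) lin_rhit[OF assms(2)]] .

section \<open>Orbits under the dual algebra and local finiteness\<close>

definition orb :: "'h \<Rightarrow> 'h set" where
  "orb x = {lhit \<phi> x | \<phi>. lform \<phi>}"

lemma orb_self: "x \<in> orb x"
  unfolding orb_def using lhit_eps[of x] eps_lform by (intro CollectI exI[of _ \<epsilon>]) simp

lemma subspace_hits:
  assumes "P (\<lambda>_. 0)" "\<And>\<phi> \<psi>. P \<phi> \<Longrightarrow> P \<psi> \<Longrightarrow> P (\<lambda>z. \<phi> z + \<psi> z)" "\<And>c \<phi>. P \<phi> \<Longrightarrow> P (\<lambda>z. c * \<phi> z)"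
  shows "subspace {lhit \<phi> x | \<phi>. P \<phi>}"
proof (rule subspaceI)
  have "lhit (\<lambda>_. 0) x = 0" by (simp add: lhit_def split_def)
  then show "0 \<in> {lhit \<phi> x | \<phi>. P \<phi>}"
    using assms(1) by (intro CollectI exI[of _ "\<lambda>_. 0"]) simp
  fix u v assume "u \<in> {lhit \<phi> x | \<phi>. P \<phi>}" "v \<in> {lhit \<phi> x | \<phi>. P \<phi>}"
  then obtain \<phi> \<psi> where "P \<phi>" "P \<psi>" "u = lhit \<phi> x" "v = lhit \<psi> x" by blast
  then show "u + v \<in> {lhit \<phi> x | \<phi>. P \<phi>}"
    using assms(2) lhit_add[of \<phi> \<psi> x] by (intro CollectI exI[of _ "\<lambda>z. \<phi> z + \<psi> z"]) simp
next
  fix c u assume "u \<in> {lhit \<phi> x | \<phi>. P \<phi>}"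
  then obtain \<phi> where "P \<phi>" "u = lhit \<phi> x" by blast
  then show "c \<star> u \<in> {lhit \<phi> x | \<phi>. P \<phi>}"
    using assms(3) lhit_scale[of c \<phi> x] by (intro CollectI exI[of _ "\<lambda>z. c * \<phi> z"]) simp
qed

lemma lform_closed:
  "lform (\<lambda>_. 0)" "lform \<phi> \<Longrightarrow> lform \<psi> \<Longrightarrow> lform (\<lambda>z. \<phi> z + \<psi> z)"
  "lform \<phi> \<Longrightarrow> lform \<psi> \<Longrightarrow> lform (\<lambda>z. \<phi> z - \<psi> z)" "lform \<phi> \<Longrightarrow> lform (\<lambda>z. c * \<phi> z)"
  by (auto simp: lform_iff algebra_simps)

lemma subspace_orb: "subspace (orb x)"
  unfolding orb_def by (rule subspace_hits) (auto intro: lform_closed)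

lemma subspace_annih_orb: "subspace {lhit \<phi> x | \<phi>. annih W \<phi>}"
  by (rule subspace_hits) (auto intro: lform_closed simp: annih_def)

lemma findim_orb: "findim (orb x)"
  unfolding findim_def
proof (intro exI conjI)
  have "lhit \<phi> x \<in> span (fst ` set (\<Delta> x))" for \<phi>
    unfolding lhit_def by (intro subspace_pairs subspace_span span_scale span_base) force
  then show "orb x \<subseteq> span (fst ` set (\<Delta> x))" by (auto simp: orb_def)
qed simp

lemma orb_lhit: "lform \<phi> \<Longrightarrow> z \<in> orb x \<Longrightarrow> lhit \<phi> z \<in> orb x"
  unfolding orb_def using lhit_lhit lform_conv(1) by blast

lemma orb_trans: "z \<in> orb x \<Longrightarrow> orb z \<subseteq> orb x"
  using orb_lhit by (auto simp: orb_def[of z])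

lemma subcoal_span:
  assumes "\<And>\<phi> x. lform \<phi> \<Longrightarrow> x \<in> T \<Longrightarrow> lhit \<phi> x \<in> span T"
    and "\<And>\<phi> x. lform \<phi> \<Longrightarrow> x \<in> T \<Longrightarrow> rhit \<phi> x \<in> span T"
  shows "subcoal (span T)"
proof (rule subcoalI)
  fix \<phi> x assume \<phi>: "lform \<phi>" and x: "x \<in> span T"
  show "lhit \<phi> x \<in> span T"
    using span_minimal[OF _ subspace_lin_vimage[OF lin_lhit[OF \<phi>] subspace_span], of T T] assms(1)[OF \<phi>] x
    by auto
  show "rhit \<phi> x \<in> span T"
    using span_minimal[OF _ subspace_lin_vimage[OF lin_rhit[OF \<phi>] subspace_span], of T T] assms(2)[OF \<phi>] x
    by auto
qed (rule subspace_span)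

lemma subcoal_span_Union:
  assumes "\<And>C. C \<in> \<C> \<Longrightarrow> subcoal C"
  shows "subcoal (span (\<Union>\<C>))"
  by (rule subcoal_span) (use assms subcoalD(2,3) in \<open>blast intro: span_base\<close>)+

lemma subcoal_Int: "subcoal C \<Longrightarrow> subcoal D \<Longrightarrow> subcoal (C \<inter> D)"
  by (rule subcoalI) (auto simp: subcoalD subspace_inter)

lemma finite_subcoal:
  obtains D where "subcoal D" "findim D" "x \<in> D" "\<And>C. subcoal C \<Longrightarrow> x \<in> C \<Longrightarrow> D \<subseteq> C"
proof
  let ?T = "{lhit \<phi> (rhit \<psi> x) | \<phi> \<psi>. lform \<phi> \<and> lform \<psi>}"
  show "subcoal (span ?T)"
  proof (rule subcoal_span)
    fix \<chi> z assume \<chi>: "lform \<chi>" and "z \<in> ?T"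
    then obtain \<phi> \<psi> where z: "z = lhit \<phi> (rhit \<psi> x)" and l: "lform \<phi>" "lform \<psi>" by blast
    have "lhit \<chi> z \<in> ?T" using lhit_lhit[OF \<chi> l(1)] lform_conv(1)[OF \<chi> l(1)] l(2) z by blast
    then show "lhit \<chi> z \<in> span ?T" by (rule span_base)
    have "rhit \<chi> z = lhit \<phi> (rhit (\<lambda>z. \<chi> (rhit \<psi> z)) x)"
      using rhit_rhit[OF \<chi> l(2)] lhit_rhit[OF l(1) \<chi>] z by metis
    then have "rhit \<chi> z \<in> ?T" using lform_conv(2)[OF \<chi> l(2)] l(1) by blast
    then show "rhit \<chi> z \<in> span ?T" by (rule span_base)
  qed
  let ?B = "\<Union>b\<in>snd ` set (\<Delta> x). fst ` set (\<Delta> b)"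
  have "?T \<subseteq> span ?B"
  proof
    fix z assume "z \<in> ?T"
    then obtain \<phi> \<psi> where z: "z = lhit \<phi> (rhit \<psi> x)" and l: "lform \<phi>" "lform \<psi>" by blast
    have "z = (\<Sum>(a, b)\<leftarrow>\<Delta> x. \<psi> a \<star> lhit \<phi> b)"
      using z by (simp add: rhit_def lin_pairs[OF lin_lhit[OF l(1)]] lin_scale[OF lin_lhit[OF l(1)]])
    also have "\<dots> \<in> span ?B"
    proof (intro subspace_pairs subspace_span span_scale)
      fix a b assume ab: "(a, b) \<in> set (\<Delta> x)"
      show "lhit \<phi> b \<in> span ?B" unfolding lhit_def
        by (intro subspace_pairs subspace_span span_scale span_base) (use ab in force)
    qed
    finally show "z \<in> span ?B" .
  qed
  then show "findim (span ?T)" unfolding findim_def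
    by (intro exI[of _ ?B] conjI span_minimal subspace_span) simp_all
  have "x = lhit \<epsilon> (rhit \<epsilon> x)" by (simp add: lhit_eps rhit_eps)
  then show "x \<in> span ?T" using eps_lform by (blast intro: span_base)
  show "span ?T \<subseteq> C" if "subcoal C" "x \<in> C" for C
    by (rule span_minimal) (use that subcoalD[OF that(1)] in auto)
qed

section \<open>Simple subcoalgebras and the wedge filtration\<close>

definition simple_subcoal :: "'h set \<Rightarrow> bool" where
  "simple_subcoal C \<longleftrightarrow> subcoal C \<and> C \<noteq> {0} \<and> (\<forall>D. subcoal D \<and> D \<subseteq> C \<longrightarrow> D = {0} \<or> D = C)"

definition corad :: "'h set" where
  "corad = span (\<Union> {C. simple_subcoal C})"

lemma subcoal_corad: "subcoal corad"
  unfolding corad_def by (rule subcoal_span_Union) (auto simp: simple_subcoal_def)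

lemma simple_subset_corad: "simple_subcoal C \<Longrightarrow> C \<subseteq> corad"
  unfolding corad_def by (auto intro: span_base)

text \<open>By local finiteness one may pass to a finite-dimensional subcoalgebra, where a nonzero
  subcoalgebra of least dimension is simple.\<close>

lemma exists_simple_subcoal:
  assumes "subcoal C" "C \<noteq> {0}"
  obtains E where "simple_subcoal E" "E \<subseteq> C"
proof -
  obtain x where x: "x \<in> C" "x \<noteq> 0" using assms subspace_0[OF subcoalD(1)[OF assms(1)]] by blast
  obtain D where D: "subcoal D" "findim D" "x \<in> D" "D \<subseteq> C"
    using finite_subcoal[of x] x assms(1) by metis
  let ?P = "\<lambda>E. subcoal E \<and> E \<noteq> {0} \<and> E \<subseteq> D"
  have "?P D" using D x by auto
  then obtain E where E: "?P E" "\<And>E'. ?P E' \<Longrightarrow> dim E \<le> dim E'"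
    using ex_has_least_nat[of ?P D dim] by blast
  have "E' = {0} \<or> E' = E" if "subcoal E'" "E' \<subseteq> E" for E'
  proof (rule ccontr)
    assume neg: "\<not> (E' = {0} \<or> E' = E)"
    then have "dim E' < dim E"
      using that E(1) D(2) by (intro dim_less_psubset) (auto simp: subcoalD intro: findim_mono)
    moreover have "?P E'" using that E(1) neg by auto
    ultimately show False using E(2) by force
  qed
  then have "simple_subcoal E" using E by (auto simp: simple_subcoal_def)
  then show ?thesis using that E D by blast
qed

text \<open>The successor consists of the \<open>x\<close> whose coproduct lies in U \<otimes> H + H
  \<otimes> K with U = \<open>wedge K n\<close>. Since indexing starts at \<open>K\<close>,
  \<open>wedge K n\<close> is the wedge of n + 1 copies of \<open>K\<close>.\<close>

primrec wedge :: "'h set \<Rightarrow> nat \<Rightarrow> 'h set" where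
  "wedge K 0 = K"
| "wedge K (Suc n) = {x. \<forall>\<phi>. annih K \<phi> \<longrightarrow> lhit \<phi> x \<in> wedge K n}"

lemma subcoal_wedge: "subcoal K \<Longrightarrow> subcoal (wedge K n)"
proof (induction n)
  case (Suc n)
  then have IH: "subcoal (wedge K n)" by simp
  show ?case
  proof (rule subcoalI)
    have "wedge K (Suc n) = (\<Inter>\<phi>\<in>{\<phi>. annih K \<phi>}. {x. lhit \<phi> x \<in> wedge K n})" by auto
    also have "subspace \<dots>"
      by (rule subspace_Int)
        (use IH in \<open>auto simp: annih_def subcoalD intro: subspace_lin_vimage lin_lhit\<close>)
    finally show "subspace (wedge K (Suc n))" .
  next
    fix \<psi> x assume \<psi>: "lform \<psi>" and x: "x \<in> wedge K (Suc n)"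
    show "lhit \<psi> x \<in> wedge K (Suc n)"
    proof (simp, intro allI impI)
      fix \<phi> assume \<phi>: "annih K \<phi>"
      then have l: "lform \<phi>" by (simp add: annih_def)
      \<comment> \<open>The forms vanishing on the subcoalgebra \<open>K\<close> are an ideal of the
        dual algebra, so the convolution of \<phi> with \<psi> vanishes on \<open>K\<close> as
        well.\<close>
      have "annih K (\<lambda>z. \<phi> (lhit \<psi> z))"
        using \<phi> lform_conv(1)[OF l \<psi>] subcoalD(2)[OF Suc.prems \<psi>] by (simp add: annih_def)
      then show "lhit \<phi> (lhit \<psi> x) \<in> wedge K n" using x lhit_lhit[OF l \<psi>] by simp
    qed
    show "rhit \<psi> x \<in> wedge K (Suc n)"
    proof (simp, intro allI impI)
      fix \<phi> assume \<phi>: "annih K \<phi>"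
      then have l: "lform \<phi>" by (simp add: annih_def)
      show "lhit \<phi> (rhit \<psi> x) \<in> wedge K n"
        using x \<phi> subcoalD(3)[OF IH \<psi>] lhit_rhit[OF l \<psi>] by simp
    qed
  qed
qed simp

lemma wedge_Suc: assumes "subcoal K" shows "wedge K n \<subseteq> wedge K (Suc n)"
proof
  fix x assume "x \<in> wedge K n"
  then show "x \<in> wedge K (Suc n)"
  proof (induction n arbitrary: x)
    case 0
    then show ?case using annih_hits(1)[OF assms] subspace_0[OF subcoalD(1)[OF assms]] by auto
  next
    case (Suc n)
    then show ?case by simp
  qed
qed

lemma wedge_mono: "subcoal K \<Longrightarrow> m \<le> n \<Longrightarrow> wedge K m \<subseteq> wedge K n"
  by (rule lift_Suc_mono_le[of "wedge K", OF wedge_Suc])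

lemma wedge_base: "subcoal K \<Longrightarrow> K \<subseteq> wedge K n"
  using wedge_mono[of K 0 n] by simp

lemma subspace_wedge_Union:
  assumes "subcoal K"
  shows "subspace (\<Union>n. wedge K n)"
proof (rule subspaceI)
  note sub = subcoalD(1)[OF subcoal_wedge[OF assms]]
  show "0 \<in> (\<Union>n. wedge K n)" using subspace_0[OF sub] by blast
  fix x y assume "x \<in> (\<Union>n. wedge K n)" "y \<in> (\<Union>n. wedge K n)"
  then obtain m n where "x \<in> wedge K m" "y \<in> wedge K n" by blast
  then have "x \<in> wedge K (max m n)" "y \<in> wedge K (max m n)"
    using wedge_mono[OF assms, of m "max m n"] wedge_mono[OF assms, of n "max m n"] by auto
  then show "x + y \<in> (\<Union>n. wedge K n)" using subspace_add[OF sub] by blast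
next
  fix c x assume "x \<in> (\<Union>n. wedge K n)"
  then show "c \<star> x \<in> (\<Union>n. wedge K n)"
    using subspace_scale[OF subcoalD(1)[OF subcoal_wedge[OF assms]]] by blast
qed

text \<open>A minimal left \<open>H\<^sup>*\<close>-submodule outside the union \<open>X\<close> of the wedge powers has a
  coefficient coalgebra; a shortest representation of an element of a simple subcoalgebra \<open>E\<close> of
  it shows that functionals vanishing on \<open>E\<close> map the submodule into \<open>X\<close>.\<close>

lemma wedge_exhausts:
  assumes K: "subcoal K" "corad \<subseteq> K"
  shows "\<exists>n. x \<in> wedge K n"
proof (rule ccontr)
  define X where "X = (\<Union>n. wedge K n)"
  assume "\<not> ?thesis"
  then have "x \<notin> X" by (auto simp: X_def)
  \<comment> \<open>Least orbit dimension means that every element of \<open>orb y\<close> outside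
    \<open>X\<close> generates \<open>orb y\<close>: modulo \<open>X\<close> this orbit is a simple
    module.\<close>
  then obtain y where y: "y \<notin> X" "\<And>z. z \<notin> X \<Longrightarrow> dim (orb y) \<le> dim (orb z)"
    using ex_has_least_nat[of "\<lambda>y. y \<notin> X" x "\<lambda>y. dim (orb y)"] by blast
  have orb_eq: "orb z = orb y" if "z \<in> orb y" "z \<notin> X" for z
  proof (rule ccontr)
    assume "orb z \<noteq> orb y"
    then have "dim (orb z) < dim (orb y)"
      using orb_trans[OF that(1)] by (intro dim_less_psubset subspace_orb findim_orb) auto
    then show False using y(2)[OF that(2)] by simp
  qed
  have X0: "0 \<in> X" using subspace_0[OF subcoalD(1)[OF K(1)]] by (auto simp: X_def intro!: exI[of _ 0])
  have X_lhit: "lhit \<phi> z \<in> X" if "lform \<phi>" "z \<in> X" for \<phi> z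
    using that subcoalD(2)[OF subcoal_wedge[OF K(1)]] by (auto simp: X_def)
  \<comment> \<open>The values \<open>val L\<close> are sums of matrix coefficients of the simple
    quotient of \<open>orb y\<close>: forms on the quotient paired with vectors of the orbit. Formal
    lists are kept because the length of a representation is minimised below.\<close>
  define ok where "ok L \<longleftrightarrow> (\<forall>(f, v)\<in>set L. annih (orb y \<inter> X) f \<and> v \<in> orb y)" for L
  define val where "val L = (\<Sum>(f, v)\<leftarrow>L. rhit f v)" for L :: "(('h \<Rightarrow> 'k) \<times> 'h) list"
  have val_map: "F (val L) = val (map (\<lambda>(f, v). (f, F v)) L)"
    if "lin F" "\<And>f v. (f, v) \<in> set L \<Longrightarrow> F (rhit f v) = rhit f (F v)" for F L
    using that(2) unfolding val_def by (induction L) (auto simp: lin_0[OF that(1)] lin_add[OF that(1)])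
  have val_lhit: "lhit \<phi> (val L) = val (map (\<lambda>(f, v). (f, lhit \<phi> v)) L)" if "lform \<phi>" "ok L" for \<phi> L
    by (rule val_map[OF lin_lhit[OF that(1)]]) (use that lhit_rhit in \<open>auto simp: ok_def annih_def\<close>)
  have ok_lhit: "ok (map (\<lambda>(f, v). (f, lhit \<phi> v)) L)" if "lform \<phi>" "ok L" for \<phi> L
    using that orb_lhit by (auto simp: ok_def)
  let ?C = "val ` Collect ok"
  have C: "subcoal ?C"
  proof (rule subcoalI)
    show "subspace ?C"
    proof (rule subspaceI)
      show "0 \<in> ?C" by (rule image_eqI[of _ _ "[]"]) (auto simp: val_def ok_def)
    next
      fix u v assume "u \<in> ?C" "v \<in> ?C"
      then obtain L M where "u = val L" "v = val M" "ok L" "ok M" by blast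
      then show "u + v \<in> ?C" by (intro image_eqI[of _ _ "L @ M"]) (auto simp: val_def ok_def)
    next
      fix c u assume "u \<in> ?C"
      then obtain L where L: "u = val L" "ok L" by blast
      have "c \<star> u = val (map (\<lambda>(f, v). (f, c \<star> v)) L)" unfolding L(1)
        by (rule val_map) (use L(2) in \<open>auto intro!: lin_intros simp: ok_def annih_def lin_scale[OF lin_rhit]\<close>)
      moreover have "ok (map (\<lambda>(f, v). (f, c \<star> v)) L)"
        using L(2) subspace_scale[OF subspace_orb] by (auto simp: ok_def)
      ultimately show "c \<star> u \<in> ?C" by blast
    qed
  next
    fix \<phi> u assume \<phi>: "lform \<phi>" and "u \<in> ?C"
    then obtain L where L: "u = val L" "ok L" by blast
    show "lhit \<phi> u \<in> ?C" using val_lhit[OF \<phi> L(2)] ok_lhit[OF \<phi> L(2)] L(1) by blast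
    let ?L = "map (\<lambda>(f, v). (\<lambda>z. \<phi> (rhit f z), v)) L"
    have "rhit \<phi> u = val ?L"
      using L(2) unfolding L(1) val_def lin_pairs[OF lin_rhit[OF \<phi>]]
      by (simp add: comp_def split_def)
        (rule arg_cong[where f = sum_list], rule map_cong,
          auto simp: ok_def annih_def rhit_rhit[OF \<phi>])
    moreover have "ok ?L"
      using L(2) \<phi> X_lhit orb_lhit
      by (auto simp: ok_def annih_def lform_conv lhit_rhit_adjoint[symmetric])
    ultimately show "rhit \<phi> u \<in> ?C" by blast
  qed
  have "subspace (orb y \<inter> X)"
    using subspace_wedge_Union[OF K(1)] subspace_inter[OF subspace_orb] by (simp add: X_def)
  then obtain f where f: "annih (orb y \<inter> X) f" "f y = 1"
    using lform_separate[of "orb y \<inter> X" y] y(1) by (metis Int_iff annih_def)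
  have "val [(f, y)] \<in> ?C" using f orb_self by (auto simp: ok_def)
  moreover have "\<epsilon> (val [(f, y)]) = 1" using f by (simp add: val_def annih_def eps_rhit)
  ultimately have "?C \<noteq> {0}" using lform_0[OF eps_lform] by (metis singletonD zero_neq_one)
  from exists_simple_subcoal[OF C this] obtain E where E: "simple_subcoal E" "E \<subseteq> ?C" .
  then have E': "subcoal E" "E \<noteq> {0}" by (auto simp: simple_subcoal_def)
  obtain e0 where "e0 \<in> E" "e0 \<noteq> 0" using E'(2) subspace_0[OF subcoalD(1)[OF E'(1)]] by blast
  then obtain L0 where "ok L0 \<and> val L0 \<in> E \<and> val L0 \<noteq> 0" using E(2) by blast
  then obtain L where L: "ok L" "val L \<in> E" "val L \<noteq> 0"
    and Lmin: "\<And>M. ok M \<Longrightarrow> val M \<in> E \<Longrightarrow> length M < length L \<Longrightarrow> val M = 0"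
    using ex_has_least_nat[of "\<lambda>L. ok L \<and> val L \<in> E \<and> val L \<noteq> 0" L0 length] by (metis not_le)
  obtain f v M where L_eq: "L = (f, v) # M" using L(3) by (cases L) (auto simp: val_def)
  have fv: "annih (orb y \<inter> X) f" "v \<in> orb y" and M: "ok M" using L(1) by (auto simp: L_eq ok_def)
  have f0: "rhit f w = 0" if "w \<in> orb y \<inter> X" for w
  proof (rule lform_determined)
    fix \<phi> assume "lform \<phi>"
    then show "\<phi> (rhit f w) = \<phi> 0"
      using that fv(1) X_lhit orb_lhit by (auto simp: annih_def lhit_rhit_adjoint[symmetric] lform_0)
  qed
  \<comment> \<open>By \<open>f0\<close> the head of the list drops out, leaving a shorter
    representation of an element of \<open>E\<close>, which is 0 by minimality. So v \<mapsto>
    \<open>val L\<close> induces a module map from the simple quotient to \<open>E\<close>.\<close>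
  have kill: "lhit \<phi> (val L) = 0" if \<phi>: "lform \<phi>" and w: "lhit \<phi> v \<in> X" for \<phi>
  proof -
    have "lhit \<phi> (val L) = val (map (\<lambda>(f, v). (f, lhit \<phi> v)) M)"
      unfolding val_lhit[OF \<phi> L(1)] using f0[of "lhit \<phi> v"] w orb_lhit[OF \<phi> fv(2)] by (simp add: L_eq val_def)
    moreover have "lhit \<phi> (val L) \<in> E" using subcoalD(2)[OF E'(1) \<phi> L(2)] .
    ultimately show ?thesis using Lmin[OF ok_lhit[OF \<phi> M]] by (simp add: L_eq)
  qed
  have "v \<notin> X" using kill[OF eps_lform] L(3) by (auto simp: lhit_eps)
  have step: "lhit \<phi> y \<in> X" if \<phi>: "annih E \<phi>" for \<phi>
  proof (rule ccontr)
    assume w: "lhit \<phi> y \<notin> X"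
    have l: "lform \<phi>" using \<phi> by (simp add: annih_def)
    obtain \<chi> where \<chi>: "lform \<chi>" "y = lhit \<chi> v"
      using orb_self[of y] orb_eq[OF fv(2) \<open>v \<notin> X\<close>] by (auto simp: orb_def)
    obtain \<psi> where \<psi>: "lform \<psi>" "v = lhit \<psi> (lhit \<phi> y)"
      using fv(2) orb_eq[OF orb_lhit[OF l orb_self] w] by (auto simp: orb_def)
    \<comment> \<open>The convolution of \<psi>, \<phi> and \<chi>. It fixes \<open>v\<close>, so by
      \<open>kill\<close> it also fixes \<open>val L\<close>; but \<phi> kills every element of
      \<open>E\<close>.\<close>
    define \<omega> where "\<omega> z = \<psi> (lhit (\<lambda>z. \<phi> (lhit \<chi> z)) z)" for z
    have \<omega>: "lform \<omega>" "\<And>z. lhit \<omega> z = lhit \<psi> (lhit \<phi> (lhit \<chi> z))"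
      unfolding \<omega>_def using lform_conv(1)[OF \<psi>(1) lform_conv(1)[OF l \<chi>(1)]]
        lhit_lhit[OF \<psi>(1) lform_conv(1)[OF l \<chi>(1)]] lhit_lhit[OF l \<chi>(1)] by auto
    have "lhit (\<lambda>z. \<omega> z - \<epsilon> z) v = 0" 
      using \<omega>(2)[of v] \<chi>(2)[symmetric] \<psi>(2)[symmetric] by (simp add: lhit_diff lhit_eps)
    then have "lhit (\<lambda>z. \<omega> z - \<epsilon> z) (val L) = 0" using X0 by (intro kill lform_closed \<omega> eps_lform) simp
    then have "val L = lhit \<psi> (lhit \<phi> (lhit \<chi> (val L)))" using \<omega>(2) by (simp add: lhit_diff lhit_eps)
    also have "lhit \<phi> (lhit \<chi> (val L)) = 0"
      using annih_hits(1)[OF E'(1) subcoalD(2)[OF E'(1) \<chi>(1) L(2)] \<phi>] .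
    finally show False using L(3) lin_0[OF lin_lhit[OF \<psi>(1)]] by simp
  qed
  have "E \<subseteq> K" using simple_subset_corad[OF E(1)] K(2) by simp
  \<comment> \<open>Contained in the finite-dimensional \<open>orb y\<close>, this space lies in a
    single wedge power, so \<open>y\<close> lies in the next one.\<close>
  let ?J = "{lhit \<phi> y | \<phi>. annih K \<phi>}"
  have "annih E \<phi>" if "annih K \<phi>" for \<phi> using that \<open>E \<subseteq> K\<close> by (auto simp: annih_def)
  then have "?J \<subseteq> (\<Union>n. wedge K n)" using step by (auto simp: X_def)
  moreover have "findim ?J" by (rule findim_mono[OF findim_orb[of y]]) (auto simp: orb_def annih_def)
  ultimately obtain n where "?J \<subseteq> wedge K n"
    using findim_chain[OF subspace_annih_orb, of y K "wedge K"] wedge_mono[OF K(1)]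
      subcoalD(1)[OF subcoal_wedge[OF K(1)]] by blast
  then have "y \<in> wedge K (Suc n)" by auto
  then show False using y(1) unfolding X_def by blast
qed

section \<open>Hopf subalgebras containing the coradical\<close>

definition subalg :: "'h set \<Rightarrow> bool" where
  "subalg A \<longleftrightarrow> subspace A \<and> \<one> \<in> A \<and> (\<forall>x\<in>A. \<forall>y\<in>A. x \<odot> y \<in> A)"

lemma subalgD:
  assumes "subalg A"
  shows "subspace A" "\<one> \<in> A" "x \<in> A \<Longrightarrow> y \<in> A \<Longrightarrow> x \<odot> y \<in> A"
  using assms by (auto simp: subalg_def)

definition hopf_sub :: "'h set \<Rightarrow> bool" where
  "hopf_sub A \<longleftrightarrow> subalg A \<and> subcoal A \<and> S ` A \<subseteq> A"

lemma hopf_subD: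
  assumes "hopf_sub A"
  shows "subalg A" "subcoal A" "subspace A" "\<one> \<in> A" "x \<in> A \<Longrightarrow> S x \<in> A"
    "x \<in> A \<Longrightarrow> y \<in> A \<Longrightarrow> x \<odot> y \<in> A"
  using assms by (auto simp: hopf_sub_def subalg_def)

lemma subalg_hull: "subalg (subalg hull T)"
  by (rule hull_in) (auto simp: subalg_def intro: subspace_Inter)

text \<open>\<open>P x\<close> says that the coproduct of \<open>x\<close> lies in the tensor square
  of the generated algebra. It is tested by all bilinear maps and all target subspaces because, for
  a product, evaluating one factor yields a new bilinear map for the other.\<close>

lemma subcoal_hull:
  assumes E: "subcoal E"
  shows "subcoal (subalg hull E)"
proof -
  let ?A = "subalg hull E"
  note A = subalgD[OF subalg_hull[of E]]
  define P where "P x \<longleftrightarrow> (\<forall>G Z. bilin G \<and> subspace Z \<and> (\<forall>a\<in>?A. \<forall>b\<in>?A. G a b \<in> Z)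
    \<longrightarrow> (\<Sum>(a, b)\<leftarrow>\<Delta> x. G a b) \<in> Z)" for x
  have "subalg {x \<in> ?A. P x}"
    unfolding subalg_def[of "{x \<in> ?A. P x}"]
  proof (intro conjI ballI)
    show "subspace {x \<in> ?A. P x}"
    proof (rule subspaceI)
      show "0 \<in> {x \<in> ?A. P x}"
        using A(1) by (auto simp: P_def subspace_0 lin_0[OF cop_lin])
      fix x y assume "x \<in> {x \<in> ?A. P x}" "y \<in> {x \<in> ?A. P x}"
      then show "x + y \<in> {x \<in> ?A. P x}"
        using A(1) by (auto simp: P_def subspace_add lin_add[OF cop_lin])
    next
      fix c x assume "x \<in> {x \<in> ?A. P x}"
      then show "c \<star> x \<in> {x \<in> ?A. P x}"
        using A(1) by (auto simp: P_def subspace_scale lin_scale[OF cop_lin])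
    qed
    show "\<one> \<in> {x \<in> ?A. P x}" using A(2) by (auto simp: P_def cop_one)
    fix x y assume x: "x \<in> {x \<in> ?A. P x}" and y: "y \<in> {x \<in> ?A. P x}"
    have "P (x \<odot> y)"
      unfolding P_def
    proof (intro allI impI, elim conjE)
      fix G Z assume G: "bilin G" and Z: "subspace Z" and mem: "\<forall>a\<in>?A. \<forall>b\<in>?A. G a b \<in> Z"
      have G1: "lin (\<lambda>x. G (f x) c)" if "lin f" for f c using lin_comp[OF bilinD(1)[OF G] that] .
      have G2: "lin (\<lambda>x. G c (f x))" if "lin f" for f c using lin_comp[OF bilinD(2)[OF G] that] .
      have "(\<Sum>(c, d)\<leftarrow>\<Delta> y. G (a \<odot> c) (b \<odot> d)) \<in> Z" if "a \<in> ?A" "b \<in> ?A" for a b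
      proof -
        have "bilin (\<lambda>c d. G (a \<odot> c) (b \<odot> d))" by (intro lin_intros G1 G2)
        then show ?thesis using y Z mem A(3) that by (auto simp: P_def)
      qed
      moreover have "bilin (\<lambda>a b. \<Sum>(c, d)\<leftarrow>\<Delta> y. G (a \<odot> c) (b \<odot> d))"
        by (intro lin_intros G1 G2)
      ultimately show "(\<Sum>(a, b)\<leftarrow>\<Delta> (x \<odot> y). G a b) \<in> Z"
        unfolding cop_mul[OF G] using x Z unfolding P_def by blast
    qed
    then show "x \<odot> y \<in> {x \<in> ?A. P x}" using x y A(3) by auto
  qed
  moreover have "E \<subseteq> {x \<in> ?A. P x}"
    using hull_subset[of E subalg] cop_mem[OF E] by (auto simp: P_def) (meson in_mono)
  ultimately have P: "P x" if "x \<in> ?A" for x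
    using hull_minimal[of E "{x \<in> ?A. P x}" subalg] that by blast
  show ?thesis
  proof (rule subcoalI[OF A(1)])
    fix \<phi> x assume \<phi>: "lform \<phi>" and x: "x \<in> ?A"
    have "bilin (\<lambda>a b. \<phi> b \<star> a)" "bilin (\<lambda>a b. \<phi> a \<star> b)" by (intro lin_intros \<phi>)+
    then show "lhit \<phi> x \<in> ?A" "rhit \<phi> x \<in> ?A"
      using P[OF x] A(1) unfolding P_def lhit_def rhit_def by (auto simp: subspace_scale)
  qed
qed

text \<open>Takeuchi: convolution invertibility of the inclusion of \<open>K\<close> is decided on the coradical.\<close>

lemma antipode_closed:
  assumes K: "subalg K" "subcoal K" "corad \<subseteq> K" "S ` corad \<subseteq> K"
  shows "S ` K \<subseteq> K"
proof -
  let ?p = "proj corad" and ?r = "proj K"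
  note sub = subcoalD(1)[OF subcoal_corad] subcoalD(1)[OF K(2)]
  have p: "lin (\<lambda>x. ?p (f x))" if "lin f" for f using lin_comp[OF lin_proj[OF sub(1)] that] .
  have r: "lin ?r" using lin_proj[OF sub(2)] .
  \<comment> \<open>\<open>T\<close> is a first approximation to the antipode with values in
    \<open>K\<close>. The defect \<open>D\<close>, the convolution of the identity with
    \<open>T\<close> minus the unit, vanishes on the coradical and maps \<open>K\<close> to
    \<open>K\<close>.\<close>
  define T where "T x = S (?p x)" for x
  have T: "lin (\<lambda>x. T (f x))" if "lin f" for f unfolding T_def by (intro lin_intros p that)
  have TK: "T x \<in> K" for x using proj_in[OF sub(1)] K(4) by (auto simp: T_def)
  define D where "D x = (\<Sum>(a, b)\<leftarrow>\<Delta> x. a \<odot> T b) - \<epsilon> x \<star> \<one>" for x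
  have D: "lin (\<lambda>x. D (f x))" if "lin f" for f unfolding D_def by (intro lin_intros T that)
  have D0: "D w = 0" if w: "w \<in> corad" for w
  proof -
    have "(\<Sum>(a, b)\<leftarrow>\<Delta> w. a \<odot> T b) = (\<Sum>(a, b)\<leftarrow>\<Delta> w. a \<odot> S b)"
      by (rule cop_cong[OF subcoal_corad w]) (intro lin_intros T, intro lin_intros, simp add: T_def proj_id[OF sub(1)])
    then show ?thesis by (simp add: D_def antipode_right)
  qed
  have DK: "D x \<in> K" if x: "x \<in> K" for x
    unfolding D_def
    by (intro subspace_diff[OF sub(2)] subspace_scale[OF sub(2)] subalgD[OF K(1)]
        cop_mem[OF K(2) x _ sub(2)] TK lin_intros T)
  \<comment> \<open>\<open>S\<close> is convolution inverse to the identity, so convolving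
    \<open>D\<close> with \<open>S\<close> from the left gives \<open>T - S\<close>.\<close>
  have S_eq: "S x = T x - (\<Sum>(a, b)\<leftarrow>\<Delta> x. S a \<odot> D b)" for x
  proof -
    have "(\<Sum>(a, e)\<leftarrow>\<Delta> x. S a \<odot> D e) = (\<Sum>(a, e)\<leftarrow>\<Delta> x. \<Sum>(b, c)\<leftarrow>\<Delta> e. S a \<odot> (b \<odot> T c)) - (\<Sum>(a, e)\<leftarrow>\<Delta> x. \<epsilon> e \<star> S a)"
      unfolding D_def mul_diff mul_pairs mul_scale mul_one
      by (simp add: split_def sum_list_subtractf)
    also have "(\<Sum>(a, e)\<leftarrow>\<Delta> x. \<Sum>(b, c)\<leftarrow>\<Delta> e. S a \<odot> (b \<odot> T c)) = (\<Sum>(e, c)\<leftarrow>\<Delta> x. \<Sum>(a, b)\<leftarrow>\<Delta> e. S a \<odot> (b \<odot> T c))"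
      by (rule cop_coassoc[symmetric]) (intro lin_intros T)
    also have "\<dots> = (\<Sum>(e, c)\<leftarrow>\<Delta> x. \<Sum>(a, b)\<leftarrow>\<Delta> e. (S a \<odot> b) \<odot> T c)" by (simp add: mul_assoc)
    also have "\<dots> = (\<Sum>(e, c)\<leftarrow>\<Delta> x. \<epsilon> e \<star> (\<one> \<odot> T c))"
      by (intro sum_list_pairs_cong contract_antipode(1)) (intro lin_intros)
    also have "\<dots> = \<one> \<odot> T x" by (rule contract_counit(1)) (intro lin_intros T)
    also have "(\<Sum>(a, e)\<leftarrow>\<Delta> x. \<epsilon> e \<star> S a) = S x" by (rule contract_counit(2)) (intro lin_intros)
    finally show ?thesis by (simp add: one_mul)
  qed
  have "S x \<in> K" if "x \<in> K" "x \<in> wedge corad n" for x n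
    using that
  proof (induction n arbitrary: x)
    case 0
    then show ?case using K(4) by auto
  next
    case (Suc n)
    \<comment> \<open>Composing with \<open>?r\<close> gives \<open>D\<close> values in
      \<open>K\<close> on arbitrary arguments. As \<open>D\<close> kills the coradical, only
      contractions of \<open>x\<close> by forms vanishing there survive, and these lower the wedge
      degree.\<close>
    have "(\<Sum>(a, b)\<leftarrow>\<Delta> x. S a \<odot> D b) = (\<Sum>(a, b)\<leftarrow>\<Delta> x. S a \<odot> D (?r b))"
      by (rule cop_cong[OF K(2) Suc.prems(1)]) (intro lin_intros D, intro lin_intros D r, simp add: proj_id[OF sub(2)])
    also have "\<dots> \<in> K"
    proof (rule cop_expand[OF sub(1) _ _ sub(2)])
      show "bilin (\<lambda>a b. S a \<odot> D (?r b))" by (intro lin_intros D r)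
      show "S a \<odot> D (?r w) = 0" if "w \<in> corad" for a w
        using that K(3) by (simp add: proj_id[OF sub(2)] D0 subsetD)
      show "S (lhit \<phi> x) \<odot> D (?r c) \<in> K" if "annih corad \<phi>" for \<phi> c
        using that Suc by (intro subalgD[OF K(1)] DK proj_in[OF sub(2)] Suc.IH)
          (auto simp: annih_def subcoalD[OF K(2)])
    qed
    finally show ?case unfolding S_eq[of x] by (rule subspace_diff[OF sub(2) TK])
  qed
  then show ?thesis using wedge_exhausts[OF subcoal_corad] by blast
qed

section \<open>Wedge quotients as Hopf modules\<close>

lemma wedge_mul:
  assumes K: "hopf_sub K"
  shows "x \<in> wedge K n \<Longrightarrow> k \<in> K \<Longrightarrow> x \<odot> k \<in> wedge K n"
proof (induction n arbitrary: x k)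
  case 0
  then show ?case using hopf_subD(6)[OF K] by simp
next
  case (Suc n)
  note k = Suc.prems(2)
  note sub = subcoalD(1)[OF subcoal_wedge[OF hopf_subD(2)[OF K]]]
  show ?case
  proof (simp, intro allI impI)
    fix \<phi> assume \<phi>: "annih K \<phi>"
    then have l: "lform \<phi>" by (simp add: annih_def)
    have l': "lform (\<lambda>x. \<phi> (f x))" if "lin f" for f using lform_comp[OF l that] .
    have "lhit \<phi> (x \<odot> k) = (\<Sum>(a, b)\<leftarrow>\<Delta> x. \<Sum>(c, d)\<leftarrow>\<Delta> k. \<phi> (b \<odot> d) \<star> (a \<odot> c))"
      unfolding lhit_def by (rule cop_mul) (intro lin_intros l)
    also have "\<dots> = (\<Sum>(c, d)\<leftarrow>\<Delta> k. \<Sum>(a, b)\<leftarrow>\<Delta> x. \<phi> (b \<odot> d) \<star> (a \<odot> c))"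
      by (rule sum_list_pairs_swap)
    also have "\<dots> \<in> wedge K n"
    proof (rule cop_mem[OF hopf_subD(2)[OF K] k _ sub])
      show "bilin (\<lambda>c d. \<Sum>(a, b)\<leftarrow>\<Delta> x. \<phi> (b \<odot> d) \<star> (a \<odot> c))" by (intro lin_intros l')
      fix c d assume c: "c \<in> K" and d: "d \<in> K"
      \<comment> \<open>\<open>K\<close> is closed under multiplication by \<open>d\<close>, so the
        translated form still vanishes on \<open>K\<close> and lowers the wedge degree of
        \<open>x\<close>.\<close>
      have "annih K (\<lambda>z. \<phi> (z \<odot> d))"
        using \<phi> d l'[OF mul_lin(1)] by (auto simp: annih_def hopf_subD[OF K])
      then have "lhit (\<lambda>z. \<phi> (z \<odot> d)) x \<odot> c \<in> wedge K n" using Suc by (auto simp: c)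
      then show "(\<Sum>(a, b)\<leftarrow>\<Delta> x. \<phi> (b \<odot> d) \<star> (a \<odot> c)) \<in> wedge K n"
        by (simp add: lhit_def mul_pairs mul_scale)
    qed
    finally show "lhit \<phi> (x \<odot> k) \<in> wedge K n" .
  qed
qed

text \<open>Modulo \<open>wedge K n\<close> the second leg of the coproduct of \<open>h\<close> lies
  in \<open>K\<close>; this is the coaction of \<open>K\<close> on the quotient of consecutive wedge
  powers. \<open>G0\<close> says that \<open>G\<close> sees its first argument only modulo
  \<open>wedge K n\<close>.\<close>

lemma cop_replace:
  assumes K: "subspace K" and h: "h \<in> wedge K (Suc n)" and G: "bilin G"
    and G0: "\<And>u c. u \<in> wedge K n \<Longrightarrow> G u c = 0"
  shows "(\<Sum>(a, b)\<leftarrow>\<Delta> h. G a b) = (\<Sum>(a, b)\<leftarrow>\<Delta> h. G a (proj K b))"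
proof -
  have G1: "lin (\<lambda>x. G (f x) c)" if "lin f" for f c using lin_comp[OF bilinD(1)[OF G] that] .
  have G2: "lin (\<lambda>x. G c (f x))" if "lin f" for f c using lin_comp[OF bilinD(2)[OF G] that] .
  have "(\<Sum>(a, b)\<leftarrow>\<Delta> h. G a (b - proj K b)) \<in> {0}"
  proof (rule cop_expand[OF K _ _ subspace_single_0])
    show "bilin (\<lambda>a b. G a (b - proj K b))" by (intro bilinI G1 G2 lin_intros lin_proj[OF K])
    show "G a (w - proj K w) = 0" if "w \<in> K" for a w
      using that by (simp add: proj_id[OF K] lin_0[OF bilinD(2)[OF G]])
    show "G (lhit \<phi> h) (c - proj K c) \<in> {0}" if "annih K \<phi>" for \<phi> c
      using that h G0 by simp
  qed
  then show ?thesis by (simp add: lin_diff[OF bilinD(2)[OF G]] split_def sum_list_subtractf)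
qed

text \<open>The successive quotients \<open>wedge K (Suc n) / wedge K n\<close> are right Hopf modules over \<open>K\<close>.
  \<open>coinv\<close> lifts the projection onto the coinvariants of this quotient and \<open>hopf_lift\<close> the
  isomorphism of the fundamental theorem of Hopf modules.\<close>

definition coinv :: "'h set \<Rightarrow> nat \<Rightarrow> 'h \<Rightarrow> 'h" where
  "coinv K n h = (\<Sum>(a, b)\<leftarrow>\<Delta> h. a \<odot> S (proj K b) - proj (wedge K n) (a \<odot> S (proj K b)))"

definition hopf_lift :: "'h set \<Rightarrow> nat \<Rightarrow> 'h \<Rightarrow> 'h" where
  "hopf_lift K n h = (\<Sum>(a, b)\<leftarrow>\<Delta> h. coinv K n a \<odot> proj K b)"

context
  fixes K :: "'h set" and n :: nat
  assumes K: "hopf_sub K"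
begin

private abbreviation "U \<equiv> wedge K n"
private abbreviation "U' \<equiv> wedge K (Suc n)"

text \<open>A linear choice of representatives modulo \<open>wedge K n\<close>, by which maps into
  the quotient become maps into \<open>H\<close>.\<close>

private definition rem where "rem x = x - proj U x"

lemma subspace_wedge: "subspace (wedge K m)"
  using subcoalD(1)[OF subcoal_wedge[OF hopf_subD(2)[OF K]]] .

private lemma rem0: "u \<in> U \<Longrightarrow> rem u = 0"
  by (simp add: rem_def proj_id[OF subspace_wedge])

private lemma lin_rem: "lin f \<Longrightarrow> lin (\<lambda>x. rem (f x))"
  unfolding rem_def by (intro lin_intros lin_comp[OF lin_proj[OF subspace_wedge]])

private lemma lin_r: "lin f \<Longrightarrow> lin (\<lambda>x. proj K (f x))"
  by (rule lin_comp[OF lin_proj[OF hopf_subD(3)[OF K]]])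

private lemmas r_in = proj_in[OF hopf_subD(3)[OF K]]
private lemmas r_id = proj_id[OF hopf_subD(3)[OF K]]
private lemmas U_mul = wedge_mul[OF K]
private lemmas KD = hopf_subD(4-6)[OF K]
private lemmas intros = lin_intros lin_rem lin_r

private lemma coinv_eq: "coinv K n h = (\<Sum>(a, b)\<leftarrow>\<Delta> h. rem (a \<odot> S (proj K b)))"
  by (simp add: coinv_def rem_def)

lemma lin_coinv: "lin f \<Longrightarrow> lin (\<lambda>x. coinv K n (f x))"
  unfolding coinv_eq by (intro intros)

lemma coinv_base: "u \<in> wedge K n \<Longrightarrow> coinv K n u = 0"
proof -
  assume u: "u \<in> U"
  have "coinv K n u \<in> {0}" unfolding coinv_eq
    by (rule cop_mem[OF subcoal_wedge[OF hopf_subD(2)[OF K]] u _ subspace_single_0], intro intros)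
      (simp add: rem0 U_mul KD r_in)
  then show ?thesis by simp
qed

lemma coinv_mul:
  assumes h: "h \<in> wedge K (Suc n)" and k: "k \<in> K"
  shows "coinv K n (h \<odot> k) = \<epsilon> k \<star> coinv K n h"
proof -
  have "coinv K n (h \<odot> k) = (\<Sum>(a, b)\<leftarrow>\<Delta> h. \<Sum>(c, d)\<leftarrow>\<Delta> k. rem (a \<odot> c \<odot> S (proj K (b \<odot> d))))"
    unfolding coinv_eq by (rule cop_mul) (intro intros)
  also have "\<dots> = (\<Sum>(a, b)\<leftarrow>\<Delta> h. \<Sum>(c, d)\<leftarrow>\<Delta> k. rem (a \<odot> c \<odot> S (proj K (proj K b \<odot> d))))"
  proof (rule cop_replace[OF hopf_subD(3)[OF K] h])
    show "bilin (\<lambda>a b. \<Sum>(c, d)\<leftarrow>\<Delta> k. rem (a \<odot> c \<odot> S (proj K (b \<odot> d))))" by (intro intros)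
    fix u b assume u: "u \<in> U"
    have "(\<Sum>(c, d)\<leftarrow>\<Delta> k. rem (u \<odot> c \<odot> S (proj K (b \<odot> d)))) \<in> {0}"
      by (rule cop_mem[OF hopf_subD(2)[OF K] k _ subspace_single_0], intro intros)
        (simp add: rem0 U_mul KD r_in u)
    then show "(\<Sum>(c, d)\<leftarrow>\<Delta> k. rem (u \<odot> c \<odot> S (proj K (b \<odot> d)))) = 0" by simp
  qed
  also have "\<dots> = (\<Sum>(a, b)\<leftarrow>\<Delta> h. \<Sum>(c, d)\<leftarrow>\<Delta> k. rem (a \<odot> (c \<odot> S d) \<odot> S (proj K b)))"
    by (intro sum_list_pairs_cong cop_cong[OF hopf_subD(2)[OF K] k] intros)
      (simp add: r_id r_in KD S_mul mul_assoc)
  also have "\<dots> = (\<Sum>(a, b)\<leftarrow>\<Delta> h. \<epsilon> k \<star> rem (a \<odot> \<one> \<odot> S (proj K b)))"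
    by (intro sum_list_pairs_cong contract_antipode(2)) (intro intros)
  also have "\<dots> = \<epsilon> k \<star> coinv K n h"
    by (simp add: coinv_eq scale_pairs mul_one)
  finally show ?thesis .
qed

lemma lin_hopf_lift: "lin (hopf_lift K n)"
  unfolding hopf_lift_def[abs_def] by (intro intros lin_coinv)

lemma hopf_lift_base: "u \<in> wedge K n \<Longrightarrow> hopf_lift K n u = 0"
proof -
  assume u: "u \<in> U"
  have "hopf_lift K n u \<in> {0}" unfolding hopf_lift_def
    by (rule cop_mem[OF subcoal_wedge[OF hopf_subD(2)[OF K]] u _ subspace_single_0], intro intros lin_coinv)
      (simp add: coinv_base)
  then show ?thesis by simp
qed

text \<open>Together with \<open>hopf_lift_base\<close> and \<open>hopf_lift_id\<close> this makes
  \<open>h - hopf_lift K n h\<close> a right \<open>K\<close>-linear retraction of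
  \<open>wedge K (Suc n)\<close> onto \<open>wedge K n\<close>. Freeness of the quotient is used
  only through this splitting.\<close>

lemma hopf_lift_mul:
  assumes h: "h \<in> wedge K (Suc n)" and k: "k \<in> K"
  shows "hopf_lift K n (h \<odot> k) = hopf_lift K n h \<odot> k"
proof -
  have "hopf_lift K n (h \<odot> k) = (\<Sum>(a, b)\<leftarrow>\<Delta> h. \<Sum>(c, d)\<leftarrow>\<Delta> k. coinv K n (a \<odot> c) \<odot> proj K (b \<odot> d))"
    unfolding hopf_lift_def by (rule cop_mul) (intro intros lin_coinv)
  also have "\<dots> = (\<Sum>(a, b)\<leftarrow>\<Delta> h. \<Sum>(c, d)\<leftarrow>\<Delta> k. \<epsilon> c \<star> (coinv K n a \<odot> proj K (b \<odot> d)))"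
  proof (rule cop_cong[OF subcoal_wedge[OF hopf_subD(2)[OF K]] h])
    fix a b assume a: "a \<in> U'"
    show "(\<Sum>(c, d)\<leftarrow>\<Delta> k. coinv K n (a \<odot> c) \<odot> proj K (b \<odot> d))
      = (\<Sum>(c, d)\<leftarrow>\<Delta> k. \<epsilon> c \<star> (coinv K n a \<odot> proj K (b \<odot> d)))"
      by (rule cop_cong[OF hopf_subD(2)[OF K] k])
        (intro intros lin_coinv, intro intros lin_coinv, simp add: coinv_mul[OF a] mul_scale)
  qed (intro intros lin_coinv)+
  also have "\<dots> = (\<Sum>(a, b)\<leftarrow>\<Delta> h. coinv K n a \<odot> proj K (b \<odot> k))"
    by (intro sum_list_pairs_cong contract_counit(1)) (intro intros)
  also have "\<dots> = (\<Sum>(a, b)\<leftarrow>\<Delta> h. coinv K n a \<odot> proj K (proj K b \<odot> k))"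
    by (rule cop_replace[OF hopf_subD(3)[OF K] h]) (intro intros lin_coinv, simp add: coinv_base)
  also have "\<dots> = hopf_lift K n h \<odot> k"
    by (simp add: hopf_lift_def mul_pairs mul_assoc r_id r_in KD k)
  finally show ?thesis .
qed

lemma hopf_lift_id:
  assumes h: "h \<in> wedge K (Suc n)"
  shows "hopf_lift K n h - h \<in> wedge K n"
proof -
  have "hopf_lift K n h = (\<Sum>(e, b)\<leftarrow>\<Delta> h. \<Sum>(a, c)\<leftarrow>\<Delta> e. rem (a \<odot> S (proj K c)) \<odot> proj K b)"
    by (simp add: hopf_lift_def coinv_eq mul_pairs)
  also have "\<dots> = (\<Sum>(a, e)\<leftarrow>\<Delta> h. \<Sum>(c, b)\<leftarrow>\<Delta> e. rem (a \<odot> S (proj K c)) \<odot> proj K b)"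
    by (rule cop_coassoc) (intro intros)
  also have "\<dots> = (\<Sum>(a, e)\<leftarrow>\<Delta> h. \<Sum>(c, b)\<leftarrow>\<Delta> (proj K e). rem (a \<odot> S (proj K c)) \<odot> proj K b)"
    by (rule cop_replace[OF hopf_subD(3)[OF K] h])
      (intro intros, simp add: rem0 U_mul KD r_in split_def)
  finally have lift: "hopf_lift K n h =
    (\<Sum>(a, e)\<leftarrow>\<Delta> h. \<Sum>(c, b)\<leftarrow>\<Delta> (proj K e). rem (a \<odot> S (proj K c)) \<odot> proj K b)" .
  have "(\<Sum>(c, b)\<leftarrow>\<Delta> k. rem (a \<odot> S (proj K c)) \<odot> proj K b) - \<epsilon> k \<star> a \<in> U" if k: "k \<in> K" for a k
  proof -
    have "(\<Sum>(c, b)\<leftarrow>\<Delta> k. rem (a \<odot> S (proj K c)) \<odot> proj K b)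
      = (\<Sum>(c, b)\<leftarrow>\<Delta> k. a \<odot> (S c \<odot> b) - proj U (a \<odot> S c) \<odot> b)"
      by (rule cop_cong[OF hopf_subD(2)[OF K] k])
        (intro intros, intro intros lin_comp[OF lin_proj[OF subspace_wedge]],
          simp add: r_id rem_def mul_diff mul_assoc)
    also have "\<dots> = (\<Sum>(c, b)\<leftarrow>\<Delta> k. a \<odot> (S c \<odot> b)) - (\<Sum>(c, b)\<leftarrow>\<Delta> k. proj U (a \<odot> S c) \<odot> b)"
      by (simp add: split_def sum_list_subtractf)
    also have "(\<Sum>(c, b)\<leftarrow>\<Delta> k. a \<odot> (S c \<odot> b)) = \<epsilon> k \<star> (a \<odot> \<one>)"
      by (rule contract_antipode(1)) (intro intros)
    finally have "(\<Sum>(c, b)\<leftarrow>\<Delta> k. rem (a \<odot> S (proj K c)) \<odot> proj K b) - \<epsilon> k \<star> a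
      = - (\<Sum>(c, b)\<leftarrow>\<Delta> k. proj U (a \<odot> S c) \<odot> b)" by (simp add: mul_one)
    also have "\<dots> \<in> U"
      by (intro subspace_neg[OF subspace_wedge] cop_mem[OF hopf_subD(2)[OF K] k _ subspace_wedge]
          intros lin_comp[OF lin_proj[OF subspace_wedge]] U_mul proj_in[OF subspace_wedge])
    finally show ?thesis .
  qed
  then have "(\<Sum>(a, e)\<leftarrow>\<Delta> h. (\<Sum>(c, b)\<leftarrow>\<Delta> (proj K e). rem (a \<odot> S (proj K c)) \<odot> proj K b)
    - \<epsilon> (proj K e) \<star> a) \<in> U"
    by (intro subspace_pairs[OF subspace_wedge]) (simp add: r_in)
  then have 1: "hopf_lift K n h - lhit (\<lambda>z. \<epsilon> (proj K z)) h \<in> U"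
    by (simp add: lift lhit_def split_def sum_list_subtractf)
  \<comment> \<open>Contraction with \<epsilon> is the identity, and replacing \<epsilon> by its
    composition with \<open>proj K\<close> changes it by a form vanishing on \<open>K\<close>; so
    \<open>h\<close> changes only by an element of \<open>wedge K n\<close>.\<close>
  have "annih K (\<lambda>z. \<epsilon> (proj K z) - \<epsilon> z)"
    by (simp add: annih_def r_id lform_closed lform_eps lin_r lin_ident eps_lform)
  then have 2: "lhit (\<lambda>z. \<epsilon> (proj K z)) h - h \<in> U"
    using h by (simp add: lhit_diff[of "\<lambda>z. \<epsilon> (proj K z)" \<epsilon>, unfolded lhit_eps, symmetric])
  show ?thesis using subspace_add[OF subspace_wedge 1 2] by simp
qed

end

section \<open>Products of subspaces and the wedge filtration\<close>

definition prod_span :: "'h set \<Rightarrow> 'h set \<Rightarrow> 'h set" where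
  "prod_span X T = span {x \<odot> t | x t. x \<in> X \<and> t \<in> T}"

lemma prod_span_mono: "X \<subseteq> X' \<Longrightarrow> T \<subseteq> T' \<Longrightarrow> prod_span X T \<subseteq> prod_span X' T'"
  unfolding prod_span_def by (rule span_mono) auto

text \<open>The \<open>K\<close>-linear retraction \<open>?\<rho>\<close> fixes \<open>y\<close> and
  carries a product \<open>x \<odot> t\<close> to a product whose first factor lies in
  \<open>wedge K n\<close>.\<close>

lemma prod_span_wedge_step:
  assumes K: "hopf_sub K" and T: "T \<subseteq> K" and y: "y \<in> wedge K n" "y \<in> prod_span (wedge K (Suc n)) T"
  shows "y \<in> prod_span (wedge K n) T"
proof -
  let ?\<rho> = "\<lambda>h. h - hopf_lift K n h"
  have \<rho>: "lin ?\<rho>" using lin_minus[OF lin_ident lin_hopf_lift[OF K]] .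
  have "{x \<odot> t | x t. x \<in> wedge K (Suc n) \<and> t \<in> T} \<subseteq> {z. ?\<rho> z \<in> prod_span (wedge K n) T}"
  proof (clarsimp)
    fix x t assume x: "\<forall>\<phi>. annih K \<phi> \<longrightarrow> lhit \<phi> x \<in> wedge K n" and t: "t \<in> T"
    have x': "x \<in> wedge K (Suc n)" using x by simp
    have "- (hopf_lift K n x - x) \<in> wedge K n"
      using subspace_neg[OF subspace_wedge[OF K] hopf_lift_id[OF K x']] .
    moreover have "x \<odot> t - hopf_lift K n (x \<odot> t) = (x - hopf_lift K n x) \<odot> t"
      using T t by (simp add: hopf_lift_mul[OF K x'] subsetD mul_diff)
    ultimately show "x \<odot> t - hopf_lift K n (x \<odot> t) \<in> prod_span (wedge K n) T"
      unfolding prod_span_def using t by (auto intro!: span_base)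
  qed
  then have "?\<rho> y \<in> prod_span (wedge K n) T"
    using span_minimal[OF _ subspace_lin_vimage[OF \<rho>]] y(2) unfolding prod_span_def by blast
  then show ?thesis using hopf_lift_base[OF K y(1)] by simp
qed

text \<open>A sum of products involves finitely many left factors, hence a single wedge power, from
  which one descends step by step. For \<open>n = 0\<close> the left ideal generated by
  \<open>T\<close> is intersected with \<open>K\<close>.\<close>

lemma prod_span_wedge:
  assumes K: "hopf_sub K" "corad \<subseteq> K" and T: "T \<subseteq> K" and y: "y \<in> wedge K n" "y \<in> prod_span UNIV T"
  shows "y \<in> prod_span (wedge K n) T"
proof -
  note mono = wedge_mono[OF hopf_subD(2)[OF K(1)]]
  have "\<exists>m. y \<in> prod_span (wedge K (n + m)) T"
    using y(2) unfolding prod_span_def[of UNIV]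
  proof (induction rule: span_induct_alt)
    case base
    show ?case by (simp add: prod_span_def span_zero)
  next
    case (step c z w)
    then obtain x t m where z: "z = x \<odot> t" "t \<in> T" and m: "w \<in> prod_span (wedge K (n + m)) T" by blast
    obtain l where l: "x \<in> wedge K l" using wedge_exhausts[OF hopf_subD(2)[OF K(1)] K(2)] by blast
    let ?N = "n + (m + l)"
    have "x \<in> wedge K ?N" using l mono[of l ?N] by auto
    then have "z \<in> prod_span (wedge K ?N) T" using z unfolding prod_span_def by (auto intro!: span_base)
    moreover have "w \<in> prod_span (wedge K ?N) T"
      using m prod_span_mono[OF mono order_refl, of "n + m" ?N T] by auto
    ultimately show ?case unfolding prod_span_def by (blast intro: span_add span_scale)
  qed
  then obtain m where "y \<in> prod_span (wedge K (n + m)) T" ..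
  then show ?thesis
  proof (induction m)
    case (Suc m)
    have "y \<in> wedge K (n + m)" using y(1) mono[of n "n + m"] by auto
    then show ?case using prod_span_wedge_step[OF K(1) T] Suc by simp
  qed simp
qed

lemma eps_diff: "\<epsilon> (x - \<epsilon> x \<star> \<one>) = 0"
  by (simp add: lform_diff[OF eps_lform] lform_scale[OF eps_lform] eps_one)

text \<open>The coinvariants of \<open>wedge K (Suc 0)\<close> modulo \<open>K\<close> vanish: after
  subtracting a scalar an element has counit 0, hence is a sum of products whose right factors lie
  in \<open>K\<close> and have counit 0, and \<open>coinv\<close> kills these. So
  \<open>wedge K (Suc 0)\<close> is \<open>K\<close>, and the filtration never grows.\<close>

lemma hopf_sub_eq_UNIV:
  assumes K: "hopf_sub K" "corad \<subseteq> K"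
    and gen: "{x. \<epsilon> x = 0} \<subseteq> prod_span UNIV {k \<in> K. \<epsilon> k = 0}"
  shows "K = UNIV"
proof -
  let ?Q = "coinv K 0"
  have Q: "lin ?Q" using lin_coinv[OF K(1) lin_ident] .
  have Q0: "?Q h = 0" if h: "h \<in> wedge K (Suc 0)" for h
  proof -
    let ?h = "h - \<epsilon> h \<star> \<one>"
    have one: "\<one> \<in> wedge K m" for m
      using wedge_base[OF hopf_subD(2)[OF K(1)]] hopf_subD(4)[OF K(1)] by blast
    have "?h \<in> wedge K (Suc 0)"
      by (rule subspace_diff[OF subspace_wedge[OF K(1)] h subspace_scale[OF subspace_wedge[OF K(1)] one]])
    then have "?h \<in> prod_span (wedge K (Suc 0)) {k \<in> K. \<epsilon> k = 0}"
      using gen eps_diff by (intro prod_span_wedge[OF K]) auto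
    moreover have "{x \<odot> k | x k. x \<in> wedge K (Suc 0) \<and> k \<in> {k \<in> K. \<epsilon> k = 0}} \<subseteq> {z. ?Q z = 0}"
      using coinv_mul[OF K(1)] by fastforce
    ultimately have "?Q ?h = 0"
      unfolding prod_span_def using span_minimal[OF _ subspace_kernel[OF Q]] by blast
    moreover have "?Q \<one> = 0" using coinv_base[OF K(1) one] .
    ultimately show ?thesis by (simp add: lin_diff[OF Q] lin_scale[OF Q])
  qed
  have 1: "wedge K (Suc 0) \<subseteq> K"
  proof
    fix h assume h: "h \<in> wedge K (Suc 0)"
    have "hopf_lift K 0 h \<in> {0}" unfolding hopf_lift_def
      by (rule cop_mem[OF subcoal_wedge[OF hopf_subD(2)[OF K(1)]] h _ subspace_single_0],
          intro lin_intros lin_coinv[OF K(1)] lin_proj[OF hopf_subD(3)[OF K(1)]])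
        (simp only: Q0 mul_0 singleton_iff)
    then show "h \<in> K" using subspace_neg[OF hopf_subD(3)[OF K(1)]] hopf_lift_id[OF K(1) h] by fastforce
  qed
  have "wedge K n \<subseteq> K" for n
  proof (induction n)
    case (Suc n)
    then have "wedge K (Suc n) \<subseteq> wedge K (Suc 0)" by auto
    then show ?case using 1 by blast
  qed simp
  then show ?thesis using wedge_exhausts[OF hopf_subD(2)[OF K(1)] K(2)] by blast
qed

end

section \<open>Commutative and cocommutative Hopf subalgebras\<close>

context linear_space
begin

text \<open>The map x \<mapsto> \<open>x - proj P x\<close> kills \<open>P\<close> and is injective
  on \<open>A\<close>; composing it with a linear left inverse gives a total map although
  \<open>A + P\<close> may be a proper subspace.\<close>

lemma direct_sum_projection:
  assumes A: "subspace A" and P: "subspace P" and AP: "A \<inter> P \<subseteq> {0}"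
  obtains e where "lin e" "\<And>a. a \<in> A \<Longrightarrow> e a = a" "\<And>p. p \<in> P \<Longrightarrow> e p = 0"
proof -
  interpret vector_space_pair scale scale ..
  let ?q = "\<lambda>x. x - proj P x"
  have q: "lin ?q" using lin_minus[OF lin_ident lin_proj[OF P]] .
  have "inj_on ?q A"
  proof (rule inj_onI)
    fix x y assume xy: "x \<in> A" "y \<in> A" "?q x = ?q y"
    then have "x - y = proj P (x - y)" by (simp add: lin_diff[OF lin_proj[OF P]] algebra_simps)
    then have "x - y \<in> A \<inter> P" using xy subspace_diff[OF A] proj_in[OF P] by (metis IntI)
    then show "x = y" using AP by auto
  qed
  from linear_exists_left_inverse_on[OF q A this]
  obtain g where g: "lin g" "\<And>a. a \<in> A \<Longrightarrow> g (?q a) = a" by blast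
  show ?thesis
    by (rule that[of "\<lambda>x. g (?q x)"]) (use g lin_comp[OF g(1) q] in \<open>auto simp: proj_id[OF P] lin_0\<close>)
qed

end

context sweedler_hopf
begin

lemma prod_span_finite:
  assumes "finite X" "X \<subseteq> prod_span Z T"
  obtains Z' where "finite Z'" "Z' \<subseteq> Z" "X \<subseteq> prod_span Z' T"
proof -
  have "\<exists>Z'. finite Z' \<and> Z' \<subseteq> Z \<and> x \<in> prod_span Z' T" if "x \<in> X" for x
  proof -
    have "x \<in> span {z \<odot> t | z t. z \<in> Z \<and> t \<in> T}"
      using that assms(2) by (auto simp: prod_span_def)
    from span_finite_subset[OF this] obtain F
      where F: "finite F" "F \<subseteq> {z \<odot> t | z t. z \<in> Z \<and> t \<in> T}" "x \<in> span F"
      by (elim exE conjE)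
    then have "\<forall>y\<in>F. \<exists>z\<in>Z. \<exists>t\<in>T. y = z \<odot> t" by blast
    then obtain z where z: "\<And>y. y \<in> F \<Longrightarrow> z y \<in> Z \<and> (\<exists>t\<in>T. y = z y \<odot> t)" by metis
    have "F \<subseteq> {z' \<odot> t | z' t. z' \<in> z ` F \<and> t \<in> T}"
    proof
      fix y assume y: "y \<in> F"
      then obtain t where "t \<in> T" "y = z y \<odot> t" using z by blast
      then show "y \<in> {z' \<odot> t | z' t. z' \<in> z ` F \<and> t \<in> T}" using y by blast
    qed
    then have "x \<in> prod_span (z ` F) T" using F(3) span_mono unfolding prod_span_def by blast
    then show ?thesis using F(1) z by (intro exI[of _ "z ` F"]) auto
  qed
  then obtain Z' where Z': "\<And>x. x \<in> X \<Longrightarrow> finite (Z' x) \<and> Z' x \<subseteq> Z \<and> x \<in> prod_span (Z' x) T"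
    by metis
  show ?thesis
  proof (rule that[of "\<Union>(Z' ` X)"])
    show "X \<subseteq> prod_span (\<Union>(Z' ` X)) T"
      using Z' prod_span_mono[of _ "\<Union>(Z' ` X)" T T] by blast
  qed (use Z' assms(1) in auto)
qed

text \<open>An essential extension argument: for finitely many elements of \<open>B\<close> there is a common
  nonzero multiplier \<open>s \<in> A\<close> into \<open>A + P\<close>, where \<open>P\<close> is a maximal \<open>A\<close>-submodule with
  \<open>A \<inter> P = 0\<close>. Since \<open>A\<close>-linear maps between \<open>B\<close>-modules are \<open>B\<close>-linear, the projection to
  \<open>P\<close>, precomposed with \<open>s\<close>, vanishes; so \<open>s\<close> conducts a given subcoalgebra \<open>D\<close> into \<open>A\<close>. The
  conductor is stable under the coaction, hence contains \<open>\<one>\<close>.\<close>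

lemma commutative_hopf_sub_eq:
  assumes A: "hopf_sub A" and B: "hopf_sub B" and AB: "A \<subseteq> B"
    and comm: "\<And>x y. x \<in> B \<Longrightarrow> y \<in> B \<Longrightarrow> x \<odot> y = y \<odot> x"
    and gen: "{x \<in> B. \<epsilon> x = 0} \<subseteq> prod_span B {a \<in> A. \<epsilon> a = 0}"
  shows "A = B"
proof (rule antisym[OF AB subsetI])
  fix d0 assume d0: "d0 \<in> B"
  note AD = hopf_subD[OF A] and BD = hopf_subD[OF B]
  have lc: "a \<odot> (b \<odot> c) = b \<odot> (a \<odot> c)" if "a \<in> B" "b \<in> B" for a b c
    using comm[OF that] by (metis mul_assoc)
  define \<P> where "\<P> = {P. subspace P \<and> P \<subseteq> B \<and> (\<forall>a\<in>A. \<forall>p\<in>P. a \<odot> p \<in> P) \<and> A \<inter> P \<subseteq> {0}}"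
  have "\<exists>P\<in>\<P>. \<forall>X\<in>\<P>. P \<subseteq> X \<longrightarrow> X = P"
  proof (rule subset_Zorn_nonempty)
    have "{0} \<in> \<P>" using subspace_0[OF BD(3)] by (auto simp: \<P>_def)
    then show "\<P> \<noteq> {}" by blast
    fix \<C> assume ne: "\<C> \<noteq> {}" and ch: "subset.chain \<P> \<C>"
    have sub: "\<C> \<subseteq> \<P>" using ch by (auto simp: subset_chain_def)
    have "subspace (\<Union>\<C>)"
    proof (rule subspaceI)
      show "0 \<in> \<Union>\<C>" using ne sub by (auto simp: \<P>_def intro!: subspace_0)
      fix x y assume "x \<in> \<Union>\<C>" "y \<in> \<Union>\<C>"
      then obtain P Q where PQ: "P \<in> \<C>" "Q \<in> \<C>" "x \<in> P" "y \<in> Q" by blast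
      then have "P \<subseteq> Q \<or> Q \<subseteq> P" using ch by (auto simp: subset_chain_def)
      then obtain R where "R \<in> \<C>" "x \<in> R" "y \<in> R" using PQ by blast
      then show "x + y \<in> \<Union>\<C>" using sub by (auto simp: \<P>_def intro!: subspace_add)
    next
      fix c x assume "x \<in> \<Union>\<C>"
      then show "c \<star> x \<in> \<Union>\<C>" using sub by (auto simp: \<P>_def intro!: subspace_scale)
    qed
    then show "\<Union>\<C> \<in> \<P>" using sub unfolding \<P>_def by blast
  qed
  then obtain P where P\<P>: "P \<in> \<P>" and Pmax: "\<And>X. X \<in> \<P> \<Longrightarrow> P \<subseteq> X \<Longrightarrow> X = P" by blast
  then have P: "subspace P" "P \<subseteq> B" "\<And>a p. a \<in> A \<Longrightarrow> p \<in> P \<Longrightarrow> a \<odot> p \<in> P" "A \<inter> P \<subseteq> {0}"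
    by (auto simp: \<P>_def)
  define E where "E = {a + p | a p. a \<in> A \<and> p \<in> P}"
  have subE: "subspace E" unfolding E_def by (rule subspace_sums[OF AD(3) P(1)])
  have AE: "c \<odot> y \<in> E" if "c \<in> A" "y \<in> E" for c y
    using that AD(6) P(3) by (fastforce simp: E_def mul_add)
  have sub_E: "A \<subseteq> E" "P \<subseteq> E"
    using subspace_0[OF AD(3)] subspace_0[OF P(1)] by (force simp: E_def)+
  \<comment> \<open>If \<open>A y\<close> met \<open>E\<close> only in 0, then P + A y would be an
    admissible submodule, hence equal to \<open>P\<close> by maximality, and \<open>y\<close> would
    lie in \<open>E\<close>.\<close>
  have ess: "\<exists>t\<in>A. t \<odot> y \<noteq> 0 \<and> t \<odot> y \<in> E" if y: "y \<in> B" "y \<noteq> 0" for y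
  proof (rule ccontr)
    assume "\<not> ?thesis"
    then have no: "t \<odot> y = 0" if "t \<in> A" "t \<odot> y \<in> E" for t using that by blast
    let ?P = "{p + q | p q. p \<in> P \<and> q \<in> (\<lambda>t. t \<odot> y) ` A}"
    have "?P \<in> \<P>"
    proof -
      have 1: "subspace ?P" by (rule subspace_sums[OF P(1) subspace_lin_image[OF mul_lin(1) AD(3)]])
      have 2: "?P \<subseteq> B" using P(2) AB y(1) BD(6) by (auto intro!: subspace_add[OF BD(3)])
      have 3: "a \<odot> p \<in> ?P" if a: "a \<in> A" and p: "p \<in> ?P" for a p
      proof -
        obtain q t where "q \<in> P" "t \<in> A" "p = q + t \<odot> y" using p by blast
        then have "a \<odot> p = a \<odot> q + (a \<odot> t) \<odot> y" "a \<odot> q \<in> P" "a \<odot> t \<in> A"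
          using a P(3) AD(6) by (auto simp: mul_add mul_assoc)
        then show ?thesis by blast
      qed
      have 4: "A \<inter> ?P \<subseteq> {0}"
      proof
        fix x assume "x \<in> A \<inter> ?P"
        then obtain p t where *: "x = p + t \<odot> y" "x \<in> A" "p \<in> P" "t \<in> A" by blast
        have "x - p \<in> E" by (rule subspace_diff[OF subE]) (use * sub_E in auto)
        then have "t \<odot> y = 0" using no[OF *(4)] *(1) by simp
        then show "x \<in> {0}" using * P(4) by auto
      qed
      have "P' \<in> \<P>" if "subspace P'" "P' \<subseteq> B" "\<And>a p. a \<in> A \<Longrightarrow> p \<in> P' \<Longrightarrow> a \<odot> p \<in> P'" "A \<inter> P' \<subseteq> {0}" for P'
        using that by (simp add: \<P>_def)
      from this[OF 1 2 3 4] show ?thesis .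
    qed
    moreover have "P \<subseteq> ?P"
    proof
      fix p assume "p \<in> P"
      then show "p \<in> ?P" using subspace_0[OF AD(3)] by (intro CollectI exI[of _ p] exI[of _ 0]) force
    qed
    ultimately have "?P = P" by (rule Pmax)
    moreover have "y \<in> ?P" using subspace_0[OF P(1)] AD(4) one_mul[of y]
      by (intro CollectI exI[of _ 0] exI[of _ y]) (auto intro!: image_eqI[of _ _ \<one>])
    ultimately have "\<one> \<odot> y \<in> E" using sub_E by (auto simp: one_mul)
    then show False using no[OF AD(4)] y(2) by (simp add: one_mul)
  qed
  have fin: "\<exists>s\<in>A. s \<noteq> 0 \<and> (\<forall>y\<in>Y. s \<odot> y \<in> E)" if "finite Y" "Y \<subseteq> B" for Y
    using that
  proof (induction Y rule: finite_induct)
    case empty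
    have "\<one> \<noteq> 0" using eps_one lform_0[OF eps_lform] by auto
    then show ?case using AD(4) by auto
  next
    case (insert y Y)
    then obtain s where s: "s \<in> A" "s \<noteq> 0" "\<And>y. y \<in> Y \<Longrightarrow> s \<odot> y \<in> E" by auto
    show ?case
    proof (cases "s \<odot> y = 0")
      case True
      then show ?thesis using s subspace_0[OF subE] by auto
    next
      case False
      then obtain t where t: "t \<in> A" "t \<odot> (s \<odot> y) \<noteq> 0" "t \<odot> (s \<odot> y) \<in> E"
        using ess[of "s \<odot> y"] insert.prems s(1) AB BD(6) by auto
      have "t \<odot> s \<noteq> 0" using t(2) by (auto simp: mul_assoc[symmetric])
      then show ?thesis using t s AE AD(6) by (intro bexI[of _ "t \<odot> s"]) (auto simp: mul_assoc)
    qed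
  qed
  obtain D where D: "subcoal D" "findim D" "d0 \<in> D" "D \<subseteq> B" using finite_subcoal[of d0] d0 BD(2) by metis
  note subD = subcoalD(1)[OF D(1)]
  from findim_basis[OF subD D(2)] obtain F where F: "finite F" "F \<subseteq> D" "D = span F" by metis
  let ?Ap = "{a \<in> A. \<epsilon> a = 0}"
  have "(\<lambda>d. d - \<epsilon> d \<star> \<one>) ` F \<subseteq> prod_span B ?Ap"
    using gen F(2) D(4) BD(3,4) eps_diff by (blast intro: subspace_diff subspace_scale)
  then obtain Z where Z: "finite Z" "Z \<subseteq> B" "(\<lambda>d. d - \<epsilon> d \<star> \<one>) ` F \<subseteq> prod_span Z ?Ap"
    using prod_span_finite[of "(\<lambda>d. d - \<epsilon> d \<star> \<one>) ` F" B ?Ap] F(1) by blast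
  have DZ: "d - \<epsilon> d \<star> \<one> \<in> prod_span Z ?Ap" if "d \<in> D" for d
  proof -
    have *: "F \<subseteq> {d. d - \<epsilon> d \<star> \<one> \<in> prod_span Z ?Ap}" using Z(3) by blast
    have "subspace {d. d - \<epsilon> d \<star> \<one> \<in> prod_span Z ?Ap}"
      unfolding prod_span_def
      by (rule subspace_lin_vimage[OF lin_minus[OF lin_ident lin_coeff[OF eps_lform]] subspace_span])
    from span_minimal[OF * this] show ?thesis using F(3) that by auto
  qed
  let ?p = "proj B"
  have p: "lin f \<Longrightarrow> lin (\<lambda>x. ?p (f x))" for f using lin_comp[OF lin_proj[OF BD(3)]] .
  note p_in = proj_in[OF BD(3)]
  \<comment> \<open>The multiplier \<open>s\<close> has to work for \<open>D\<close> and for all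
    S(z2) d to which \<open>A\<close>-linearity of \<open>g\<close> is applied below. The finitely
    many left factors \<open>Z\<close> keep this set finite.\<close>
  define Y where "Y = F \<union> (\<lambda>(z, d). S (?p z) \<odot> d) ` ((\<Union>z\<in>Z. snd ` set (\<Delta> z)) \<times> F)"
  have finY: "finite Y" unfolding Y_def using F(1) Z(1) by (intro finite_UnI finite_imageI finite_cartesian_product finite_UN_I) auto
  have FB: "F \<subseteq> B" using F(2) D(4) by (rule subset_trans)
  then have "S (?p z) \<odot> d \<in> B" if "d \<in> F" for z d using that BD(6)[OF BD(5)[OF p_in]] by (meson subsetD)
  with FB have "Y \<subseteq> B" unfolding Y_def by fast
  from fin[OF finY this] obtain s where s: "s \<in> A" "s \<noteq> 0" "\<And>y. y \<in> Y \<Longrightarrow> s \<odot> y \<in> E" by blast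
  have sB: "s \<in> B" using s(1) AB by blast
  obtain e where e: "lin e" "\<And>a. a \<in> A \<Longrightarrow> e a = a" "\<And>p. p \<in> P \<Longrightarrow> e p = 0"
    by (rule direct_sum_projection[OF AD(3) P(1,4)]) (rule that)
  \<comment> \<open>For \<open>s \<odot> y \<in> E\<close> this is the \<open>P\<close>-component of
    \<open>s \<odot> y\<close>.\<close>
  define g where "g y = s \<odot> y - e (s \<odot> y)" for y
  have g: "lin (\<lambda>x. g (f x))" if "lin f" for f
    unfolding g_def by (intro lin_intros lin_comp[OF e(1)] that)
  have g1: "g \<one> = 0" using e(2)[OF s(1)] by (simp add: g_def mul_one)
  have sDE: "s \<odot> d \<in> E" if "d \<in> D" for d
    using span_minimal[OF _ subspace_lin_vimage[OF mul_lin(2) subE], of F s] s(3) F(3) that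
    by (auto simp: Y_def)
  have zE: "s \<odot> (S (?p z2) \<odot> d) \<in> E" if "z \<in> Z" "(z1, z2) \<in> set (\<Delta> z)" "d \<in> D" for z z1 z2 d
  proof -
    have *: "F \<subseteq> {d. s \<odot> (S (?p z2) \<odot> d) \<in> E}"
    proof
      fix x assume "x \<in> F"
      moreover have "z2 \<in> (\<Union>z\<in>Z. snd ` set (\<Delta> z))"
        using that(1,2) by (intro UN_I[of z] image_eqI[of _ snd "(z1, z2)"]) auto
      ultimately have "S (?p z2) \<odot> x \<in> Y"
        unfolding Y_def by (intro UnI2 image_eqI[of _ _ "(z2, x)"]) auto
      then show "x \<in> {d. s \<odot> (S (?p z2) \<odot> d) \<in> E}" using s(3) by simp
    qed
    have "subspace {d. s \<odot> (S (?p z2) \<odot> d) \<in> E}"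
      by (rule subspace_lin_vimage[OF _ subE]) (intro lin_intros)
    from span_minimal[OF * this] show ?thesis using F(3) that(3) by auto
  qed
  have gA: "g (c \<odot> y) = c \<odot> g y" if c: "c \<in> A" and y: "s \<odot> y \<in> E" for c y
  proof -
    obtain a q where aq: "s \<odot> y = a + q" "a \<in> A" "q \<in> P" using y by (auto simp: E_def)
    have "s \<odot> (c \<odot> y) = c \<odot> a + c \<odot> q" using lc[OF sB, of c y] c AB aq(1) by (auto simp: mul_add)
    moreover have "c \<odot> a \<in> A" "c \<odot> q \<in> P" using c aq AD(6) P(3) by auto
    ultimately show ?thesis using aq e by (simp add: g_def lin_add[OF e(1)])
  qed
  \<comment> \<open>An averaged form of \<open>B\<close>-linearity of \<open>g\<close>. On
    \<open>z \<odot> a\<close> with \<open>a\<close> in \<open>?Ap\<close>,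
    \<open>A\<close>-linearity takes \<open>S v\<close> out of \<open>g\<close> to meet
    \<open>u\<close>, and the sum collapses to 0; elements of \<open>D\<close> differ from scalars
    by sums of such products.\<close>
  have key: "(\<Sum>(x, y)\<leftarrow>\<Delta> d'. x \<odot> g (S y \<odot> d)) = \<epsilon> d' \<star> g d" if d: "d \<in> D" "d' \<in> D" for d d'
  proof -
    let ?L = "\<lambda>d'. \<Sum>(x, y)\<leftarrow>\<Delta> d'. x \<odot> g (S y \<odot> d)"
    have L: "lin ?L" by (intro lin_intros g)
    have "?L (z \<odot> a) = 0" if z: "z \<in> Z" and a: "a \<in> ?Ap" for z a
    proof -
      have "?L (z \<odot> a) = (\<Sum>(z1, z2)\<leftarrow>\<Delta> z. \<Sum>(u, v)\<leftarrow>\<Delta> a. (z1 \<odot> u) \<odot> g (S (z2 \<odot> v) \<odot> d))"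
        by (rule cop_mul) (intro lin_intros g)
      also have "\<dots> = (\<Sum>(z1, z2)\<leftarrow>\<Delta> z. \<Sum>(u, v)\<leftarrow>\<Delta> a. (?p z1 \<odot> u) \<odot> g (S (?p z2 \<odot> v) \<odot> d))"
        by (rule cop_restrict[OF BD(2)]) (use z Z(2) in blast, intro lin_intros g)
      also have "\<dots> = (\<Sum>(z1, z2)\<leftarrow>\<Delta> z. 0)"
      proof (rule sum_list_pairs_cong)
        fix z1 z2 assume z12: "(z1, z2) \<in> set (\<Delta> z)"
        have "(\<Sum>(u, v)\<leftarrow>\<Delta> a. (?p z1 \<odot> u) \<odot> g (S (?p z2 \<odot> v) \<odot> d))
          = (\<Sum>(u, v)\<leftarrow>\<Delta> a. ?p z1 \<odot> (u \<odot> S v) \<odot> g (S (?p z2) \<odot> d))"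
          by (rule cop_cong[OF AD(2)], use a in blast, intro lin_intros g, intro lin_intros)
            (simp add: S_mul mul_assoc gA AD(5) zE[OF z z12 d(1)])
        also have "\<dots> = \<epsilon> a \<star> (?p z1 \<odot> \<one> \<odot> g (S (?p z2) \<odot> d))"
          by (rule contract_antipode(2)) (intro lin_intros)
        finally show "(\<Sum>(u, v)\<leftarrow>\<Delta> a. (?p z1 \<odot> u) \<odot> g (S (?p z2 \<odot> v) \<odot> d)) = 0" using a by simp
      qed
      finally show ?thesis by (simp add: split_def)
    qed
    then have "prod_span Z ?Ap \<subseteq> {x. ?L x = 0}"
      unfolding prod_span_def by (intro span_minimal subspace_kernel[OF L]) auto
    then have "?L (d' - \<epsilon> d' \<star> \<one>) = 0" using DZ[OF d(2)] by blast
    moreover have "?L \<one> = \<one> \<odot> g (S \<one> \<odot> d)" by (rule cop_one) (intro lin_intros g)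
    ultimately show ?thesis by (simp add: lin_diff[OF L] lin_scale[OF L] S_one one_mul)
  qed
  \<comment> \<open>The expression d1 g(S(d2) d3), bracketed in two ways, gives \<open>g d\<close>
    by \<open>key\<close> and a multiple of \<open>g \<one>\<close> by the antipode
    identity.\<close>
  have gd: "g d = 0" if d: "d \<in> D" for d
  proof -
    have "g d = (\<Sum>(e, c)\<leftarrow>\<Delta> d. \<epsilon> e \<star> g c)"
      by (rule contract_counit(1)[symmetric]) (intro g lin_ident)
    also have "\<dots> = (\<Sum>(e, c)\<leftarrow>\<Delta> d. \<Sum>(x, y)\<leftarrow>\<Delta> e. x \<odot> g (S y \<odot> c))"
      by (rule cop_cong[OF D(1) d]) (intro lin_intros g, intro lin_intros g, simp add: key)
    also have "\<dots> = (\<Sum>(x, r)\<leftarrow>\<Delta> d. \<Sum>(y, c)\<leftarrow>\<Delta> r. x \<odot> g (S y \<odot> c))"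
      by (rule cop_coassoc) (intro lin_intros g)
    also have "\<dots> = (\<Sum>(x, r)\<leftarrow>\<Delta> d. \<epsilon> r \<star> (x \<odot> g \<one>))"
      by (intro sum_list_pairs_cong contract_antipode(1)) (intro lin_intros g)
    finally show ?thesis by (simp add: g1 split_def)
  qed
  have sD: "s \<odot> d \<in> A" if d: "d \<in> D" for d
  proof -
    obtain a q where aq: "s \<odot> d = a + q" "a \<in> A" "q \<in> P" using sDE[OF d] by (auto simp: E_def)
    then have "q = 0" using gd[OF d] e by (simp add: g_def lin_add[OF e(1)])
    then show ?thesis using aq by simp
  qed
  define I where "I = {t \<in> A. \<forall>d\<in>D. t \<odot> d \<in> A}"
  have subI: "subspace I"
    unfolding I_def using AD(3)
    by (intro subspaceI) (auto simp: mul_add mul_scale subspace_0 subspace_add subspace_scale)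
  have IA: "t \<odot> c \<in> I" if "t \<in> I" "c \<in> A" for t c
  proof -
    have "(t \<odot> c) \<odot> d = (t \<odot> d) \<odot> c" if "d \<in> D" for d
      using comm[of c d] \<open>c \<in> A\<close> AB D(4) that by (metis mul_assoc subsetD)
    then show ?thesis using that AD(6) by (auto simp: I_def)
  qed
  \<comment> \<open>Inserting d2 S(d3) inside \<phi> rewrites the product as contractions of
    elements \<open>t \<odot> e\<close> with \<open>e \<in> D\<close>, which lie in the subcoalgebra
    \<open>A\<close>.\<close>
  have hitI: "lhit \<phi> t \<in> I" if \<phi>: "lform \<phi>" and t: "t \<in> I" for \<phi> t
  proof -
    have l: "lform (\<lambda>x. \<phi> (f x))" if "lin f" for f using lform_comp[OF \<phi> that] .
    have "lhit \<phi> t \<odot> d \<in> A" if d: "d \<in> D" for d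
    proof -
      have "lhit \<phi> t \<odot> d = (\<Sum>(t1, t2)\<leftarrow>\<Delta> t. \<phi> t2 \<star> (t1 \<odot> d))"
        by (simp add: lhit_def mul_pairs mul_scale)
      also have "\<dots> = (\<Sum>(t1, t2)\<leftarrow>\<Delta> t. \<Sum>(u, r)\<leftarrow>\<Delta> d. \<epsilon> r \<star> \<phi> (t2 \<odot> \<one>) \<star> (t1 \<odot> u))"
        unfolding mul_one by (intro sum_list_pairs_cong contract_counit(2)[symmetric]) (intro lin_intros)
      also have "\<dots> = (\<Sum>(t1, t2)\<leftarrow>\<Delta> t. \<Sum>(u, r)\<leftarrow>\<Delta> d. \<Sum>(v, c)\<leftarrow>\<Delta> r. \<phi> (t2 \<odot> (v \<odot> S c)) \<star> (t1 \<odot> u))"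
        by (intro sum_list_pairs_cong contract_antipode(2)[symmetric]) (intro lin_intros l)
      also have "\<dots> = (\<Sum>(t1, t2)\<leftarrow>\<Delta> t. \<Sum>(e, c)\<leftarrow>\<Delta> d. \<Sum>(u, v)\<leftarrow>\<Delta> e. \<phi> (t2 \<odot> (v \<odot> S c)) \<star> (t1 \<odot> u))"
        by (intro sum_list_pairs_cong cop_coassoc[symmetric]) (intro lin_intros l)
      also have "\<dots> = (\<Sum>(e, c)\<leftarrow>\<Delta> d. \<Sum>(t1, t2)\<leftarrow>\<Delta> t. \<Sum>(u, v)\<leftarrow>\<Delta> e. \<phi> (t2 \<odot> (v \<odot> S c)) \<star> (t1 \<odot> u))"
        by (rule sum_list_pairs_swap)
      also have "\<dots> = (\<Sum>(e, c)\<leftarrow>\<Delta> d. \<Sum>(t1, t2)\<leftarrow>\<Delta> t. \<Sum>(u, v)\<leftarrow>\<Delta> e. \<phi> ((t2 \<odot> v) \<odot> S c) \<star> (t1 \<odot> u))"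
        by (simp add: mul_assoc)
      also have "\<dots> = (\<Sum>(e, c)\<leftarrow>\<Delta> d. lhit (\<lambda>y. \<phi> (y \<odot> S c)) (t \<odot> e))"
        unfolding lhit_def by (intro sum_list_pairs_cong cop_mul[symmetric]) (intro lin_intros l)
      also have "\<dots> \<in> A"
      proof (rule cop_mem[OF D(1) d _ AD(3)])
        show "bilin (\<lambda>e c. lhit (\<lambda>y. \<phi> (y \<odot> S c)) (t \<odot> e))"
          unfolding lhit_def by (intro lin_intros l)
        show "lhit (\<lambda>y. \<phi> (y \<odot> S c)) (t \<odot> e) \<in> A" if "e \<in> D" for e c
          by (rule subcoalD(2)[OF AD(2)]) (intro l lin_intros, use t that in \<open>simp add: I_def\<close>)
      qed
      finally show ?thesis .
    qed
    moreover have "lhit \<phi> t \<in> A" using t subcoalD(2)[OF AD(2) \<phi>] by (simp add: I_def)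
    ultimately show ?thesis by (simp add: I_def)
  qed
  \<comment> \<open>A form with value 1 at \<open>s\<close> contracts \<open>s\<close> to an element
    of \<open>I\<close> of counit 1. The antipode identity for that element then writes \<one> as a
    sum of products from \<open>I\<close> and \<open>A\<close>.\<close>
  obtain \<phi> where \<phi>: "lform \<phi>" "\<phi> s = 1" using lform_separate[OF subspace_single_0, of s] s(2) by blast
  have "s \<in> I" using s(1) sD by (simp add: I_def)
  then have s': "lhit \<phi> s \<in> I" "\<epsilon> (lhit \<phi> s) = 1" using hitI \<phi> by (auto simp: eps_lhit)
  then have s'A: "lhit \<phi> s \<in> A" by (simp add: I_def)
  have pA: "lin (\<lambda>x. proj A (f x))" if "lin f" for f using lin_comp[OF lin_proj[OF AD(3)] that] .
  have "\<one> = (\<Sum>(x, y)\<leftarrow>\<Delta> (lhit \<phi> s). x \<odot> S y)" by (simp add: antipode_right s'(2))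
  also have "\<dots> = (\<Sum>(x, y)\<leftarrow>\<Delta> (lhit \<phi> s). x \<odot> S (proj A y))"
    by (rule cop_cong[OF AD(2) s'A]) (intro lin_intros, intro lin_intros pA, simp add: proj_id[OF AD(3)])
  also have "\<dots> \<in> I"
  proof (rule cop_expand[OF subspace_single_0 _ _ subI])
    show "bilin (\<lambda>x y. x \<odot> S (proj A y))" by (intro lin_intros pA)
    show "x \<odot> S (proj A w) = 0" if "w \<in> {0}" for x w
      using that by (simp add: lin_0[OF lin_proj[OF AD(3)]] lin_0[OF S_lin])
    show "lhit \<psi> (lhit \<phi> s) \<odot> S (proj A c) \<in> I" if "annih {0} \<psi>" for \<psi> c
      using that by (intro IA hitI s' AD(5) proj_in[OF AD(3)]) (simp add: annih_def)
  qed
  finally have "\<one> \<in> I" .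
  then show "d0 \<in> A" using D(3) by (auto simp: I_def one_mul)
qed

definition cocommutative :: "'h set \<Rightarrow> bool" where
  "cocommutative C \<longleftrightarrow>
    (\<forall>x\<in>C. \<forall>G. bilin G \<longrightarrow> (\<Sum>(a, b)\<leftarrow>\<Delta> x. G a b) = (\<Sum>(a, b)\<leftarrow>\<Delta> x. G b a))"

lemma cocommutativeD:
  "cocommutative C \<Longrightarrow> x \<in> C \<Longrightarrow> bilin G \<Longrightarrow> (\<Sum>(a, b)\<leftarrow>\<Delta> x. G a b) = (\<Sum>(a, b)\<leftarrow>\<Delta> x. G b a)"
  by (simp add: cocommutative_def)

text \<open>\<open>B\<close> is the direct sum of the part \<open>X\<close> on which functionals vanishing on \<open>A\<close> act
  nilpotently and a complementary subcoalgebra \<open>Y\<close> (Fitting). The functional \<open>\<chi>\<close> that is \<open>\<epsilon>\<close> on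
  \<open>X\<close> and vanishes on \<open>Y\<close> is \<open>A\<close>-linear, which forces \<open>Y = 0\<close>.\<close>

lemma cocommutative_simple_subset:
  assumes A: "hopf_sub A" and B: "hopf_sub B" and AB: "A \<subseteq> B"
    and coc: "cocommutative B"
    and gen: "{x \<in> B. \<epsilon> x = 0} \<subseteq> prod_span B {a \<in> A. \<epsilon> a = 0}"
    and C: "simple_subcoal C" "C \<subseteq> B"
  shows "C \<subseteq> A"
proof -
  note AD = hopf_subD[OF A] and BD = hopf_subD[OF B]
  have hits_eq: "rhit \<phi> x = lhit \<phi> x" if "lform \<phi>" "x \<in> B" for \<phi> x
    unfolding lhit_def rhit_def
    by (rule cocommutativeD[OF coc that(2)]) (intro lin_intros that(1))
  \<comment> \<open>The two actions commute with each other and agree on \<open>B\<close>, so the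
    dual algebra acts on \<open>B\<close> by commuting operators.\<close>
  have comm: "lhit \<phi> (lhit \<psi> x) = lhit \<psi> (lhit \<phi> x)" if "lform \<phi>" "lform \<psi>" "x \<in> B" for \<phi> \<psi> x
    using hits_eq[OF that(2,3)] hits_eq[OF that(2) subcoalD(2)[OF BD(2) that(1,3)]]
      lhit_rhit[OF that(1,2), of x] by simp
  define X where "X = B \<inter> (\<Union>n. wedge A n)"
  \<comment> \<open>Being fixed by some form that vanishes on \<open>A\<close> is the counterpart of
    the nilpotency that defines \<open>X\<close>.\<close>
  define Y where "Y = {b \<in> B. \<exists>j. annih A j \<and> lhit j b = b}"
  have annihD: "lform j" if "annih W j" for W j using that by (simp add: annih_def)
  \<comment> \<open>In the dual algebra, with unit \<epsilon>, this form is 1 - (1 - i)(1 - j); on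
    \<open>B\<close> it fixes whatever \<open>i\<close> or \<open>j\<close> fixes.\<close>
  have merge: "annih A (\<lambda>z. i z + j z - i (lhit j z))" if "annih A i" "annih A j" for i j
    using that annih_hits(1)[OF AD(2)] lform_conv(1)[OF annihD annihD, OF that]
    by (auto simp: annih_def lform_closed lform_0)
  have merge_hit: "lhit (\<lambda>z. i z + j z - i (lhit j z)) b = lhit i b + lhit j b - lhit i (lhit j b)"
    if "annih A i" "annih A j" for i j b
    using lhit_lhit[OF annihD annihD, OF that]
    by (simp add: lhit_diff lhit_add)
  have merge_fix: "lhit (\<lambda>z. i z + j z - i (lhit j z)) b = b"
    if "annih A i" "annih A j" "b \<in> B" "lhit i b = b \<or> lhit j b = b" for i j b
    unfolding merge_hit[OF that(1,2)]
    using that(4) comm[OF annihD[OF that(1)] annihD[OF that(2)] that(3)] by auto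
  have subX: "subspace X"
    unfolding X_def by (intro subspace_inter BD(3) subspace_wedge_Union AD(2))
  have subY: "subspace Y"
  proof (rule subspaceI)
    have "annih A (\<lambda>_. 0)" by (simp add: annih_def lform_closed)
    moreover have "lhit (\<lambda>_. 0) 0 = 0" by (simp add: lhit_def split_def)
    ultimately show "0 \<in> Y" using subspace_0[OF BD(3)] unfolding Y_def by blast
    fix x y assume "x \<in> Y" "y \<in> Y"
    then obtain i j where i: "annih A i" "lhit i x = x" and j: "annih A j" "lhit j y = y"
      and xy: "x \<in> B" "y \<in> B" by (auto simp: Y_def)
    let ?k = "\<lambda>z. i z + j z - i (lhit j z)"
    have "lhit ?k (x + y) = x + y"
      using merge_fix[OF i(1) j(1)] xy i j lin_add[OF lin_lhit[OF annihD[OF merge[OF i(1) j(1)]]]] by simp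
    then show "x + y \<in> Y"
      using merge[OF i(1) j(1)] subspace_add[OF BD(3) xy] unfolding Y_def by blast
  next
    fix c x assume "x \<in> Y"
    then show "c \<star> x \<in> Y"
      using subspace_scale[OF BD(3)] by (auto simp: Y_def lin_scale[OF lin_lhit[OF annihD]])
  qed
  have coalX: "subcoal X"
    using subX subcoalD(2,3)[OF BD(2)] subcoalD(2,3)[OF subcoal_wedge[OF AD(2)]]
    by (intro subcoalI) (auto simp: X_def, blast+)
  have hitY: "lhit \<phi> y \<in> Y" if "lform \<phi>" "y \<in> Y" for \<phi> y
    using that comm[OF _ that(1), of _ y] subcoalD(2)[OF BD(2) that(1)]
    by (auto simp: Y_def annihD)
  have coalY: "subcoal Y"
    using hitY hits_eq by (intro subcoalI subY) (auto simp: Y_def)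
  have XY: "X \<inter> Y \<subseteq> {0}"
  proof -
    have "b = 0" if "annih A j" "lhit j b = b" "b \<in> wedge A n" for b j n
      using that(3)
    proof (induction n)
      case 0
      then show ?case using annih_hits(1)[OF AD(2) _ that(1), of b] that(2) by simp
    next
      case (Suc n)
      then show ?case using that(1,2) by auto
    qed
    then show ?thesis by (auto simp: X_def Y_def)
  qed
  obtain e where e: "lin e" "\<And>x. x \<in> X \<Longrightarrow> e x = x" "\<And>y. y \<in> Y \<Longrightarrow> e y = 0"
    by (rule direct_sum_projection[OF subX subY XY]) (rule that)
  have unit: "\<exists>j. annih A j \<and> (\<forall>v\<in>V. lhit j v = v)" if V: "subspace V" "findim V" "V \<subseteq> Y" for V
  proof -
    from findim_basis[OF V(1,2)] obtain F where F: "finite F" "F \<subseteq> V" "V = span F" by metis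
    have "\<exists>j. annih A j \<and> (\<forall>v\<in>F. lhit j v = v)" if "finite F" "F \<subseteq> Y" for F
      using that
    proof (induction F rule: finite_induct)
      case empty
      have "annih A (\<lambda>_. 0)" by (simp add: annih_def lform_closed)
      then show ?case by blast
    next
      case (insert v F)
      then obtain j where j: "annih A j" "\<And>v. v \<in> F \<Longrightarrow> lhit j v = v" by auto
      obtain i where i: "annih A i" "lhit i v = v" using insert.prems by (auto simp: Y_def)
      have "lhit (\<lambda>z. i z + j z - i (lhit j z)) w = w" if "w \<in> insert v F" for w
        by (rule merge_fix[OF i(1) j(1)]) (use that i j insert.prems in \<open>auto simp: Y_def\<close>)
      then show ?case using merge[OF i(1) j(1)] by blast
    qed
    from this[OF F(1) subset_trans[OF F(2) V(3)]]
    obtain j where j: "annih A j" "\<And>v. v \<in> F \<Longrightarrow> lhit j v = v" by blast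
    have "subspace {v. lhit j v - v = 0}"
      by (rule subspace_kernel[OF lin_minus[OF lin_lhit[OF annihD[OF j(1)]] lin_ident]])
    then have "V \<subseteq> {v. lhit j v - v = 0}"
      unfolding F(3) by (rule span_minimal[rotated]) (use j(2) in auto)
    then show ?thesis using j(1) by auto
  qed
  have decomp: "\<exists>x\<in>X. \<exists>y\<in>Y. b = x + y" if "b \<in> B" for b
    using that
  proof (induction b rule: measure_induct_rule[where f = "\<lambda>b. dim (orb b)"])
    case (less b)
    have jB: "lhit j b \<in> B" if "annih A j" for j using subcoalD(2)[OF BD(2) annihD[OF that] less.prems] .
    show ?case
    \<comment> \<open>If some contraction of \<open>b\<close> by a form vanishing on
      \<open>A\<close> still generates \<open>b\<close>, such a form even fixes \<open>b\<close>.
      Otherwise all these contractions have smaller orbits and the induction hypothesis splits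
      them.\<close>
    proof (cases "\<exists>j. annih A j \<and> b \<in> orb (lhit j b)")
      case True
      then obtain j \<phi> where j: "annih A j" "lform \<phi>" "b = lhit \<phi> (lhit j b)" by (auto simp: orb_def)
      then have "lhit (\<lambda>z. \<phi> (lhit j z)) b = b" using lhit_lhit[OF j(2) annihD[OF j(1)]] by metis
      moreover have "annih A (\<lambda>z. \<phi> (lhit j z))"
        using lform_conv(1)[OF j(2) annihD[OF j(1)]] annih_hits(1)[OF AD(2) _ j(1)] lform_0[OF j(2)]
        by (auto simp: annih_def)
      ultimately have "b \<in> Y" using less.prems unfolding Y_def by blast
      then show ?thesis using subspace_0[OF subX] by (intro bexI[of _ 0] bexI[of _ b]) auto
    next
      case False
      let ?J = "{lhit j b | j. annih A j}"
      have J_decomp: "\<exists>x\<in>X. \<exists>y\<in>Y. lhit j b = x + y" if j: "annih A j" for j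
      proof (rule less.IH[OF _ jB[OF j]])
        have "orb (lhit j b) \<subseteq> orb b" using orb_trans[OF orb_lhit[OF annihD[OF j] orb_self]] .
        moreover have "b \<notin> orb (lhit j b)" using False j by blast
        ultimately show "dim (orb (lhit j b)) < dim (orb b)"
          using orb_self[of b] by (intro dim_less_psubset subspace_orb findim_orb) auto
      qed
      have subJ: "subspace ?J" by (rule subspace_annih_orb)
      have finJ: "findim ?J" by (rule findim_mono[OF findim_orb[of b]]) (auto simp: orb_def annih_def)
      let ?q = "\<lambda>x. x - e x"
      have q: "lin ?q" using lin_minus[OF lin_ident e(1)] .
      have qY: "?q ` ?J \<subseteq> Y" using J_decomp e by (fastforce simp: lin_add[OF e(1)])
      have "findim (?q ` ?J)"
      proof -
        obtain F where F: "finite F" "?J = span F" by (rule findim_basis[OF subJ finJ]) (rule that)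
        have "span F \<subseteq> {z. ?q z \<in> span (?q ` F)}"
          by (rule span_minimal[OF _ subspace_lin_vimage[OF q subspace_span]]) (auto intro: span_base)
        then have "?q ` ?J \<subseteq> span (?q ` F)" unfolding F(2) by blast
        then show ?thesis unfolding findim_def using F(1) by blast
      qed
      then obtain i where i: "annih A i" "\<And>v. v \<in> ?q ` ?J \<Longrightarrow> lhit i v = v"
        using unit[OF subspace_lin_image[OF q subJ] _ qY] by blast
      \<comment> \<open>The form \<open>i\<close> fixes the \<open>Y\<close>-parts of all
        contractions of \<open>b\<close> by forms vanishing on \<open>A\<close>. Subtracting leaves
        such contractions of \<open>?c\<close> in \<open>X\<close>, so \<open>?c\<close> lies in
        \<open>X\<close>, one wedge step higher.\<close>
      let ?c = "b - lhit i b"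
      have jc: "lhit j ?c \<in> X" if j: "annih A j" for j
      proof -
        obtain x y where xy: "x \<in> X" "y \<in> Y" "lhit j b = x + y" using J_decomp[OF j] by blast
        have "?q (lhit j b) = y" using xy e by (simp add: lin_add[OF e(1)])
        then have iy: "lhit i y = y" using i(2) j by blast
        have "lhit j ?c = lhit j b - lhit i (lhit j b)"
          using comm[OF annihD[OF j] annihD[OF i(1)] less.prems] by (simp add: lin_diff[OF lin_lhit[OF annihD[OF j]]])
        also have "\<dots> = x - lhit i x" using iy xy(3) by (simp add: lin_add[OF lin_lhit[OF annihD[OF i(1)]]])
        also have "\<dots> \<in> X" using subspace_diff[OF subX xy(1) subcoalD(2)[OF coalX annihD[OF i(1)] xy(1)]] .
        finally show ?thesis .
      qed
      have "{lhit j ?c | j. annih A j} \<subseteq> (\<Union>n. wedge A n)" using jc by (auto simp: X_def)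
      moreover have "findim {lhit j ?c | j. annih A j}"
        by (rule findim_mono[OF findim_orb[of ?c]]) (auto simp: orb_def annih_def)
      ultimately obtain n where "{lhit j ?c | j. annih A j} \<subseteq> wedge A n"
        using findim_chain[OF subspace_annih_orb, of ?c A "wedge A"] wedge_mono[OF AD(2)]
          subcoalD(1)[OF subcoal_wedge[OF AD(2)]] by blast
      then have "?c \<in> wedge A (Suc n)" by auto
      moreover have "?c \<in> B" using subspace_diff[OF BD(3) less.prems jB[OF i(1)]] .
      ultimately have cX: "?c \<in> X" unfolding X_def by blast
      obtain x y where xy: "x \<in> X" "y \<in> Y" "lhit i b = x + y" using J_decomp[OF i(1)] by blast
      have "b = (?c + x) + y" using xy(3) by (simp add: algebra_simps)
      then show ?thesis using subspace_add[OF subX cX xy(1)] xy(2) by blast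
    qed
  qed
  define \<chi> where "\<chi> x = \<epsilon> (e x)" for x
  have \<chi>: "lform \<chi>" unfolding \<chi>_def using lform_comp[OF eps_lform e(1)] .
  have \<chi>X: "\<chi> x = \<epsilon> x" if "x \<in> X" for x using e(2)[OF that] by (simp add: \<chi>_def)
  have \<chi>Y: "\<chi> y = 0" if "y \<in> Y" for y using e(3)[OF that] by (simp add: \<chi>_def lform_0[OF eps_lform])
  have \<chi>l: "lform (\<lambda>x. \<chi> (f x))" if "lin f" for f using lform_comp[OF \<chi> that] .
  have hit\<chi>: "lhit \<chi> z \<in> X" if z: "z \<in> B" for z
  proof -
    obtain x y where xy: "x \<in> X" "y \<in> Y" "z = x + y" using decomp[OF z] by blast
    have "lhit \<chi> x \<in> X" using subcoalD(2)[OF coalX \<chi> xy(1)] .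
    moreover have "lhit \<chi> y = 0"
      by (rule annih_hits(1)[OF coalY xy(2)]) (simp add: annih_def \<chi> \<chi>Y)
    ultimately show ?thesis by (simp add: xy(3) lin_add[OF lin_lhit[OF \<chi>]])
  qed
  have XA: "x \<odot> a \<in> X" if x: "x \<in> X" and a: "a \<in> A" for x a
  proof -
    obtain n where "x \<in> B" "x \<in> wedge A n" using x by (auto simp: X_def)
    then have "x \<odot> a \<in> B" "x \<odot> a \<in> wedge A n"
      using a AB BD(6) wedge_mul[OF A] by auto
    then show ?thesis unfolding X_def by blast
  qed
  \<comment> \<open>\<open>?T\<close> lies in \<open>Y\<close> by \<open>hitY\<close>. Inserting a2
    S(a3) and interchanging the first two legs of \<open>a\<close> by cocommutativity rewrites it as
    a contraction by \<chi> times an element of \<open>A\<close>, which lies in \<open>X\<close>. So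
    \<open>?T\<close> is 0, and its counit is the desired value.\<close>
  have \<chi>_mul_Y: "\<chi> (y \<odot> a) = 0" if y: "y \<in> Y" and a: "a \<in> A" for y a
  proof -
    let ?T = "lhit (\<lambda>z. \<chi> (z \<odot> a)) y"
    have yB: "y \<in> B" using y by (simp add: Y_def)
    have l: "lform (\<lambda>z. \<chi> (z \<odot> a))" by (intro \<chi>l lin_intros)
    have "?T = (\<Sum>(y1, y2)\<leftarrow>\<Delta> y. \<Sum>(u, r)\<leftarrow>\<Delta> a. \<epsilon> r \<star> (\<chi> (y2 \<odot> u) \<star> (y1 \<odot> \<one>)))"
      unfolding lhit_def mul_one
      by (intro sum_list_pairs_cong contract_counit(2)[symmetric]) (intro lin_intros \<chi>l)
    also have "\<dots> = (\<Sum>(y1, y2)\<leftarrow>\<Delta> y. \<Sum>(u, r)\<leftarrow>\<Delta> a. \<Sum>(v, c)\<leftarrow>\<Delta> r. \<chi> (y2 \<odot> u) \<star> (y1 \<odot> (v \<odot> S c)))"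
      by (intro sum_list_pairs_cong contract_antipode(2)[symmetric]) (intro lin_intros \<chi>l)
    also have "\<dots> = (\<Sum>(y1, y2)\<leftarrow>\<Delta> y. \<Sum>(h, c)\<leftarrow>\<Delta> a. \<Sum>(u, v)\<leftarrow>\<Delta> h. \<chi> (y2 \<odot> u) \<star> (y1 \<odot> (v \<odot> S c)))"
      by (intro sum_list_pairs_cong cop_coassoc[symmetric]) (intro lin_intros \<chi>l)
    also have "\<dots> = (\<Sum>(y1, y2)\<leftarrow>\<Delta> y. \<Sum>(h, c)\<leftarrow>\<Delta> a. \<Sum>(u, v)\<leftarrow>\<Delta> h. \<chi> (y2 \<odot> v) \<star> (y1 \<odot> (u \<odot> S c)))"
    proof (rule sum_list_pairs_cong, rule cop_cong[OF AD(2) a])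
      fix y1 y2 h c assume "h \<in> A"
      then have "h \<in> B" using AB by blast
      then show "(\<Sum>(u, v)\<leftarrow>\<Delta> h. \<chi> (y2 \<odot> u) \<star> (y1 \<odot> (v \<odot> S c)))
        = (\<Sum>(u, v)\<leftarrow>\<Delta> h. \<chi> (y2 \<odot> v) \<star> (y1 \<odot> (u \<odot> S c)))"
        by (rule cocommutativeD[OF coc]) (intro lin_intros \<chi>l)
    qed (intro lin_intros \<chi>l)+
    also have "\<dots> = (\<Sum>(h, c)\<leftarrow>\<Delta> a. \<Sum>(y1, y2)\<leftarrow>\<Delta> y. \<Sum>(u, v)\<leftarrow>\<Delta> h. \<chi> (y2 \<odot> v) \<star> (y1 \<odot> (u \<odot> S c)))"
      by (rule sum_list_pairs_swap)
    also have "\<dots> = (\<Sum>(h, c)\<leftarrow>\<Delta> a. (\<Sum>(y1, y2)\<leftarrow>\<Delta> y. \<Sum>(u, v)\<leftarrow>\<Delta> h. \<chi> (y2 \<odot> v) \<star> (y1 \<odot> u)) \<odot> S c)"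
      by (simp add: mul_pairs mul_scale mul_assoc)
    also have "\<dots> = (\<Sum>(h, c)\<leftarrow>\<Delta> a. lhit \<chi> (y \<odot> h) \<odot> S c)"
      unfolding lhit_def
      by (intro sum_list_pairs_cong arg_cong[where f = "\<lambda>x. x \<odot> S _"] cop_mul[symmetric] lin_intros \<chi>)
    also have "\<dots> \<in> X"
    proof (rule cop_mem[OF AD(2) a _ subX])
      show "bilin (\<lambda>h c. lhit \<chi> (y \<odot> h) \<odot> S c)" unfolding lhit_def by (intro lin_intros \<chi>)
      show "lhit \<chi> (y \<odot> h) \<odot> S c \<in> X" if "h \<in> A" "c \<in> A" for h c
        using that AB by (intro XA hit\<chi> BD(6)[OF yB] AD(5)) auto
    qed
    finally have "?T \<in> X" .
    then have "?T = 0" using hitY[OF l y] XY by blast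
    then show ?thesis using eps_lhit[OF l, of y] lform_0[OF eps_lform] by simp
  qed
  have \<chi>_mul: "\<chi> (b \<odot> a) = \<epsilon> a * \<chi> b" if b: "b \<in> B" and a: "a \<in> A" for a b
  proof -
    obtain x y where xy: "x \<in> X" "y \<in> Y" "b = x + y" using decomp[OF b] by blast
    then show ?thesis
      using \<chi>X[OF XA[OF xy(1) a]] \<chi>_mul_Y[OF xy(2) a] \<chi>X[OF xy(1)] \<chi>Y[OF xy(2)]
      by (simp add: mul_add lform_add[OF \<chi>] eps_mul)
  qed
  have "prod_span B {a \<in> A. \<epsilon> a = 0} \<subseteq> {x. \<chi> x = 0}"
    unfolding prod_span_def by (intro span_minimal subspace_lform_kernel[OF \<chi>]) (auto simp: \<chi>_mul)
  then have \<chi>0: "\<chi> x = 0" if "x \<in> B" "\<epsilon> x = 0" for x using gen that by blast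
  have "\<one> \<in> wedge A 0" using AD(4) by simp
  then have "\<one> \<in> X" using BD(4) unfolding X_def by blast
  then have \<chi>1: "\<chi> \<one> = 1" using \<chi>X eps_one by simp
  \<comment> \<open>On \<open>B\<close> the form \<chi> agrees with \<epsilon>, since it is 1 at
    \<one> and vanishes where \<epsilon> does. So the counit of the subcoalgebra \<open>Y\<close> is
    zero.\<close>
  have "Y \<subseteq> {0}"
  proof -
    have "\<epsilon> y = 0" if y: "y \<in> Y" for y
    proof -
      have "y - \<epsilon> y \<star> \<one> \<in> B"
        using y BD(4) by (intro subspace_diff[OF BD(3)] subspace_scale[OF BD(3)]) (auto simp: Y_def)
      from \<chi>0[OF this eps_diff] show ?thesis
        using \<chi>Y[OF y] by (simp add: lform_diff[OF \<chi>] lform_scale[OF \<chi>] \<chi>1)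
    qed
    then have "annih Y \<epsilon>" by (simp add: annih_def eps_lform)
    from annih_hits(1)[OF coalY _ this] show ?thesis by (auto simp: lhit_eps)
  qed
  then have BX: "B \<subseteq> (\<Union>n. wedge A n)" using decomp by (fastforce simp: X_def)
  have coalC: "subcoal C" "C \<noteq> {0}" using C(1) by (auto simp: simple_subcoal_def)
  show "C \<subseteq> A"
  proof (rule ccontr)
    assume "\<not> C \<subseteq> A"
    then have CA: "C \<inter> A = {0}"
      using C(1) subcoal_Int[OF coalC(1) AD(2)] unfolding simple_subcoal_def by blast
    \<comment> \<open>Contractions by forms vanishing on \<open>A\<close> lower the wedge degree and
      stay in \<open>C\<close>, so they are 0 by induction; forms then separate no element of the
      intersection from \<open>A\<close>.\<close>
    have "C \<inter> wedge A n \<subseteq> {0}" for n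
    proof (induction n)
      case (Suc n)
      show ?case
      proof
        fix x assume x: "x \<in> C \<inter> wedge A (Suc n)"
        have "\<phi> x = 0" if \<phi>: "annih A \<phi>" for \<phi>
        proof -
          have "lhit \<phi> x \<in> C \<inter> wedge A n" using x \<phi> subcoalD(2)[OF coalC(1) annihD[OF \<phi>]] by auto
          then have "lhit \<phi> x = 0" using Suc by blast
          then show ?thesis using eps_lhit[OF annihD[OF \<phi>], of x] lform_0[OF eps_lform] by simp
        qed
        then have "x \<in> A" using lform_separate[OF AD(3), of x] by (metis annih_def zero_neq_one)
        then show "x \<in> {0}" using CA x by blast
      qed
    qed (use CA in simp)
    then have "C \<subseteq> {0}" using C(2) BX by blast
    then show False using coalC(2) subspace_0[OF subcoalD(1)[OF coalC(1)]] by blast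
  qed
qed

section \<open>Noetherian Hopf algebras\<close>

text \<open>\<open>inv\<close> says that \<open>S\<close> inverts the identity for the opposite
  coproduct too. Applying \<open>S\<close> shows that \<open>S \<circ> S\<close> is convolution
  inverse to \<open>S\<close>, hence the identity; the chain evaluates x S(y) S(S(z)) in two
  ways.\<close>

lemma antipode_involutive:
  assumes B: "hopf_sub B"
    and inv: "\<And>r. r \<in> B \<Longrightarrow> (\<Sum>(y, z)\<leftarrow>\<Delta> r. S z \<odot> y) = \<epsilon> r \<star> \<one>"
    and b: "b \<in> B"
  shows "S (S b) = b"
proof -
  have "S (S b) = \<one> \<odot> S (S b)" by (simp add: one_mul)
  also have "\<dots> = (\<Sum>(e, z)\<leftarrow>\<Delta> b. \<epsilon> e \<star> (\<one> \<odot> S (S z)))"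
    by (rule contract_counit(1)[symmetric]) (intro lin_intros)
  also have "\<dots> = (\<Sum>(e, z)\<leftarrow>\<Delta> b. \<Sum>(x, y)\<leftarrow>\<Delta> e. (x \<odot> S y) \<odot> S (S z))"
    by (intro sum_list_pairs_cong contract_antipode(2)[symmetric]) (intro lin_intros)
  also have "\<dots> = (\<Sum>(x, r)\<leftarrow>\<Delta> b. \<Sum>(y, z)\<leftarrow>\<Delta> r. (x \<odot> S y) \<odot> S (S z))"
    by (rule cop_coassoc) (intro lin_intros)
  also have "\<dots> = (\<Sum>(x, r)\<leftarrow>\<Delta> b. x \<odot> S (\<Sum>(y, z)\<leftarrow>\<Delta> r. S z \<odot> y))"
    by (simp add: lin_pairs[OF S_lin] mul_pairs S_mul mul_assoc)
  also have "\<dots> = (\<Sum>(x, r)\<leftarrow>\<Delta> b. \<epsilon> r \<star> x)"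
    by (rule cop_cong[OF hopf_subD(2)[OF B] b])
      (intro lin_intros, intro lin_intros, simp add: inv lin_scale[OF S_lin] S_one mul_scale mul_one)
  finally show ?thesis by (simp add: cop_counit_right)
qed

text \<open>By \<open>S_cop\<close> the antipode reverses the legs, so it exchanges left and right
  contractions.\<close>

lemma subcoal_S: "subcoal C \<Longrightarrow> subcoal (S ` C)"
proof (rule subcoalI)
  assume C: "subcoal C"
  show "subspace (S ` C)" by (rule subspace_lin_image[OF S_lin subcoalD(1)[OF C]])
  fix \<phi> x assume \<phi>: "lform \<phi>" and "x \<in> S ` C"
  then obtain c where c: "c \<in> C" "x = S c" by blast
  have \<phi>S: "lform (\<lambda>z. \<phi> (S z))" using lform_comp[OF \<phi> S_lin] .
  have "lhit \<phi> x = (\<Sum>(a, b)\<leftarrow>\<Delta> c. \<phi> (S a) \<star> S b)"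
    unfolding lhit_def c(2) by (rule S_cop) (intro lin_intros \<phi>)
  also have "\<dots> = S (rhit (\<lambda>z. \<phi> (S z)) c)" by (simp add: rhit_def lin_pairs[OF S_lin] lin_scale[OF S_lin])
  finally show "lhit \<phi> x \<in> S ` C" using subcoalD(3)[OF C \<phi>S c(1)] by simp
  have "rhit \<phi> x = (\<Sum>(a, b)\<leftarrow>\<Delta> c. \<phi> (S b) \<star> S a)"
    unfolding rhit_def c(2) by (rule S_cop) (intro lin_intros \<phi>)
  also have "\<dots> = S (lhit (\<lambda>z. \<phi> (S z)) c)" by (simp add: lhit_def lin_pairs[OF S_lin] lin_scale[OF S_lin])
  finally show "rhit \<phi> x \<in> S ` C" using subcoalD(2)[OF C \<phi>S c(1)] by simp
qed

lemma subcoal_span_Un: "subcoal C \<Longrightarrow> subcoal D \<Longrightarrow> subcoal (span (C \<union> D))"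
  using subcoal_span_Union[of "{C, D}"] by auto

lemma finite_subcoal_set:
  assumes "finite X"
  obtains E where "subcoal E" "findim E" "X \<subseteq> E" "\<And>C. subcoal C \<Longrightarrow> X \<subseteq> C \<Longrightarrow> E \<subseteq> C"
proof -
  have "\<exists>E. subcoal E \<and> findim E \<and> X \<subseteq> E \<and> (\<forall>C. subcoal C \<and> X \<subseteq> C \<longrightarrow> E \<subseteq> C)"
    using assms
  proof (induction X rule: finite_induct)
    case empty
    have "subcoal {0}" by (auto simp: subcoal_def lin_0[OF lin_lhit] lin_0[OF lin_rhit])
    moreover have "findim {0}" unfolding findim_def by (intro exI[of _ "{}"]) simp
    ultimately show ?case using subspace_0[OF subcoalD(1)] by (intro exI[of _ "{0}"]) auto
  next
    case (insert x X)
    from insert.IH obtain E where E: "subcoal E" "findim E" "X \<subseteq> E"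
      "\<forall>C. subcoal C \<and> X \<subseteq> C \<longrightarrow> E \<subseteq> C" by (elim exE conjE)
    obtain D where D: "subcoal D" "findim D" "x \<in> D" "\<And>C. subcoal C \<Longrightarrow> x \<in> C \<Longrightarrow> D \<subseteq> C"
      by (rule finite_subcoal[of x]) (rule that)
    let ?F = "span (E \<union> D)"
    from E(2) D(2) obtain B B' where "finite B" "E \<subseteq> span B" "finite B'" "D \<subseteq> span B'"
      by (auto simp: findim_def)
    then have "findim ?F" unfolding findim_def
      by (intro exI[of _ "B \<union> B'"] conjI span_minimal subspace_span)
        (use span_mono[of B "B \<union> B'"] span_mono[of B' "B \<union> B'"] in auto)
    moreover have "insert x X \<subseteq> ?F" using E(3) D(3) by (auto intro: span_base)
    moreover have "?F \<subseteq> C" if "subcoal C" "insert x X \<subseteq> C" for C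
      using that E(4) D(4) by (intro span_minimal subcoalD(1)) auto
    ultimately show ?case using subcoal_span_Un[OF E(1) D(1)] by blast
  qed
  then obtain E where "subcoal E" "findim E" "X \<subseteq> E" "\<forall>C. subcoal C \<and> X \<subseteq> C \<longrightarrow> E \<subseteq> C"
    by (elim exE conjE)
  then show ?thesis by (intro that[of E]) auto
qed

section \<open>Generated subalgebras\<close>

lemma subalg_hull_span: "subalg hull (span T) = subalg hull T"
proof (rule antisym)
  show "subalg hull (span T) \<subseteq> subalg hull T"
    by (intro hull_minimal span_minimal subalg_hull hull_subset) (rule subalgD(1)[OF subalg_hull])
  show "subalg hull T \<subseteq> subalg hull (span T)"
    by (rule hull_mono) (rule span_superset)
qed

lemma subalg_hull_cong:
  "T \<subseteq> subalg hull T' \<Longrightarrow> T' \<subseteq> subalg hull T \<Longrightarrow> subalg hull T = subalg hull T'"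
  by (intro antisym hull_minimal subalg_hull)

text \<open>Centralizers are subalgebras; this is applied to the centralizer of \<open>T\<close> and
  then to that of the generated subalgebra.\<close>

lemma subalg_hull_commutes:
  assumes "\<And>x y. x \<in> T \<Longrightarrow> y \<in> T \<Longrightarrow> x \<odot> y = y \<odot> x"
    and xy: "x \<in> subalg hull T" "y \<in> subalg hull T"
  shows "x \<odot> y = y \<odot> x"
proof -
  let ?C = "\<lambda>W. {x. \<forall>w\<in>W. x \<odot> w = w \<odot> x}"
  have cent: "subalg (?C W)" for W
  proof -
    have "subspace (?C W)" by (rule subspaceI) (auto simp: mul_add mul_scale)
    then show ?thesis by (auto simp: subalg_def one_mul mul_one) (metis mul_assoc)
  qed
  have "subalg hull T \<subseteq> ?C T" by (rule hull_minimal[where S = subalg, OF _ cent]) (use assms(1) in auto)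
  then have "T \<subseteq> ?C (subalg hull T)" by auto
  then have "subalg hull T \<subseteq> ?C (subalg hull T)" by (rule hull_minimal[where S = subalg, OF _ cent])
  then show ?thesis using xy by blast
qed

lemma cocommutative_subalg_hull:
  assumes "cocommutative T"
  shows "cocommutative (subalg hull T)"
proof -
  let ?C = "{x. \<forall>G. bilin G \<longrightarrow> (\<Sum>(a, b)\<leftarrow>\<Delta> x. G a b) = (\<Sum>(a, b)\<leftarrow>\<Delta> x. G b a)}"
  have flip: "bilin (\<lambda>a b. G b a)" if "bilin G" for G using that by (auto simp: bilin_def)
  have "subspace ?C"
    by (rule subspaceI)
      (auto simp: lin_0[OF cop_lin] lin_add[OF cop_lin] lin_scale[OF cop_lin] dest!: flip
        simp: lin_0[OF cop_lin[OF flip]] lin_add[OF cop_lin[OF flip]] lin_scale[OF cop_lin[OF flip]])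
  moreover have "\<one> \<in> ?C" by (simp add: cop_one flip)
  moreover have "x \<odot> y \<in> ?C" if x: "x \<in> ?C" and y: "y \<in> ?C" for x y
  proof (intro CollectI allI impI)
    fix G assume G: "bilin G"
    have G1: "lin (\<lambda>x. G (f x) c)" if "lin f" for f c using lin_comp[OF bilinD(1)[OF G] that] .
    have G2: "lin (\<lambda>x. G c (f x))" if "lin f" for f c using lin_comp[OF bilinD(2)[OF G] that] .
    have "(\<Sum>(a, b)\<leftarrow>\<Delta> (x \<odot> y). G a b) = (\<Sum>(a, b)\<leftarrow>\<Delta> x. \<Sum>(c, d)\<leftarrow>\<Delta> y. G (a \<odot> c) (b \<odot> d))"
      by (rule cop_mul[OF G])
    also have "\<dots> = (\<Sum>(a, b)\<leftarrow>\<Delta> x. \<Sum>(c, d)\<leftarrow>\<Delta> y. G (b \<odot> c) (a \<odot> d))"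
    proof -
      have "bilin (\<lambda>a b. \<Sum>(c, d)\<leftarrow>\<Delta> y. G (a \<odot> c) (b \<odot> d))" by (intro lin_intros G1 G2)
      then show ?thesis using x by simp
    qed
    also have "\<dots> = (\<Sum>(a, b)\<leftarrow>\<Delta> x. \<Sum>(c, d)\<leftarrow>\<Delta> y. G (b \<odot> d) (a \<odot> c))"
    proof (rule sum_list_pairs_cong)
      fix a b
      have "bilin (\<lambda>c d. G (b \<odot> c) (a \<odot> d))" by (intro lin_intros G1 G2)
      then show "(\<Sum>(c, d)\<leftarrow>\<Delta> y. G (b \<odot> c) (a \<odot> d)) = (\<Sum>(c, d)\<leftarrow>\<Delta> y. G (b \<odot> d) (a \<odot> c))"
        using y by simp
    qed
    also have "\<dots> = (\<Sum>(a, b)\<leftarrow>\<Delta> (x \<odot> y). G b a)" by (rule cop_mul[OF flip[OF G], symmetric])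
    finally show "(\<Sum>(a, b)\<leftarrow>\<Delta> (x \<odot> y). G a b) = (\<Sum>(a, b)\<leftarrow>\<Delta> (x \<odot> y). G b a)" .
  qed
  ultimately have "subalg ?C" unfolding subalg_def by blast
  then have "subalg hull T \<subseteq> ?C" by (intro hull_minimal) (use assms in \<open>auto simp: cocommutative_def\<close>)
  then show ?thesis unfolding cocommutative_def by blast
qed

section \<open>Left ideals and the ascending chain condition\<close>

definition lideal :: "'h set \<Rightarrow> bool" where
  "lideal I \<longleftrightarrow> 0 \<in> I \<and> (\<forall>x\<in>I. \<forall>y\<in>I. x + y \<in> I) \<and> (\<forall>r. \<forall>x\<in>I. r \<odot> x \<in> I)"

lemma lideal_prod_span: "lideal (prod_span UNIV T)"
proof -
  have "r \<odot> x \<in> prod_span UNIV T" if "x \<in> prod_span UNIV T" for r x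
  proof -
    let ?G = "{x \<odot> t | x t. x \<in> UNIV \<and> t \<in> T}"
    have "?G \<subseteq> {x. r \<odot> x \<in> span ?G}" by (force simp: mul_assoc[symmetric] intro: span_base)
    then show ?thesis
      using span_minimal[OF _ subspace_lin_vimage[OF mul_lin(2) subspace_span]] that
      unfolding prod_span_def by blast
  qed
  then show ?thesis unfolding lideal_def by (auto simp: prod_span_def intro: span_zero span_add)
qed

text \<open>Repeatedly choosing an element of \<open>T\<close> outside the ideal reached so far
  would give a strictly ascending chain. The generators are taken from \<open>T\<close> itself,
  which later keeps them in a given Hopf subalgebra.\<close>

lemma noetherian_finite:
  assumes noeth: "\<And>I :: nat \<Rightarrow> 'h set. (\<And>n. lideal (I n)) \<Longrightarrow> mono I \<Longrightarrow> \<exists>m. \<forall>n\<ge>m. I n = I m"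
  obtains T' where "finite T'" "T' \<subseteq> T" "T \<subseteq> prod_span UNIV T'"
proof -
  have "\<exists>T'. finite T' \<and> T' \<subseteq> T \<and> T \<subseteq> prod_span UNIV T'"
  proof (rule ccontr)
    assume "\<not> ?thesis"
    then have "\<forall>F. \<exists>t. finite F \<and> F \<subseteq> T \<longrightarrow> t \<in> T \<and> t \<notin> prod_span UNIV F" by blast
    then obtain t where t: "\<And>F. finite F \<Longrightarrow> F \<subseteq> T \<Longrightarrow> t F \<in> T \<and> t F \<notin> prod_span UNIV F" by metis
    define F where "F = rec_nat {} (\<lambda>_ F. insert (t F) F)"
    have F_simps: "F 0 = {}" "F (Suc n) = insert (t (F n)) (F n)" for n by (simp_all add: F_def)
    have F: "finite (F n) \<and> F n \<subseteq> T" for n by (induction n) (auto simp: F_simps t)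
    have "mono (\<lambda>n. prod_span UNIV (F n))"
      by (rule incseq_SucI, rule prod_span_mono) (auto simp: F_simps)
    then obtain m where m: "\<forall>n\<ge>m. prod_span UNIV (F n) = prod_span UNIV (F m)"
      using noeth[of "\<lambda>n. prod_span UNIV (F n)"] lideal_prod_span by blast
    have "\<one> \<odot> t (F m) \<in> prod_span UNIV (F (Suc m))"
      unfolding prod_span_def by (rule span_base) (auto simp: F_simps)
    then have "t (F m) \<in> prod_span UNIV (F m)" using m[rule_format, of "Suc m"] by (simp add: one_mul)
    then show False using t[of "F m"] F by blast
  qed
  then show ?thesis using that by blast
qed

section \<open>The Hopf subalgebra generated by the coradical\<close>

definition hopf_corad :: "'h set" where
  "hopf_corad = subalg hull (corad \<union> S ` corad)"

lemma hopf_corad_eq: "hopf_corad = subalg hull (span (corad \<union> S ` corad))"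
  by (simp add: hopf_corad_def subalg_hull_span)

text \<open>Stability under \<open>S\<close> is supplied by \<open>antipode_closed\<close>, so a
  Hopf subalgebra remains one when an arbitrary subcoalgebra is added to such an
  \<open>E\<close>.\<close>

lemma hopf_sub_hull:
  assumes "subcoal E" "corad \<union> S ` corad \<subseteq> subalg hull E"
  shows "hopf_sub (subalg hull E)"
  unfolding hopf_sub_def
  using antipode_closed[OF subalg_hull subcoal_hull[OF assms(1)]] assms subcoal_hull[OF assms(1)] subalg_hull
  by auto

lemma hopf_sub_hopf_corad: "hopf_sub hopf_corad"
  unfolding hopf_corad_eq
proof (rule hopf_sub_hull)
  show "subcoal (span (corad \<union> S ` corad))"
    by (rule subcoal_span_Un[OF subcoal_corad subcoal_S[OF subcoal_corad]])
  show "corad \<union> S ` corad \<subseteq> subalg hull span (corad \<union> S ` corad)"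
    by (simp only: subalg_hull_span hull_subset)
qed

lemma corad_subset_hopf_corad: "corad \<subseteq> hopf_corad"
  unfolding hopf_corad_def using hull_subset[of "corad \<union> S ` corad" subalg] by blast

context
  assumes noeth: "\<And>I :: nat \<Rightarrow> 'h set. (\<And>n. lideal (I n)) \<Longrightarrow> mono I \<Longrightarrow> \<exists>m. \<forall>n\<ge>m. I n = I m"
begin

lemma affine_if_hopf_corad_affine:
  assumes T: "finite T" "hopf_corad = subalg hull T"
  shows "\<exists>T. finite T \<and> subalg hull T = UNIV"
proof -
  obtain X where X: "finite X" "X \<subseteq> {x. \<epsilon> x = 0}" "{x. \<epsilon> x = 0} \<subseteq> prod_span UNIV X"
    by (rule noetherian_finite[OF noeth, of "{x. \<epsilon> x = 0}"])
  obtain E where E: "subcoal E" "findim E" "X \<subseteq> E"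
    by (rule finite_subcoal_set[OF X(1)]) (rule that)
  obtain F where F: "finite F" "E = span F"
    by (rule findim_basis[OF subcoalD(1)[OF E(1)] E(2)]) (rule that)
  let ?C = "span (corad \<union> S ` corad)"
  let ?K = "subalg hull (span (?C \<union> E))"
  have sup: "span (?C \<union> E) \<subseteq> ?K" by (rule hull_subset)
  have C_sub: "corad \<union> S ` corad \<subseteq> ?K" and E_sub: "E \<subseteq> ?K"
    using sup by (auto intro: span_base)
  have "subcoal (span (?C \<union> E))"
    by (intro subcoal_span_Un subcoal_corad subcoal_S E(1))
  then have K: "hopf_sub ?K" using C_sub by (rule hopf_sub_hull)
  have "?K = UNIV"
  proof (rule hopf_sub_eq_UNIV[OF K])
    show "corad \<subseteq> ?K" using C_sub by blast
    have "X \<subseteq> {k \<in> ?K. \<epsilon> k = 0}" using X(2) E(3) E_sub by blast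
    then show "{x. \<epsilon> x = 0} \<subseteq> prod_span UNIV {k \<in> ?K. \<epsilon> k = 0}"
      using X(3) prod_span_mono[OF order_refl] by blast
  qed
  moreover have "?K \<subseteq> subalg hull (T \<union> F)"
  proof -
    have sub: "subspace (subalg hull (T \<union> F))" by (rule subalgD(1)[OF subalg_hull])
    have "hopf_corad \<subseteq> subalg hull (T \<union> F)" unfolding T(2) by (rule hull_mono) blast
    moreover have "?C \<subseteq> hopf_corad" unfolding hopf_corad_eq by (rule hull_subset)
    moreover have "F \<subseteq> subalg hull (T \<union> F)" using hull_subset[of "T \<union> F" subalg] by blast
    then have "E \<subseteq> subalg hull (T \<union> F)" unfolding F(2) by (rule span_minimal[OF _ sub])
    ultimately have "?C \<union> E \<subseteq> subalg hull (T \<union> F)" by blast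
    from hull_minimal[where S = subalg, OF span_minimal[OF this sub] subalg_hull] show ?thesis .
  qed
  ultimately show ?thesis using T(1) F(1) by (intro exI[of _ "T \<union> F"]) auto
qed

text \<open>The chain condition is available only for ideals of \<open>H\<close>;
  \<open>prod_span_wedge\<close> with \<open>n = 0\<close> brings the resulting generation statement
  back to \<open>B\<close>. \<open>inv\<close> makes \<open>S\<close> an involution on
  \<open>B\<close>, so that \<open>E\<close> and its image generate an antipode-stable algebra, and
  \<open>max\<close> is the step that depends on the case.\<close>

lemma hopf_corad_affine:
  assumes inv: "\<And>r. r \<in> hopf_corad \<Longrightarrow> (\<Sum>(y, z)\<leftarrow>\<Delta> r. S z \<odot> y) = \<epsilon> r \<star> \<one>"
    and max: "\<And>A. hopf_sub A \<Longrightarrow> A \<subseteq> hopf_corad \<Longrightarrow>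
      {x \<in> hopf_corad. \<epsilon> x = 0} \<subseteq> prod_span hopf_corad {a \<in> A. \<epsilon> a = 0} \<Longrightarrow> A = hopf_corad"
  obtains T where "finite T" "hopf_corad = subalg hull T"
proof -
  let ?B = "hopf_corad"
  note B = hopf_sub_hopf_corad
  obtain X where X: "finite X" "X \<subseteq> {x \<in> ?B. \<epsilon> x = 0}" "{x \<in> ?B. \<epsilon> x = 0} \<subseteq> prod_span UNIV X"
    by (rule noetherian_finite[OF noeth, of "{x \<in> ?B. \<epsilon> x = 0}"])
  have XB: "X \<subseteq> ?B" using X(2) by blast
  obtain E where E: "subcoal E" "findim E" "X \<subseteq> E" "E \<subseteq> ?B"
    by (rule finite_subcoal_set[OF X(1)]) (use hopf_subD(2)[OF B] XB that in metis)
  obtain F where F: "finite F" "E = span F"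
    by (rule findim_basis[OF subcoalD(1)[OF E(1)] E(2)]) (rule that)
  let ?E = "span (E \<union> S ` E)"
  let ?A = "subalg hull ?E"
  have coalE: "subcoal ?E" by (intro subcoal_span_Un subcoal_S E(1))
  have EB: "E \<union> S ` E \<subseteq> ?B" using E(4) hopf_subD(5)[OF B] by blast
  have AB: "?A \<subseteq> ?B"
    using EB hopf_subD(1,3)[OF B] by (intro hull_minimal span_minimal)
  have EA: "E \<union> S ` E \<subseteq> ?A" unfolding subalg_hull_span by (rule hull_subset)
  have "subalg {x. S x \<in> ?A}"
    using subspace_lin_vimage[OF S_lin subalgD(1)[OF subalg_hull]] subalgD(2,3)[OF subalg_hull]
    by (simp add: subalg_def S_one S_mul)
  moreover have "E \<union> S ` E \<subseteq> {x. S x \<in> ?A}"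
  proof
    fix x assume "x \<in> E \<union> S ` E"
    then consider "x \<in> E" | y where "y \<in> E" "x = S y" by blast
    then have "S x \<in> E \<union> S ` E"
    proof cases
      case 2
      then have "S x = y" using antipode_involutive[OF B inv] E(4) by auto
      then show ?thesis using 2 by simp
    qed simp
    then show "x \<in> {x. S x \<in> ?A}" using EA by blast
  qed
  ultimately have "S ` ?A \<subseteq> ?A"
    unfolding subalg_hull_span using hull_minimal[of "E \<union> S ` E"] by blast
  then have A: "hopf_sub ?A" by (simp add: hopf_sub_def subalg_hull subcoal_hull[OF coalE])
  have "{x \<in> ?B. \<epsilon> x = 0} \<subseteq> prod_span ?B {a \<in> ?A. \<epsilon> a = 0}"
  proof
    fix x assume x: "x \<in> {x \<in> ?B. \<epsilon> x = 0}"
    have "X \<subseteq> {a \<in> ?A. \<epsilon> a = 0}" using X(2) E(3) EA by blast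
    then have 1: "x \<in> prod_span UNIV {a \<in> ?A. \<epsilon> a = 0}"
      using x X(3) prod_span_mono[OF order_refl] by blast
    have "{a \<in> ?A. \<epsilon> a = 0} \<subseteq> ?B" "x \<in> wedge ?B 0" using x AB by auto
    from prod_span_wedge[OF B corad_subset_hopf_corad this 1]
    show "x \<in> prod_span ?B {a \<in> ?A. \<epsilon> a = 0}" by simp
  qed
  from max[OF A AB this] have "?A = ?B" .
  moreover have "?A = subalg hull (F \<union> S ` F)"
    unfolding subalg_hull_span
  proof (rule subalg_hull_cong)
    let ?H = "subalg hull (F \<union> S ` F)"
    note sub = subalgD(1)[OF subalg_hull]
    have F_sub: "F \<subseteq> ?H" "S ` F \<subseteq> ?H" using hull_subset[of "F \<union> S ` F" subalg] by auto
    have "E \<subseteq> ?H" unfolding F(2) by (rule span_minimal[OF F_sub(1) sub])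
    moreover have "E \<subseteq> {x. S x \<in> ?H}"
      unfolding F(2) by (rule span_minimal[OF _ subspace_lin_vimage[OF S_lin sub]]) (use F_sub in auto)
    ultimately show "E \<union> S ` E \<subseteq> ?H" by blast
    show "F \<union> S ` F \<subseteq> subalg hull (E \<union> S ` E)"
      using hull_subset[of "E \<union> S ` E" subalg] span_superset[of F] F(2) by blast
  qed
  ultimately show ?thesis using F(1) by (intro that[of "F \<union> S ` F"]) auto
qed

lemma affine_if_corad_cocommutative:
  assumes "cocommutative corad"
  shows "\<exists>T. finite T \<and> subalg hull T = UNIV"
proof -
  have "cocommutative (S ` corad)"
    unfolding cocommutative_def
  proof (intro ballI allI impI)
    fix x G assume "x \<in> S ` corad" and G: "bilin G"
    then obtain c where c: "c \<in> corad" "x = S c" by blast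
    have flip: "bilin (\<lambda>a b. G b a)" using G by (auto simp: bilin_def)
    have "bilin (\<lambda>a b. G (S b) (S a))"
      by (intro bilinI lin_comp[OF bilinD(1)[OF G] S_lin] lin_comp[OF bilinD(2)[OF G] S_lin])
    from cocommutativeD[OF assms c(1) this]
    show "(\<Sum>(a, b)\<leftarrow>\<Delta> x. G a b) = (\<Sum>(a, b)\<leftarrow>\<Delta> x. G b a)"
      unfolding c(2) S_cop[OF G] S_cop[OF flip] .
  qed
  then have coc: "cocommutative hopf_corad"
    using assms unfolding hopf_corad_def by (intro cocommutative_subalg_hull) (auto simp: cocommutative_def)
  have inv: "(\<Sum>(y, z)\<leftarrow>\<Delta> r. S z \<odot> y) = \<epsilon> r \<star> \<one>" if "r \<in> hopf_corad" for r
    using cocommutativeD[OF coc that, of "\<lambda>y z. S y \<odot> z"] antipode_left[of r]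
    by (simp add: bilinI lin_intros)
  obtain T where "finite T" "hopf_corad = subalg hull T"
  proof (rule hopf_corad_affine[OF inv])
    fix A assume A: "hopf_sub A" "A \<subseteq> hopf_corad"
      "{x \<in> hopf_corad. \<epsilon> x = 0} \<subseteq> prod_span hopf_corad {a \<in> A. \<epsilon> a = 0}"
    have "corad \<subseteq> A"
      unfolding corad_def
    proof (intro span_minimal hopf_subD(3)[OF A(1)] Union_least)
      fix C assume C: "C \<in> {C. simple_subcoal C}"
      then have "C \<subseteq> hopf_corad" using simple_subset_corad corad_subset_hopf_corad by blast
      then show "C \<subseteq> A"
        using cocommutative_simple_subset[OF A(1) hopf_sub_hopf_corad A(2) coc A(3)] C by blast
    qed
    then have "hopf_corad \<subseteq> A"
      unfolding hopf_corad_def using hopf_subD(1,5)[OF A(1)] by (intro hull_minimal) auto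
    then show "A = hopf_corad" using A(2) by blast
  qed blast
  then show ?thesis by (rule affine_if_hopf_corad_affine)
qed

lemma affine_if_commutative:
  assumes "\<And>x y. x \<in> corad \<Longrightarrow> y \<in> corad \<Longrightarrow> x \<odot> y = y \<odot> x"
  shows "\<exists>T. finite T \<and> subalg hull T = UNIV"
proof -
  \<comment> \<open>Both products come from S(c1) y c2 S(c3), in which \<open>y\<close> may be moved
    past c2.\<close>
  have S_comm: "y \<odot> S c = S c \<odot> y" if y: "y \<in> corad" and c: "c \<in> corad" for y c
  proof -
    have "S c \<odot> y = (\<Sum>(e, d)\<leftarrow>\<Delta> c. \<epsilon> d \<star> (S e \<odot> y))"
      by (rule contract_counit(2)[symmetric]) (intro lin_intros)
    also have "\<dots> = (\<Sum>(e, d)\<leftarrow>\<Delta> c. \<epsilon> d \<star> (S e \<odot> y \<odot> \<one>))" by (simp add: mul_one)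
    also have "\<dots> = (\<Sum>(a, d)\<leftarrow>\<Delta> c. \<Sum>(u, v)\<leftarrow>\<Delta> d. S a \<odot> y \<odot> (u \<odot> S v))"
      by (intro sum_list_pairs_cong contract_antipode(2)[symmetric]) (intro lin_intros)
    also have "\<dots> = (\<Sum>(a, d)\<leftarrow>\<Delta> c. \<Sum>(u, v)\<leftarrow>\<Delta> d. S a \<odot> u \<odot> (y \<odot> S v))"
    proof (rule cop_cong[OF subcoal_corad c])
      fix a d assume d: "d \<in> corad"
      show "(\<Sum>(u, v)\<leftarrow>\<Delta> d. S a \<odot> y \<odot> (u \<odot> S v)) = (\<Sum>(u, v)\<leftarrow>\<Delta> d. S a \<odot> u \<odot> (y \<odot> S v))"
      proof (rule cop_cong[OF subcoal_corad d])
        fix u v assume "u \<in> corad"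
        then have "y \<odot> u = u \<odot> y" using assms y by blast
        then show "S a \<odot> y \<odot> (u \<odot> S v) = S a \<odot> u \<odot> (y \<odot> S v)" by (metis mul_assoc)
      qed (intro lin_intros)+
    qed (intro lin_intros)+
    also have "\<dots> = (\<Sum>(e, v)\<leftarrow>\<Delta> c. \<Sum>(a, u)\<leftarrow>\<Delta> e. S a \<odot> u \<odot> (y \<odot> S v))"
      by (rule cop_coassoc[symmetric]) (intro lin_intros)
    also have "\<dots> = (\<Sum>(e, v)\<leftarrow>\<Delta> c. \<epsilon> e \<star> (\<one> \<odot> (y \<odot> S v)))"
      by (intro sum_list_pairs_cong contract_antipode(1)) (intro lin_intros)
    also have "\<dots> = \<one> \<odot> (y \<odot> S c)"
      by (rule contract_counit(1)) (intro lin_intros)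
    finally show ?thesis by (simp add: one_mul)
  qed
  have SS_comm: "S x \<odot> S y = S y \<odot> S x" if "x \<in> corad" "y \<in> corad" for x y
    using assms[OF that] S_mul by metis
  have comm: "x \<odot> y = y \<odot> x" if "x \<in> hopf_corad" "y \<in> hopf_corad" for x y
    using that unfolding hopf_corad_def
    by (rule subalg_hull_commutes[rotated 1]) (use assms S_comm SS_comm in auto)
  have inv: "(\<Sum>(y, z)\<leftarrow>\<Delta> r. S z \<odot> y) = \<epsilon> r \<star> \<one>" if r: "r \<in> hopf_corad" for r
  proof -
    have "(\<Sum>(y, z)\<leftarrow>\<Delta> r. S z \<odot> y) = (\<Sum>(y, z)\<leftarrow>\<Delta> r. y \<odot> S z)"
      by (rule cop_cong[OF hopf_subD(2)[OF hopf_sub_hopf_corad] r], intro lin_intros, intro lin_intros)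
        (simp add: comm hopf_subD(5)[OF hopf_sub_hopf_corad])
    then show ?thesis by (simp add: antipode_right)
  qed
  obtain T where "finite T" "hopf_corad = subalg hull T"
    by (rule hopf_corad_affine[OF inv])
      (use commutative_hopf_sub_eq[OF _ hopf_sub_hopf_corad _ comm] in blast)+
  then show ?thesis by (rule affine_if_hopf_corad_affine)
qed

lemma affine_if_corad_findim:
  assumes "finite B" "corad = span B"
  shows "\<exists>T. finite T \<and> subalg hull T = UNIV"
proof (rule affine_if_hopf_corad_affine)
  show "finite (B \<union> S ` B)" using assms(1) by simp
  show "hopf_corad = subalg hull (B \<union> S ` B)"
    unfolding hopf_corad_def
  proof (rule subalg_hull_cong)
    let ?H = "subalg hull (B \<union> S ` B)"
    note sub = subalgD(1)[OF subalg_hull]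
    have B_sub: "B \<subseteq> ?H" "S ` B \<subseteq> ?H" using hull_subset[of "B \<union> S ` B" subalg] by auto
    have "corad \<subseteq> ?H" unfolding assms(2) by (rule span_minimal[OF B_sub(1) sub])
    moreover have "corad \<subseteq> {x. S x \<in> ?H}"
      unfolding assms(2) by (rule span_minimal[OF _ subspace_lin_vimage[OF S_lin sub]]) (use B_sub in auto)
    ultimately show "corad \<union> S ` corad \<subseteq> ?H" by blast
    show "B \<union> S ` B \<subseteq> subalg hull (corad \<union> S ` corad)"
      using hull_subset[of "corad \<union> S ` corad" subalg] span_superset[of B] assms(2) by blast
  qed
qed

end

text \<open>Reversing both the multiplication and the comultiplication keeps the antipode, so right
  Noetherian Hopf algebras are covered by the left Noetherian case.\<close>

lemma opposite: "sweedler_hopf scale (\<lambda>x y. y \<odot> x) \<one> (\<lambda>x. map prod.swap (\<Delta> x)) \<epsilon> S"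
proof -
  have swap: "(\<Sum>(a, b)\<leftarrow>map prod.swap l. G a b) = (\<Sum>(a, b)\<leftarrow>l. G b a)" for G :: "'h \<Rightarrow> 'h \<Rightarrow> 'h" and l
    by (simp add: comp_def split_def)
  have flip: "bilin (\<lambda>a b. G b a)" if "bilin G" for G using that by (auto simp: bilin_def)
  have flip3: "trilin (\<lambda>a b c. T c b a)" if "trilin T" for T using that by (auto simp: trilin_def)
  show ?thesis
  proof (intro sweedler_hopf.intro sweedler_hopf_axioms.intro linear_space_axioms, unfold swap)
    show "bilin (\<lambda>x y. y \<odot> x)" by (rule flip[OF mul_bilin])
    show "lin (\<lambda>x. \<Sum>(a, b)\<leftarrow>\<Delta> x. G b a)" if "bilin G" for G by (rule cop_lin[OF flip[OF that]])
    show "(\<Sum>(b, a)\<leftarrow>\<Delta> \<one>. G a b) = G \<one> \<one>" if "bilin G" for G by (rule cop_one[OF flip[OF that]])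
    show "(\<Sum>(c, e)\<leftarrow>\<Delta> x. \<Sum>(b, a)\<leftarrow>\<Delta> e. T a b c) = (\<Sum>(e, a)\<leftarrow>\<Delta> x. \<Sum>(c, b)\<leftarrow>\<Delta> e. T a b c)"
      if "trilin T" for T x
      by (rule cop_coassoc[OF flip3[OF that], symmetric])
    show "(\<Sum>(b, a)\<leftarrow>\<Delta> (y \<odot> x). G a b) = (\<Sum>(b, a)\<leftarrow>\<Delta> x. \<Sum>(d, c)\<leftarrow>\<Delta> y. G (c \<odot> a) (d \<odot> b))"
      if "bilin G" for G x y
      unfolding cop_mul[OF flip[OF that]] by (rule sum_list_pairs_swap)
  qed (simp_all add: mul_assoc one_mul mul_one cop_counit_left cop_counit_right
      eps_lform eps_mul eps_one S_lin antipode_left antipode_right mult.commute)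
qed

section \<open>Transfer to right ideals\<close>

definition rideal :: "'h set \<Rightarrow> bool" where
  "rideal I \<longleftrightarrow> 0 \<in> I \<and> (\<forall>x\<in>I. \<forall>y\<in>I. x + y \<in> I) \<and> (\<forall>r. \<forall>x\<in>I. x \<odot> r \<in> I)"

lemma affine_if_left_noetherian:
  assumes "\<And>I :: nat \<Rightarrow> 'h set. (\<And>n. lideal (I n)) \<Longrightarrow> mono I \<Longrightarrow> \<exists>m. \<forall>n\<ge>m. I n = I m"
    and "cocommutative corad \<or> (\<forall>x\<in>corad. \<forall>y\<in>corad. x \<odot> y = y \<odot> x) \<or> (\<exists>B. finite B \<and> corad = span B)"
  shows "\<exists>T. finite T \<and> subalg hull T = UNIV"
  using assms(2) affine_if_corad_cocommutative[OF assms(1)] affine_if_commutative[OF assms(1)]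
    affine_if_corad_findim[OF assms(1)] by blast

lemma affine_if_right_noetherian:
  assumes "\<And>I :: nat \<Rightarrow> 'h set. (\<And>n. rideal (I n)) \<Longrightarrow> mono I \<Longrightarrow> \<exists>m. \<forall>n\<ge>m. I n = I m"
    and "cocommutative corad \<or> (\<forall>x\<in>corad. \<forall>y\<in>corad. x \<odot> y = y \<odot> x) \<or> (\<exists>B. finite B \<and> corad = span B)"
  shows "\<exists>T. finite T \<and> subalg hull T = UNIV"
proof -
  interpret op: sweedler_hopf scale "\<lambda>x y. y \<odot> x" "\<one>" "\<lambda>x. map prod.swap (\<Delta> x)" \<epsilon> S
    by (rule opposite)
  have swap: "(\<Sum>(a, b)\<leftarrow>map prod.swap l. G a b) = (\<Sum>(a, b)\<leftarrow>l. G b a)" for G :: "'h \<Rightarrow> 'h \<Rightarrow> 'h" and l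
    by (simp add: comp_def split_def)
  \<comment> \<open>The opposite structure exchanges the two contractions, and subcoalgebras are
    defined symmetrically in them, so the coradical is unchanged.\<close>
  have "op.lhit = rhit" "op.rhit = lhit"
    unfolding op.lhit_def[abs_def] op.rhit_def[abs_def] lhit_def[abs_def] rhit_def[abs_def] swap by auto
  then have coal: "op.subcoal = subcoal"
    by (intro ext) (auto simp: op.subcoal_def subcoal_def)
  have corad: "op.corad = corad"
    unfolding op.corad_def corad_def op.simple_subcoal_def[abs_def] simple_subcoal_def[abs_def] coal ..
  have coc: "op.cocommutative corad = cocommutative corad"
    unfolding op.cocommutative_def cocommutative_def swap by (auto dest: sym)
  have alg: "op.subalg = subalg"
    by (intro ext) (auto simp: op.subalg_def subalg_def)
  have "op.lideal = rideal"
    by (intro ext) (simp add: op.lideal_def rideal_def)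
  then show ?thesis
    using op.affine_if_left_noetherian assms unfolding corad coc alg by metis
qed

end

section \<open>Coset-valued comultiplications\<close>

lemma lin_ext_superset:
  assumes "vector_space s" "finite A" "Poly_Mapping.keys u \<subseteq> A"
  shows "lin_ext s f u = (\<Sum>x\<in>A. s (Poly_Mapping.lookup u x) (f x))"
proof -
  interpret vector_space s by fact
  show ?thesis unfolding lin_ext_def
    by (rule sum.mono_neutral_left) (use assms in \<open>auto simp: in_keys_iff\<close>)
qed

lemma lin_ext_linear:
  assumes "vector_space s"
  shows "Vector_Spaces.linear free_scale s (lin_ext s f)"
proof -
  interpret vector_space s by fact
  have "lin_ext s f (u + v) = lin_ext s f u + lin_ext s f v" for u v
  proof -
    let ?A = "Poly_Mapping.keys u \<union> Poly_Mapping.keys v"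
    have "Poly_Mapping.keys (u + v) \<subseteq> ?A" by (rule keys_add)
    then show ?thesis
      using lin_ext_superset[OF assms, of ?A]
      by (simp add: lookup_add scale_left_distrib sum.distrib)
  qed
  moreover have "lin_ext s f (free_scale c u) = s c (lin_ext s f u)" for c u
  proof -
    have "Poly_Mapping.keys (free_scale c u) \<subseteq> Poly_Mapping.keys u"
      by (auto simp: in_keys_iff lookup_free_scale)
    then show ?thesis
      using lin_ext_superset[OF assms, of "Poly_Mapping.keys u"]
      by (simp add: lookup_free_scale scale_sum_right)
  qed
  ultimately show ?thesis
    unfolding Vector_Spaces.linear_iff using assms vector_space_free_scale by auto
qed

lemma lin_ext_add: "vector_space s \<Longrightarrow> lin_ext s f (u + v) = lin_ext s f u + lin_ext s f v"
  and lin_ext_free_scale: "vector_space s \<Longrightarrow> lin_ext s f (free_scale c u) = s c (lin_ext s f u)"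
  using lin_ext_linear unfolding Vector_Spaces.linear_iff by blast+

lemma lin_ext_diff: "vector_space s \<Longrightarrow> lin_ext s f (u - v) = lin_ext s f u - lin_ext s f v"
  using lin_ext_add[of s f "u - v" v] by simp

lemma lin_ext_single: "vector_space s \<Longrightarrow> lin_ext s f (Poly_Mapping.single x c) = s c (f x)"
  using lin_ext_superset[of s "{x}"] by (simp add: lookup_single)

lemma lin_ext_0: "lin_ext s f 0 = 0"
  by (simp add: lin_ext_def)

lemma lin_ext_sum: "vector_space s \<Longrightarrow> lin_ext s f (sum g I) = (\<Sum>i\<in>I. lin_ext s f (g i))"
  by (induction I rule: infinite_finite_induct) (simp_all add: lin_ext_add lin_ext_0)

lemma lin_ext_lin_ext:
  assumes "vector_space s"
  shows "lin_ext s f (lin_ext free_scale g u) = lin_ext s (\<lambda>x. lin_ext s f (g x)) u"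
proof -
  have "lin_ext s f (lin_ext free_scale g u)
    = lin_ext s f (\<Sum>x\<in>Poly_Mapping.keys u. free_scale (Poly_Mapping.lookup u x) (g x))"
    by (simp only: lin_ext_def[of free_scale])
  also have "\<dots> = (\<Sum>x\<in>Poly_Mapping.keys u. s (Poly_Mapping.lookup u x) (lin_ext s f (g x)))"
    by (simp only: lin_ext_sum[OF assms] lin_ext_free_scale[OF assms])
  also have "\<dots> = lin_ext s (\<lambda>x. lin_ext s f (g x)) u"
    by (simp only: lin_ext_def[of s "\<lambda>x. lin_ext s f (g x)"])
  finally show ?thesis .
qed

text \<open>The universal property of the tensor power: a map linear in each slot sends every
  generator of the relation space to 0.\<close>

lemma lin_ext_slot_relations:
  fixes s :: "'k::field \<Rightarrow> 'h::ab_group_add \<Rightarrow> 'h" and t :: "'k \<Rightarrow> 'v::ab_group_add \<Rightarrow> 'v"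
    and u :: "'x \<Rightarrow>\<^sub>0 'k"
  assumes s: "vector_space s" and t: "vector_space t"
    and f: "\<And>\<sigma>. \<sigma> \<in> \<Sigma> \<Longrightarrow> Vector_Spaces.linear s t (\<lambda>x. f (\<sigma> x))"
    and u: "u \<in> slot_relations s \<Sigma>"
  shows "lin_ext t f u = 0"
proof -
  interpret t: vector_space t by (rule t)
  interpret free: linear_space "free_scale :: 'k \<Rightarrow> ('x \<Rightarrow>\<^sub>0 'k) \<Rightarrow> _"
    by (rule linear_space.intro[OF vector_space_free_scale])
  have f': "f (\<sigma> (a + b)) = f (\<sigma> a) + f (\<sigma> b)" "f (\<sigma> (s c a)) = t c (f (\<sigma> a))" if "\<sigma> \<in> \<Sigma>" for \<sigma> a b c
    using f[OF that] unfolding Vector_Spaces.linear_iff by auto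
  have "free.subspace {u. lin_ext t f u = 0}"
    by (rule free.subspaceI) (auto simp: lin_ext_add[OF t] lin_ext_free_scale[OF t] lin_ext_0)
  then have "slot_relations s \<Sigma> \<subseteq> {u. lin_ext t f u = 0}"
    unfolding slot_relations_def
    by (rule free.span_minimal[rotated])
      (auto simp: lin_ext_diff[OF t] lin_ext_single[OF t] lin_ext_free_scale[OF t] f')
  then show ?thesis using u by blast
qed

section \<open>Evaluating multilinear maps on cosets\<close>

context linear_space
begin

lemma lin_ext_class2:
  assumes "bilin G" "u - v \<in> slot_relations scale slots2"
  shows "lin_ext scale (\<lambda>(a, b). G a b) u = lin_ext scale (\<lambda>(a, b). G a b) v"
proof -
  have "lin_ext scale (\<lambda>(a, b). G a b) (u - v) = 0"
    by (rule lin_ext_slot_relations[OF vector_space_axioms vector_space_axioms _ assms(2)])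
      (use assms(1) in \<open>auto simp: slots2_def bilin_def\<close>)
  then show ?thesis by (simp add: lin_ext_diff[OF vector_space_axioms])
qed

lemma lin_ext_class3:
  assumes "trilin T" "u - v \<in> slot_relations scale slots3"
  shows "lin_ext scale (\<lambda>(a, b, c). T a b c) u = lin_ext scale (\<lambda>(a, b, c). T a b c) v"
proof -
  have "lin_ext scale (\<lambda>(a, b, c). T a b c) (u - v) = 0"
    by (rule lin_ext_slot_relations[OF vector_space_axioms vector_space_axioms _ assms(2)])
      (use assms(1) in \<open>auto simp: slots3_def trilin_def\<close>)
  then show ?thesis by (simp add: lin_ext_diff[OF vector_space_axioms])
qed

lemma slot_relations_0: "0 \<in> slot_relations scale (\<Sigma> :: ('h \<Rightarrow> 'x) set)"
proof -
  interpret free: linear_space "free_scale :: 'k \<Rightarrow> ('x \<Rightarrow>\<^sub>0 'k) \<Rightarrow> _"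
    by (rule linear_space.intro[OF vector_space_free_scale])
  show ?thesis unfolding slot_relations_def by (rule free.span_zero)
qed

lemma coset_rep_class2: "coset_rep (tensor_class2 scale u) - u \<in> slot_relations scale slots2"
proof -
  have "u \<in> tensor_class2 scale u" using slot_relations_0 by (simp add: tensor_class2_def)
  then have "coset_rep (tensor_class2 scale u) \<in> tensor_class2 scale u"
    unfolding coset_rep_def by (rule someI)
  then show ?thesis by (simp add: tensor_class2_def)
qed

abbreviation tensor_eval :: "('h \<Rightarrow> 'h \<Rightarrow> 'h) \<Rightarrow> ('h \<times> 'h \<Rightarrow>\<^sub>0 'k) set \<Rightarrow> 'h" where
  "tensor_eval G X \<equiv> lin_ext scale (\<lambda>(a, b). G a b) (coset_rep X)"

lemma tensor_eval_class2:
  "bilin G \<Longrightarrow> tensor_eval G (tensor_class2 scale u) = lin_ext scale (\<lambda>(a, b). G a b) u"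
  by (rule lin_ext_class2[OF _ coset_rep_class2])

end

text \<open>Coefficients are absorbed into the first entries, so that a formal combination becomes a
  plain list of pure tensors.\<close>

definition pair_list :: "('k::field \<Rightarrow> 'h \<Rightarrow> 'h) \<Rightarrow> ('h \<times> 'h \<Rightarrow>\<^sub>0 'k) \<Rightarrow> ('h \<times> 'h) list" where
  "pair_list s u = map (\<lambda>(a, b). (s (Poly_Mapping.lookup u (a, b)) a, b))
     (SOME l. set l = Poly_Mapping.keys u \<and> distinct l)"

lemma (in linear_space) sum_pair_list:
  assumes G: "bilin G"
  shows "(\<Sum>(a, b)\<leftarrow>pair_list scale u. G a b) = lin_ext scale (\<lambda>(a, b). G a b) u"
proof -
  have "\<exists>l. set l = Poly_Mapping.keys u \<and> distinct l" by (rule finite_distinct_list) simp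
  then obtain l where l: "set l = Poly_Mapping.keys u" "distinct l"
    and eq: "pair_list scale u = map (\<lambda>(a, b). (scale (Poly_Mapping.lookup u (a, b)) a, b)) l"
    unfolding pair_list_def by (metis (mono_tags, lifting) someI_ex)
  have "(\<Sum>(a, b)\<leftarrow>pair_list scale u. G a b)
    = (\<Sum>x\<leftarrow>l. scale (Poly_Mapping.lookup u x) (case x of (a, b) \<Rightarrow> G a b))"
    by (simp add: eq comp_def split_def lin_scale[OF bilinD(1)[OF G]])
  also have "\<dots> = lin_ext scale (\<lambda>(a, b). G a b) u"
    unfolding lin_ext_def l(1)[symmetric] using l(2) by (rule sum_list_distinct_conv_sum_set)
  finally show ?thesis .
qed

sublocale hopf_algebra \<subseteq> linear_space scale ..

section \<open>The Sweedler form of the given Hopf algebra\<close>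

context hopf_algebra
begin

definition cop :: "'h \<Rightarrow> ('h \<times> 'h) list" where
  "cop x = pair_list scale (coset_rep (comult x))"

lemma sum_cop: "bilin G \<Longrightarrow> (\<Sum>(a, b)\<leftarrow>cop x. G a b) = tensor_eval G (comult x)"
  unfolding cop_def by (rule sum_pair_list)

lemma tensor_eval_linear:
  assumes G: "bilin G"
  shows "lin (\<lambda>x. tensor_eval G (comult x))"
  unfolding lin_iff comult_add comult_scale tensor_add_def tensor_scale_def tensor_eval_class2[OF G]
  by (simp add: lin_ext_add[OF vector_space_axioms] lin_ext_free_scale[OF vector_space_axioms])

lemma counit_lform: "lform counit"
  using counit_linear .

lemma mult_lin: "lin (\<lambda>x. x * c)" "lin (\<lambda>x. c * x)" "lin ((*) c)"
  by (auto simp: lin_iff distrib_left distrib_right scale_mult_left scale_mult_right)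

text \<open>Representatives of equal cosets differ by relations, which trilinear maps cannot
  see.\<close>

lemma coassoc_eval:
  assumes T: "trilin T"
  shows "tensor_eval (\<lambda>e c. tensor_eval (\<lambda>a b. T a b c) (comult e)) (comult x)
    = tensor_eval (\<lambda>a e. tensor_eval (\<lambda>b c. T a b c) (comult e)) (comult x)"
proof -
  let ?L = "lin_ext free_scale (\<lambda>(a, b).
    lin_ext free_scale (\<lambda>(p, q). Poly_Mapping.single (p, q, b) 1) (coset_rep (comult a))) (coset_rep (comult x))"
  let ?R = "lin_ext free_scale (\<lambda>(a, b).
    lin_ext free_scale (\<lambda>(p, q). Poly_Mapping.single (a, p, q) 1) (coset_rep (comult b))) (coset_rep (comult x))"
  have "tensor_class3 scale ?L = tensor_class3 scale ?R"
    using coassoc[of x] unfolding tensor_left_def tensor_right_def .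
  moreover have "?L \<in> tensor_class3 scale ?L"
    using slot_relations_0 by (simp add: tensor_class3_def)
  ultimately have "?L - ?R \<in> slot_relations scale slots3" by (simp add: tensor_class3_def)
  from lin_ext_class3[OF T this] show ?thesis
    by (simp add: lin_ext_lin_ext[OF vector_space_axioms] split_def lin_ext_single[OF vector_space_axioms])
qed

lemma mult_eval:
  assumes G: "bilin G"
  shows "tensor_eval G (comult (x * y))
    = tensor_eval (\<lambda>a b. tensor_eval (\<lambda>c d. G (a * c) (b * d)) (comult y)) (comult x)"
  unfolding comult_mult tensor_mult_def tensor_eval_class2[OF G]
  by (simp add: lin_ext_lin_ext[OF vector_space_axioms] split_def lin_ext_single[OF vector_space_axioms])

lemma sweedler: "sweedler_hopf scale (*) 1 cop counit antipode"
proof (intro sweedler_hopf.intro sweedler_hopf_axioms.intro linear_space_axioms)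
  have c: "lin (\<lambda>x. f x * c)" "lin (\<lambda>x. c * f x)" if "lin f" for f c
    using lin_comp[OF mult_lin(1) that] lin_comp[OF mult_lin(2) that] .
  show "bilin (*)" by (intro bilinI mult_lin)
  show "lin (\<lambda>x. \<Sum>(a, b)\<leftarrow>cop x. G a b)" if "bilin G" for G
    unfolding sum_cop[OF that] by (rule tensor_eval_linear[OF that])
  then have lin_cop: "lin (\<lambda>x. \<Sum>(a, b)\<leftarrow>cop x. G a b)" if "bilin G" for G using that .
  show "(\<Sum>(e, c)\<leftarrow>cop x. \<Sum>(a, b)\<leftarrow>cop e. T a b c) = (\<Sum>(a, e)\<leftarrow>cop x. \<Sum>(b, c)\<leftarrow>cop e. T a b c)"
    if T: "trilin T" for T x
  proof -
    have T12: "bilin (\<lambda>a b. T a b c)" and T23: "bilin (\<lambda>b c. T a b c)" for a c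
      using T by (auto simp: trilin_def bilin_def)
    have 1: "bilin (\<lambda>e c. \<Sum>(a, b)\<leftarrow>cop e. T a b c)" "bilin (\<lambda>a e. \<Sum>(b, c)\<leftarrow>cop e. T a b c)"
      using T by (auto intro!: bilinI lin_cop T12 T23 lin_param simp: trilin_def)
    show ?thesis
      using coassoc_eval[OF T, of x] by (simp only: sum_cop[OF 1(1)] sum_cop[OF 1(2)]) (simp only: sum_cop[OF T12] sum_cop[OF T23])
  qed
  show "(\<Sum>(a, b)\<leftarrow>cop x. scale (counit a) b) = x" for x
    using counit_left[of x] unfolding tensor_lift_def
    by (subst sum_cop) (intro bilinI lin_coeff counit_lform lin_scaled lin_ident)
  show "(\<Sum>(a, b)\<leftarrow>cop x. scale (counit b) a) = x" for x
    using counit_right[of x] unfolding tensor_lift_def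
    by (subst sum_cop) (intro bilinI lin_coeff counit_lform lin_scaled lin_ident)
  show "(\<Sum>(a, b)\<leftarrow>cop (x * y). G a b) = (\<Sum>(a, b)\<leftarrow>cop x. \<Sum>(c, d)\<leftarrow>cop y. G (a * c) (b * d))"
    if G: "bilin G" for G x y
  proof -
    have G1: "lin (\<lambda>x. G (f x) c)" if "lin f" for f c using lin_comp[OF bilinD(1)[OF G] that] .
    have G2: "lin (\<lambda>x. G c (f x))" if "lin f" for f c using lin_comp[OF bilinD(2)[OF G] that] .
    have 1: "bilin (\<lambda>c d. G (a * c) (b * d))" for a b by (intro bilinI G1 G2 mult_lin)
    have 2: "bilin (\<lambda>a b. \<Sum>(c, d)\<leftarrow>cop y. G (a * c) (b * d))"
      by (intro bilinI lin_param G1 G2 mult_lin)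
    show ?thesis
      unfolding sum_cop[OF 2] unfolding sum_cop[OF 1] sum_cop[OF G] by (rule mult_eval[OF G])
  qed
  show "(\<Sum>(a, b)\<leftarrow>cop 1. G a b) = G 1 1" if G: "bilin G" for G
    unfolding sum_cop[OF G] comult_one tensor_eval_class2[OF G] by (simp add: lin_ext_single[OF vector_space_axioms])
  show "lform counit" by (rule counit_lform)
  show "lin antipode" by (rule antipode_linear)
  show "(\<Sum>(a, b)\<leftarrow>cop x. antipode a * b) = scale (counit x) 1" for x
    using antipode_left[of x] unfolding tensor_lift_def
    by (subst sum_cop) (intro bilinI c antipode_linear mult_lin)
  show "(\<Sum>(a, b)\<leftarrow>cop x. a * antipode b) = scale (counit x) 1" for x
    using antipode_right[of x] unfolding tensor_lift_def
    by (subst sum_cop) (intro bilinI c antipode_linear mult_lin)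
qed (simp_all add: mult.assoc counit_mult counit_one)

end

sublocale hopf_algebra \<subseteq> sw: sweedler_hopf scale "(*)" 1 cop counit antipode
  by (rule sweedler)

section \<open>Comparison with the definitions by cosets\<close>

context hopf_algebra
begin

text \<open>For the passage from contractions to tensors, both legs of a representative
  \<open>u\<close> are projected to \<open>C\<close>, giving \<open>v\<close>. A form separating
  \<open>u - v\<close> from the relations would be a bilinear form, on which
  \<open>cop_restrict\<close> forces equal values at \<open>u\<close> and \<open>v\<close>.\<close>

lemma subcoalgebra_iff: "subcoalgebra C \<longleftrightarrow> sw.subcoal C"
proof
  interpret free: linear_space "free_scale :: 'k \<Rightarrow> ('h \<times> 'h \<Rightarrow>\<^sub>0 'k) \<Rightarrow> _"
    by (rule linear_space.intro[OF vector_space_free_scale])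
  {
    assume C: "subcoalgebra C"
    then have sub: "subspace C" by (simp add: subcoalgebra_def)
    have mem: "(\<Sum>(a, b)\<leftarrow>cop x. G a b) \<in> C"
      if x: "x \<in> C" and G: "bilin G" "\<And>a b. a \<in> C \<Longrightarrow> b \<in> C \<Longrightarrow> G a b \<in> C" for x G
    proof -
      let ?g = "lin_ext scale (\<lambda>(a, b). G a b)"
      obtain v where v: "comult x = tensor_class2 scale v"
        "v \<in> free.span ((\<lambda>x. Poly_Mapping.single x 1) ` (C \<times> C))"
        using C x unfolding subcoalgebra_def sub_tensor_square_def by blast
      have "free.subspace {v. ?g v \<in> C}"
        by (rule free.subspaceI)
          (auto simp: lin_ext_add[OF vector_space_axioms] lin_ext_free_scale[OF vector_space_axioms] subspace_add[OF sub] subspace_scale[OF sub]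
            lin_ext_0 subspace_0[OF sub])
      then have "free.span ((\<lambda>x. Poly_Mapping.single x 1) ` (C \<times> C)) \<subseteq> {v. ?g v \<in> C}"
        by (rule free.span_minimal[rotated]) (auto simp: lin_ext_single[OF vector_space_axioms] G(2))
      then show ?thesis using v by (auto simp: sum_cop[OF G(1)] tensor_eval_class2[OF G(1)])
    qed
    show "sw.subcoal C"
      unfolding sw.subcoal_def sw.lhit_def sw.rhit_def
    proof (intro conjI sub allI impI image_subsetI)
      fix \<phi> x assume \<phi>: "lform \<phi>" and x: "x \<in> C"
      show "(\<Sum>(a, b)\<leftarrow>cop x. scale (\<phi> b) a) \<in> C"
        by (rule mem[OF x]) (intro sw.lin_intros \<phi>, rule subspace_scale[OF sub])
      show "(\<Sum>(a, b)\<leftarrow>cop x. scale (\<phi> a) b) \<in> C"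
        by (rule mem[OF x]) (intro sw.lin_intros \<phi>, rule subspace_scale[OF sub])
    qed
  }
  assume C: "sw.subcoal C"
  let ?R = "slot_relations scale slots2 :: ('h \<times> 'h \<Rightarrow>\<^sub>0 'k) set"
  let ?p = "proj C"
  let ?sq = "\<lambda>(a, b). Poly_Mapping.single (?p a, ?p b) 1"
  note sub = sw.subcoalD(1)[OF C]
  have subR: "free.subspace ?R" unfolding slot_relations_def by (rule free.subspace_span)
  have "comult x \<in> sub_tensor_square scale C" if x: "x \<in> C" for x
  proof -
    define u where "u = coset_rep (comult x)"
    define v where "v = lin_ext free_scale ?sq u"
    have "u - v \<in> ?R"
    proof (rule ccontr)
      assume "u - v \<notin> ?R"
      then obtain \<theta> where \<theta>: "free.lform \<theta>" "\<And>w. w \<in> ?R \<Longrightarrow> \<theta> w = 0" "\<theta> (u - v) = 1"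
        using free.lform_separate[OF subR] by metis
      \<comment> \<open>A bilinear form becomes a bilinear map into \<open>H\<close> by multiplying
        with the unit, and the counit recovers its values because it is 1 at the unit.\<close>
      let ?G = "\<lambda>a b. scale (\<theta> (Poly_Mapping.single (a, b) 1)) 1"
      have rel: "\<theta> (Poly_Mapping.single (\<sigma> (a + b)) 1)
          = \<theta> (Poly_Mapping.single (\<sigma> a) 1) + \<theta> (Poly_Mapping.single (\<sigma> b) 1)"
        "\<theta> (Poly_Mapping.single (\<sigma> (scale c a)) 1) = c * \<theta> (Poly_Mapping.single (\<sigma> a) 1)"
        if "\<sigma> \<in> slots2" for \<sigma> a b c
      proof -
        have "Poly_Mapping.single (\<sigma> (a + b)) 1 - Poly_Mapping.single (\<sigma> a) 1 - Poly_Mapping.single (\<sigma> b) 1 \<in> ?R"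
          "Poly_Mapping.single (\<sigma> (scale c a)) 1 - free_scale c (Poly_Mapping.single (\<sigma> a) 1) \<in> ?R"
          unfolding slot_relations_def using that by (blast intro: free.span_base)+
        from this[THEN \<theta>(2)] show "\<theta> (Poly_Mapping.single (\<sigma> (a + b)) 1)
            = \<theta> (Poly_Mapping.single (\<sigma> a) 1) + \<theta> (Poly_Mapping.single (\<sigma> b) 1)"
          "\<theta> (Poly_Mapping.single (\<sigma> (scale c a)) 1) = c * \<theta> (Poly_Mapping.single (\<sigma> a) 1)"
          by (simp_all add: free.lform_diff[OF \<theta>(1)] free.lform_scale[OF \<theta>(1)]
              free.lform_add[OF \<theta>(1)] algebra_simps)
      qed
      have slot: "(\<lambda>x. (x, b)) \<in> slots2" "(\<lambda>x. (b, x)) \<in> slots2" for b :: 'h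
        by (auto simp: slots2_def)
      have G: "bilin ?G"
        by (intro bilinI lin_coeff) (auto simp: lform_iff rel[OF slot(1)] rel[OF slot(2)])
      have p: "lin (\<lambda>x. ?p (f x))" if "lin f" for f using lin_comp[OF lin_proj[OF sub] that] .
      have Gp: "bilin (\<lambda>a b. ?G (?p a) (?p b))"
        by (intro bilinI lin_comp[OF bilinD(1)[OF G] lin_proj[OF sub]]
            lin_comp[OF bilinD(2)[OF G] lin_proj[OF sub]])
      have \<theta>_ext: "\<theta> w = counit (lin_ext scale (\<lambda>(a, b). ?G a b) w)" for w
      proof -
        have "w = lin_ext free_scale (\<lambda>x. Poly_Mapping.single x 1) w"
          by (rule poly_mapping_eqI)
            (simp add: lin_ext_def lookup_sum lookup_free_scale lookup_single when_def in_keys_iff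
              if_distrib[of "(*) _"] cong: if_cong)
        then have "\<theta> w = (\<Sum>x\<in>Poly_Mapping.keys w. Poly_Mapping.lookup w x * \<theta> (Poly_Mapping.single x 1))"
          by (metis (mono_tags, lifting) free.lform_scale[OF \<theta>(1)] free.lform_sum[OF \<theta>(1)] lin_ext_def sum.cong)
        also have "\<dots> = counit (lin_ext scale (\<lambda>(a, b). ?G a b) w)"
          by (simp add: lin_ext_def lform_sum[OF counit_lform] lform_scale[OF counit_lform] counit_one split_def)
        finally show ?thesis .
      qed
      have "lin_ext scale (\<lambda>(a, b). ?G a b) u = (\<Sum>(a, b)\<leftarrow>cop x. ?G a b)"
        by (simp add: sum_cop[OF G] u_def)
      also have "\<dots> = (\<Sum>(a, b)\<leftarrow>cop x. ?G (?p a) (?p b))"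
        by (rule sw.cop_restrict[OF C x G])
      also have "\<dots> = lin_ext scale (\<lambda>(a, b). ?G a b) v"
        unfolding sum_cop[OF Gp] v_def u_def
        by (simp add: lin_ext_lin_ext[OF vector_space_axioms] split_def lin_ext_single[OF vector_space_axioms])
      finally have "\<theta> u = \<theta> v" by (simp only: \<theta>_ext[of u] \<theta>_ext[of v])
      then show False using \<theta>(3) by (simp add: free.lform_diff[OF \<theta>(1)])
    qed
    obtain w where w: "comult x = tensor_class2 scale w" using comult_in by (auto simp: tensor_square_def)
    have "u - w \<in> ?R" unfolding u_def w by (rule coset_rep_class2)
    then have vw: "v - w \<in> ?R"
      using free.subspace_diff[OF subR \<open>u - w \<in> ?R\<close> \<open>u - v \<in> ?R\<close>] by simp
    have "tensor_class2 scale w = tensor_class2 scale v"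
    proof (intro set_eqI iffI)
      fix y assume "y \<in> tensor_class2 scale w"
      then have "y - w \<in> ?R" by (simp add: tensor_class2_def)
      from free.subspace_diff[OF subR this vw] show "y \<in> tensor_class2 scale v" by (simp add: tensor_class2_def)
    next
      fix y assume "y \<in> tensor_class2 scale v"
      then have "y - v \<in> ?R" by (simp add: tensor_class2_def)
      from free.subspace_add[OF subR this vw] show "y \<in> tensor_class2 scale w" by (simp add: tensor_class2_def)
    qed
    moreover have "v \<in> free.span ((\<lambda>x. Poly_Mapping.single x 1) ` (C \<times> C))"
      unfolding v_def lin_ext_def
      by (intro free.span_sum free.span_scale free.span_base) (auto simp: proj_in[OF sub] split_def)
    ultimately show ?thesis unfolding sub_tensor_square_def w by blast
  qed
  then show "subcoalgebra C" using sub by (auto simp: subcoalgebra_def)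
qed

lemma coradical_eq: "coradical = sw.corad"
  unfolding coradical_def sw.corad_def simple_subcoalgebra_def sw.simple_subcoal_def subcoalgebra_iff ..

lemma cocommutative_on_imp: "cocommutative_on C \<Longrightarrow> sw.cocommutative C"
  unfolding cocommutative_on_def sw.cocommutative_def
proof (intro ballI allI impI)
  fix x G assume coc: "\<forall>x\<in>C. tensor_flip scale (comult x) = comult x" and x: "x \<in> C" and G: "bilin G"
  have flip: "bilin (\<lambda>a b. G b a)" using G by (auto simp: bilin_def)
  have "tensor_eval G (comult x) = tensor_eval G (tensor_flip scale (comult x))" using coc x by simp
  also have "\<dots> = tensor_eval (\<lambda>a b. G b a) (comult x)"
    unfolding tensor_flip_def tensor_eval_class2[OF G]
    by (simp add: lin_ext_lin_ext[OF vector_space_axioms] split_def lin_ext_single[OF vector_space_axioms])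
  finally show "(\<Sum>(a, b)\<leftarrow>cop x. G a b) = (\<Sum>(a, b)\<leftarrow>cop x. G b a)"
    by (simp add: sum_cop[OF G] sum_cop[OF flip])
qed

lemma subalgebra_eq: "subalgebra = sw.subalg"
  by (intro ext) (simp add: subalgebra_def sw.subalg_def)

lemma affine_if_noetherian:
  assumes "left_noetherian TYPE('h) \<or> right_noetherian TYPE('h)"
    and "cocommutative_on coradical \<or> (\<forall>x\<in>hopf_coradical. \<forall>y\<in>hopf_coradical. x * y = y * x)
      \<or> (\<exists>B. finite B \<and> coradical = span B)"
  shows affine_algebra
proof -
  have "coradical \<subseteq> hopf_coradical" unfolding hopf_coradical_def by (rule hull_subset)
  then have cond: "sw.cocommutative sw.corad \<or> (\<forall>x\<in>sw.corad. \<forall>y\<in>sw.corad. x * y = y * x)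
      \<or> (\<exists>B. finite B \<and> sw.corad = span B)"
    using assms(2) cocommutative_on_imp unfolding coradical_eq by blast
  have "sw.lideal = left_ideal" "sw.rideal = right_ideal"
    by (intro ext, simp add: sw.lideal_def left_ideal_def, intro ext, simp add: sw.rideal_def right_ideal_def)
  then show ?thesis
    using assms(1) sw.affine_if_left_noetherian[OF _ cond] sw.affine_if_right_noetherian[OF _ cond]
    unfolding affine_algebra_def subalgebra_eq left_noetherian_def right_noetherian_def by metis
qed

end

theorem corollary6p6:
  fixes scale :: "'k::field \<Rightarrow> 'h::ring_1 \<Rightarrow> 'h"
    and comult :: "'h \<Rightarrow> ('h \<times> 'h \<Rightarrow>\<^sub>0 'k) set"
    and counit :: "'h \<Rightarrow> 'k"
    and antipode :: "'h \<Rightarrow> 'h"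
  assumes "hopf_algebra scale comult counit antipode"
    and "left_noetherian TYPE('h) \<or> right_noetherian TYPE('h)"
    and "k_coalgebra.cocommutative_on scale comult (k_coalgebra.coradical scale comult)
       \<or> (\<forall>x\<in>hopf_algebra.hopf_coradical scale comult.
            \<forall>y\<in>hopf_algebra.hopf_coradical scale comult. x * y = y * x)
       \<or> (\<exists>B. finite B \<and> k_coalgebra.coradical scale comult = module.span scale B)"
  shows "k_algebra.affine_algebra scale"
  using hopf_algebra.affine_if_noetherian[OF assms] .

end
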